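(* Let $\mathcal{A}\subseteq\mathbb{N}$ be a finite alphabet with $|\mathcal{A}|\ge 2$, and let $\delta_{\mathcal{A}}$ denote the Hausdorff dimension of the set $\mathcal{E}_{\mathcal{A}}$ of infinite continued fractions $[d_1,d_2,\ldots]$ all of whose partial quotients $d_j$ belong to $\mathcal{A}$. For $N\ge1$ let $$\mathcal{D}_{\mathcal{A}}(N)=\Bigl\{d\in\mathbb{N}\;\Bigl|\; d\le N,\ \exists\, b\in\mathbb{N}:\ \gcd(b,d)=1,\ \tfrac{b}{d}=[d_1,\ldots,d_k]\text{ for some }k\ge1\text{ and some } d_1,\ldots,d_k\in\mathcal{A}\Bigr\}.$$ If $\delta_{\mathcal{A}}>1-\frac{1}{8+\sqrt{34}}\ (=0.9276\ldots)$, then there is a constant $c=c(\mathcal{A})>0$ such that $\#\mathcal{D}_{\mathcal{A}}(N)\ge cN$ for all sufficiently large $N$ (i.e. $\#\mathcal{D}_{\mathcal{A}}(N)\gg N$).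
   Context: Finite continued fractions are written $[d_1,d_2,\ldots,d_k]=\cfrac{1}{d_1+\cfrac{1}{d_2+\cdots+\cfrac{1}{d_k}}}$ with positive integer partial quotients $d_j$; infinite continued fractions $[d_1,d_2,\ldots]$ are defined analogously as limits. The notation $f\gg g$ means $f\ge Cg$ for a positive constant $C$ depending only on the alphabet $\mathcal{A}$. *)

theory Defs
  imports "HOL-Analysis.Analysis"
begin

text \<open>
  Hausdorff measure and dimension. The case distinctions in \<open>hausdorff_gauge\<close> implement the usual
  conventions that the empty set contributes \<open>0\<close> and that \<open>(diam U)\<^sup>0 = 1\<close> for nonempty \<open>U\<close>
  (in the library, \<open>0 powr 0 = 0\<close>). Covering sets are required to be bounded because
  \<open>diameter\<close> is unspecified on unbounded sets.
\<close>

definition hausdorff_gauge :: "real \<Rightarrow> 'a::metric_space set \<Rightarrow> ennreal" where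
  "hausdorff_gauge s U =
     (if U = {} then 0 else if s = 0 then 1 else ennreal (diameter U powr s))"

definition hausdorff_premeasure :: "real \<Rightarrow> real \<Rightarrow> 'a::metric_space set \<Rightarrow> ennreal" where
  "hausdorff_premeasure s \<epsilon> E =
     Inf {(\<Sum>i. hausdorff_gauge s (U i)) | U :: nat \<Rightarrow> 'a set.
            E \<subseteq> (\<Union>i. U i) \<and> (\<forall>i. bounded (U i) \<and> diameter (U i) \<le> \<epsilon>)}"

definition hausdorff_measure :: "real \<Rightarrow> 'a::metric_space set \<Rightarrow> ennreal" where
  "hausdorff_measure s E = (SUP \<epsilon>\<in>{0<..}. hausdorff_premeasure s \<epsilon> E)"

definition hausdorff_dim :: "'a::metric_space set \<Rightarrow> ennreal" where
  "hausdorff_dim E = Inf {ennreal s | s. 0 \<le> s \<and> hausdorff_measure s E = 0}"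

text \<open>
  \<open>cfrac [d\<^sub>1, \<dots>, d\<^sub>k] = 1 / (d\<^sub>1 + 1 / (d\<^sub>2 + \<dots> + 1 / d\<^sub>k))\<close>; the value at the empty list
  only serves to start the recursion.
\<close>

fun cfrac :: "nat list \<Rightarrow> real" where
  "cfrac [] = 0"
| "cfrac (d # ds) = 1 / (real d + cfrac ds)"

definition cfrac_limit_set :: "nat set \<Rightarrow> real set" where
  "cfrac_limit_set A =
     {x. \<exists>d :: nat \<Rightarrow> nat. (\<forall>j. d j \<in> A) \<and> (\<lambda>k. cfrac (map d [0..<k])) \<longlonglongrightarrow> x}"

definition cfrac_denoms :: "nat set \<Rightarrow> nat \<Rightarrow> nat set" where
  "cfrac_denoms A N =
     {d. 1 \<le> d \<and> d \<le> N \<and>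
         (\<exists>b \<ge> 1. coprime b d \<and>
            (\<exists>ds. ds \<noteq> [] \<and> set ds \<subseteq> A \<and> real b / real d = cfrac ds))}"

end

theory Submission
  imports Defs
begin

text \<open>
  Let \<open>\<delta>\<close> be the exponent for which the sums \<open>\<Sum> q(w)\<^bsup>-2\<delta>\<^esup>\<close> over the words \<open>w\<close> of length \<open>n\<close> stay
  bounded above and below, where \<open>q\<close> is the denominator of the continued fraction; covering by cylinders
  shows that \<open>\<delta>\<close> is at least the Hausdorff dimension. About \<open>N\<^bsup>2\<delta>\<^esup>\<close> words have a
  denominator of order \<open>N\<close>, so by Cauchy-Schwarz it suffices to show that only \<open>O(N\<^bsup>4\<delta>-1\<^esup>)\<close> pairs of
  words have equal denominators. By Parseval this is a mean square bound for the
  exponential sum \<open>S(\<theta>) = \<Sum> e(\<theta> q(w))\<close> (with a smooth cut-off) over the fractions \<open>\<theta> = j/P\<close>, \<open>P\<close> of order \<open>N\<close>.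

  Cutting each word as \<open>w = uv\<close> with \<open>q(u)\<close> of order \<open>M\<close> turns \<open>q(w)\<close> into the inner product of
  \<open>(q(u), q'(u))\<close> and the primitive vector \<open>(q(v), p(v))\<close>. A large sieve argument, in which \<open>u\<close> is
  replaced by all integer vectors of size \<open>M\<close>, reduces the bound to counting the pairs \<open>(\<theta>', v')\<close> for which
  \<open>\<theta>'(q(v'), p(v'))\<close> is close to \<open>\<theta>(q(v), p(v))\<close> modulo \<open>1\<close>. Write \<open>\<theta> = a/q + \<beta>\<close> by Dirichlet's theorem and
  let \<open>X = q(1 + N|\<beta>|)\<close>. If \<open>X\<close> is at most a small power of \<open>N\<close>, take \<open>M\<close> of order \<open>X\<^sup>4\<close>: primitivity forces
  equal denominators of \<open>\<theta>\<close> and \<open>\<theta>'\<close>, the two vectors are proportional modulo \<open>q\<close> and nearly parallel, and the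
  count gains a factor \<open>X\<^bsup>1-2\<delta>\<^esup>\<close>, which beats the loss \<open>M\<^bsup>2-2\<delta>\<^esup>\<close>. Otherwise take
  \<open>M = N\<^bsup>4/5\<^esup>\<close>: the determinant \<open>m\<close> of the two vectors has \<open>\<theta>m\<close> close to an integer, which leaves few
  values of \<open>m\<close>, and \<open>m\<close> determines \<open>v'\<close> up to boundedly many choices.
\<close>

section \<open>Continuants\<close>

text \<open>In the generic range the sieve costs \<open>M\<^sup>2\<close>, and of about
  \<open>(N / M)\<^sup>2\<close> determinants a proportion \<open>1 / X\<close> survives. So
  \<open>M\<close> cancels, and \<open>N\<^sup>2 / X\<close> has to stay below
  \<open>N powr (2 * \<delta>)\<close>: \<open>X\<close> must exceed
  \<open>N powr (2 - 2 * \<delta>)\<close>. The split is made at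
  \<open>X = N powr (16 / 100)\<close>, while \<delta> \<ge> 37/40 means 2 - 2 \<delta> \<le>
  15/100; the spare hundredth pays for the logarithm lost in the dyadic summation. The bound 1 -
  1/(8 + sqrt 34) lies just above 37/40. \<open>M\<close> itself is restricted by the Dirichlet
  parameter \<open>T\<close>: it must exceed \<open>(N / M)\<^sup>2\<close>, to make \<beta>m
  negligible, and stay below \<open>M\<^sup>2 / (N * X)\<close>, to force \<theta>m near an integer
  only for multiples of \<open>q\<close>. At the split this leaves room only if \<open>M\<close> is
  at least \<open>N powr (79 / 100)\<close>. For small \<open>X\<close> the obstacle is to turn
  approximate coincidences modulo 1 into exact congruences; \<open>M\<close> of order
  \<open>X ^ 4\<close> makes all errors, multiplied by both denominators, less than 1.\<close>

fun den :: "nat list \<Rightarrow> int" and num :: "nat list \<Rightarrow> int" where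
  "den [] = 1"
| "den (a # w) = int a * den w + num w"
| "num [] = 0"
| "num (a # w) = den w"

text \<open>With \<open>den\<close> and \<open>num\<close> these are the entries of the product of
  the matrices (a 1; 1 0) over the letters: first row \<open>den\<close>, \<open>denp\<close>,
  second row \<open>num\<close>, \<open>nump\<close>. For a nonempty word \<open>denp\<close> is the
  denominator left after removing the last letter.\<close>

fun denp :: "nat list \<Rightarrow> int" and nump :: "nat list \<Rightarrow> int" where
  "denp [] = 0"
| "denp (a # w) = int a * denp w + nump w"
| "nump [] = 1"
| "nump (a # w) = denp w"

text \<open>First column of the product of the matrices of \<open>u\<close> and
  \<open>v\<close>.\<close>

lemma den_num_append:
  "den (u @ v) = den u * den v + denp u * num v \<and> num (u @ v) = num u * den v + nump u * num v"
  by (induction u) (auto simp: algebra_simps)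

lemmas den_append = den_num_append[THEN conjunct1]
lemmas num_append = den_num_append[THEN conjunct2]

lemma denp_nump_append:
  "denp (u @ v) = den u * denp v + denp u * nump v \<and> nump (u @ v) = num u * denp v + nump u * nump v"
  by (induction u) (auto simp: algebra_simps)

text \<open>Every letter contributes a factor of determinant -1. This unimodularity lets
  determinants pass through common prefixes and lets the matrix of a word be inverted over the
  integers.\<close>

lemma continuant_det: "den u * nump u - denp u * num u = (- 1) ^ length u"
proof (induction u)
  case (Cons a u)
  have "den (a # u) * nump (a # u) - denp (a # u) * num (a # u) = - (den u * nump u - denp u * num u)"
    by (simp add: algebra_simps)
  then show ?case using Cons by simp
qed simp

text \<open>All factors are symmetric, so reversing the word transposes its matrix.\<close>

lemma continuant_rev:
  "den (rev w) = den w \<and> num (rev w) = denp w \<and> denp (rev w) = num w \<and> nump (rev w) = nump w"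
  by (induction w) (auto simp: den_append num_append denp_nump_append)

lemma den_snoc: "den (w @ [a]) = int a * den w + denp w"
  by (simp add: den_append)

lemma num_nonneg: "0 \<le> num w" and den_nonneg: "0 \<le> den w"
  by (induction w) auto

lemma nump_nonneg: "0 \<le> nump w" and denp_nonneg: "0 \<le> denp w"
  by (induction w) auto

lemma den_pos: "0 \<notin> set w \<Longrightarrow> 1 \<le> den w"
proof (induction w)
  case (Cons a w)
  then have "1 * 1 \<le> int a * den w" by (intro mult_mono) auto
  then show ?case using num_nonneg[of w] by simp
qed simp

lemma num_le_den: "0 \<notin> set w \<Longrightarrow> num w \<le> den w"
proof (cases w)
  case (Cons a v)
  assume "0 \<notin> set w"
  then have "1 * den v \<le> int a * den v"
    using Cons den_nonneg[of v] by (intro mult_right_mono) auto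
  then show ?thesis using Cons num_nonneg[of v] by simp
qed simp

lemma denp_le_den: "0 \<notin> set w \<Longrightarrow> denp w \<le> den w"
  using num_le_den[of "rev w"] continuant_rev[of w] by simp

lemma den_append_ge: "0 \<notin> set u \<Longrightarrow> 0 \<notin> set v \<Longrightarrow> den u * den v \<le> den (u @ v)"
  by (simp add: den_append denp_nonneg num_nonneg)

lemma den_append_le:
  assumes "0 \<notin> set u" "0 \<notin> set v"
  shows "den (u @ v) \<le> 2 * den u * den v"
proof -
  have "denp u * num v \<le> den u * den v"
    using assms by (intro mult_mono denp_le_den num_le_den den_nonneg num_nonneg)
  then show ?thesis by (simp add: den_append)
qed

lemma den_append_left_le:
  assumes "0 \<notin> set u" "0 \<notin> set v" shows "den u \<le> den (u @ v)"
proof -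
  have "den u * 1 \<le> den u * den v"
    using assms by (intro mult_left_mono den_pos den_nonneg)
  then show ?thesis using den_append_ge[OF assms] by simp
qed

text \<open>By the two-step recursion each further letter adds at least
  \<open>den w \<ge> 1\<close>. Linear growth is enough to make sets of words with bounded
  denominator finite.\<close>

lemma den_ge_length: "0 \<notin> set w \<Longrightarrow> int (length w) \<le> den w"
proof (induction w rule: induct_list012)
  case (3 a b w)
  have "1 * den (b # w) \<le> int a * den (b # w)"
    using 3(3) by (intro mult_right_mono den_nonneg) auto
  moreover have "int (length (b # w)) \<le> den (b # w)" "1 \<le> den w" using 3 den_pos[of w] by auto
  moreover have "den (a # b # w) = int a * den (b # w) + den w" by (simp only: den.simps num.simps)
  ultimately show ?case unfolding list.size by linarith
qed auto

lemma coprime_den_num: "coprime (den w) (num w)"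
proof (rule coprimeI)
  fix d assume "d dvd den w" "d dvd num w"
  then have "d dvd den w * nump w - denp w * num w" by auto
  then show "is_unit d"
    unfolding continuant_det by (metis dvd_trans dvd_def minus_one_mult_self)
qed

lemma den_eq_one_num_zero: "0 \<notin> set w \<Longrightarrow> num w = 0 \<Longrightarrow> w = []"
  using den_pos by (cases w) force+

lemma num_eq_den: "0 \<notin> set w \<Longrightarrow> num w = den w \<Longrightarrow> w = [1]"
proof (cases w)
  case (Cons a v)
  assume w: "0 \<notin> set w" "num w = den w"
  have a: "1 \<le> int a" and v: "1 \<le> den v" using w Cons den_pos[of v] by auto
  have "num v = (1 - int a) * den v" using w Cons by (simp add: algebra_simps)
  moreover have "(1 - int a) * den v \<le> 0"
    using a v by (simp add: mult_nonpos_nonneg)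
  ultimately have "num v = 0" "(1 - int a) * den v = 0" using num_nonneg[of v] by auto
  then have "int a = 1" "v = []" using v w Cons den_eq_one_num_zero[of v] by auto
  then show ?thesis using Cons by simp
qed simp

text \<open>The parity is needed because \<open>[\<dots>, a, 1]\<close> and \<open>[\<dots>, a + 1]\<close> represent the same rational.\<close>

lemma word_unique:
  "0 \<notin> set v \<Longrightarrow> 0 \<notin> set v' \<Longrightarrow> den v = den v' \<Longrightarrow> num v = num v' \<Longrightarrow>
    even (length v) = even (length v') \<Longrightarrow> v = v'"
proof (induction v arbitrary: v')
  case Nil
  then show ?case using den_eq_one_num_zero[of v'] by simp
next
  case (Cons a w)
  then obtain b w' where v': "v' = b # w'"
    using den_eq_one_num_zero[of "a # w"] by (cases v') auto
  have w: "0 \<notin> set w" "0 \<notin> set w'" "den w = den w'"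
    and eq: "int a * den w + num w = int b * den w + num w'"
    and par: "even (length w) = even (length w')"
    using Cons.prems v' by auto
  have pos: "1 \<le> den w" using den_pos w by blast
  have "int a = int b \<and> num w = num w'"
  proof -
    \<comment> \<open>Division by \<open>den w\<close> recovers the first letter unless a numerator
      equals the denominator, which happens only for the tail \<open>[1]\<close>. The mixed cases
      would compare the tails \<open>[1]\<close> and \<open>[]\<close> and contradict
      parity.\<close>
    consider "num w = den w" "num w' = den w'" | "num w = den w" "num w' < den w'"
      | "num w < den w" "num w' = den w'" | "num w < den w" "num w' < den w'"
      using num_le_den w by (metis order_le_less)
    then show ?thesis
    proof cases
      case 1 then show ?thesis using eq w pos by auto
    next
      case 2
      then have "w = [1]" using num_eq_den w by blast
      then have "num w' = 0" using 2 w num_nonneg[of w'] by simp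
      then have "w' = []" using den_eq_one_num_zero w by blast
      then show ?thesis using par \<open>w = [1]\<close> by simp
    next
      case 3
      then have "w' = [1]" using num_eq_den w by blast
      then have "num w = 0" using 3 w num_nonneg[of w] by simp
      then have "w = []" using den_eq_one_num_zero w by blast
      then show ?thesis using par \<open>w' = [1]\<close> by simp
    next
      case 4
      have "(int a * den w + num w) div den w = int a"
        using 4 num_nonneg[of w] pos by simp
      moreover have "(int b * den w + num w') div den w = int b"
        using 4 num_nonneg[of w'] pos w by simp
      ultimately have "int a = int b" using eq by simp
      then show ?thesis using eq by simp
    qed
  qed
  then show ?case using Cons.IH[of w'] w par v' by auto
qed

lemma word_unique_prefix:
  assumes "0 \<notin> set v" "0 \<notin> set v'" "den v = den v'" "denp v = denp v'"
    "even (length v) = even (length v')"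
  shows "v = v'"
  using word_unique[of "rev v" "rev v'"] assms continuant_rev[of v] continuant_rev[of v']
  by simp

section \<open>Values of finite continued fractions\<close>

lemma cfrac_eq: "0 \<notin> set w \<Longrightarrow> cfrac w = num w / den w"
proof (induction w)
  case (Cons a w)
  have "1 \<le> den w" using Cons.prems den_pos by simp
  then have "real_of_int (den w) > 0" by simp
  moreover have "cfrac w = num w / den w" using Cons by simp
  moreover have "real a + num w / den w = (int a * den w + num w) / den w"
    using \<open>real_of_int (den w) > 0\<close> by (simp add: field_simps)
  ultimately show ?case by simp
qed simp

text \<open>The cross difference of the two fractions is \<open>num v\<close> times the determinant
  of \<open>u\<close>, and \<open>den (u @ v) \<ge> den u * den v\<close>. Hence all continuations
  of \<open>u\<close> stay within \<open>1 / (den u)\<^sup>2\<close>, the scale of the covering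
  argument and of every later localisation.\<close>

lemma cfrac_append_dist:
  assumes "0 \<notin> set u" "0 \<notin> set v"
  shows "\<bar>cfrac (u @ v) - cfrac u\<bar> \<le> 1 / (den u)\<^sup>2"
proof -
  let ?u = "real_of_int (den u)" and ?v = "real_of_int (den v)" and ?w = "real_of_int (den (u @ v))"
  have "num (u @ v) * den u - num u * den (u @ v) = num v * (den u * nump u - denp u * num u)"
    by (simp add: den_append num_append algebra_simps)
  also have "\<bar>\<dots>\<bar> = num v"
    unfolding continuant_det by (simp add: abs_mult num_nonneg power_abs)
  finally have "\<bar>num (u @ v) * den u - num u * den (u @ v)\<bar> = num v" .
  then have eq: "\<bar>num (u @ v) * ?u - num u * ?w\<bar> = real_of_int (num v)"
    by (metis of_int_abs of_int_diff of_int_mult)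
  have pos: "?u \<ge> 1" "?v \<ge> 1" "?w \<ge> 1" using den_pos assms by (auto simp del: den.simps)
  have "?u * ?v \<le> ?w" using den_append_ge[OF assms] by (metis of_int_le_iff of_int_mult)
  moreover have "real_of_int (num v) \<le> ?v" using num_le_den assms by simp
  ultimately have nle: "real_of_int (num v) * ?u \<le> ?w"
    using pos by (smt (verit, best) mult.commute mult_left_mono)
  have "cfrac (u @ v) - cfrac u = (num (u @ v) * ?u - num u * ?w) / (?u * ?w)"
    using pos assms by (simp add: cfrac_eq field_simps)
  then have "\<bar>cfrac (u @ v) - cfrac u\<bar> = real_of_int (num v) / (?u * ?w)"
    using eq pos by (simp add: abs_mult)
  also have "\<dots> \<le> 1 / ?u\<^sup>2"
    using nle pos by (simp add: field_simps power2_eq_square)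
  finally show ?thesis by simp
qed

section \<open>The critical exponent of an alphabet\<close>

locale alphabet =
  fixes A :: "nat set"
  assumes finite_A: "finite A" and zero_notin_A: "0 \<notin> A" and two_le_card: "2 \<le> card A"
begin

section \<open>Words over the alphabet and their partition functions\<close>

definition words :: "nat \<Rightarrow> nat list set" where
  "words n = {w. set w \<subseteq> A \<and> length w = n}"

text \<open>A cylinder has length of order \<open>1 / (den w)\<^sup>2\<close>, so up to constants
  this is the sum of the \<open>s\<close>-th powers of the cylinder lengths.\<close>

definition psum :: "real \<Rightarrow> nat \<Rightarrow> real" where
  "psum s n = (\<Sum>w\<in>words n. den w powr (- 2 * s))"

lemma word_pos: "set w \<subseteq> A \<Longrightarrow> 0 \<notin> set w"
  using zero_notin_A by auto

lemma den_word_ge1: "set w \<subseteq> A \<Longrightarrow> 1 \<le> real_of_int (den w)"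
  using den_pos[OF word_pos] by (simp del: den.simps)

lemma finite_words: "finite (words n)"
  unfolding words_def using finite_lists_length_eq[OF finite_A] .

lemma card_words: "card (words n) = card A ^ n"
  unfolding words_def using card_lists_length_eq[OF finite_A] .

lemma sum_words_add: "(\<Sum>w\<in>words (n + m). g w) = (\<Sum>u\<in>words n. \<Sum>v\<in>words m. g (u @ v))"
proof -
  have "inj_on (\<lambda>(u, v). u @ v) (words n \<times> words m)"
    by (auto simp: inj_on_def words_def)
  moreover have "(\<lambda>(u, v). u @ v) ` (words n \<times> words m) = words (n + m)"
  proof (intro equalityI subsetI)
    fix w assume "w \<in> words (n + m)"
    then have "(take n w, drop n w) \<in> words n \<times> words m" "w = take n w @ drop n w"
      using set_take_subset[of n w] set_drop_subset[of n w] by (auto simp: words_def)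
    then show "w \<in> (\<lambda>(u, v). u @ v) ` (words n \<times> words m)" by (metis case_prod_conv image_eqI)
  qed (auto simp: words_def)
  ultimately have "(\<Sum>w\<in>words (n + m). g w) = (\<Sum>p\<in>words n \<times> words m. g ((\<lambda>(u, v). u @ v) p))"
    by (metis (no_types, lifting) sum.reindex_cong)
  then show ?thesis by (simp add: sum.cartesian_product case_prod_unfold)
qed

text \<open>Quasi-multiplicativity
  \<open>den u * den v \<le> den (u @ v) \<le> 2 * den u * den v\<close>, raised to the power
  \<open>- 2 * s\<close>; the factor 2 turns into \<open>4 powr s\<close>.\<close>

lemma den_append_powr:
  assumes "set u \<subseteq> A" "set v \<subseteq> A" "0 \<le> s"
  shows "den (u @ v) powr (- 2 * s) \<le> den u powr (- 2 * s) * den v powr (- 2 * s)"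
    and "den u powr (- 2 * s) * den v powr (- 2 * s) \<le> 4 powr s * den (u @ v) powr (- 2 * s)"
proof -
  note pos = den_word_ge1[OF assms(1)] den_word_ge1[OF assms(2)] den_word_ge1[of "u @ v"]
  have ge: "real_of_int (den u) * den v \<le> den (u @ v)"
    using den_append_ge word_pos assms by (metis of_int_le_iff of_int_mult)
  have "den (u @ v) \<le> 2 * den u * den v"
    using den_append_le word_pos assms by blast
  then have "real_of_int (den (u @ v)) \<le> real_of_int (2 * den u * den v)"
    using of_int_le_iff by blast
  then have le: "real_of_int (den (u @ v)) \<le> 2 * (real_of_int (den u) * den v)" by simp
  have uv: "real_of_int (den u) * den v > 0" using pos by simp
  have "den (u @ v) powr (- 2 * s) \<le> (real_of_int (den u) * den v) powr (- 2 * s)"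
    using ge uv assms by (intro powr_mono2') auto
  then show "den (u @ v) powr (- 2 * s) \<le> den u powr (- 2 * s) * den v powr (- 2 * s)"
    using pos by (simp add: powr_mult)
  have "(2 * (real_of_int (den u) * den v)) powr (- 2 * s) \<le> den (u @ v) powr (- 2 * s)"
    using le pos assms by (intro powr_mono2') auto
  moreover have "(2::real) powr (- 2 * s) = inverse (4 powr s)"
    using powr_powr[of 2 2 s] by (simp add: powr_minus powr_numeral)
  ultimately have "inverse (4 powr s) * (den u powr (- 2 * s) * den v powr (- 2 * s))
      \<le> den (u @ v) powr (- 2 * s)"
    using pos by (simp add: powr_mult)
  then show "den u powr (- 2 * s) * den v powr (- 2 * s) \<le> 4 powr s * den (u @ v) powr (- 2 * s)"
    by (simp add: field_simps)
qed

lemma psum_nonneg: "0 \<le> psum s n"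
  unfolding psum_def by (intro sum_nonneg) auto

lemma psum_0: "psum s 0 = 1"
proof -
  have "words 0 = {[]}" by (auto simp: words_def)
  then show ?thesis by (simp add: psum_def)
qed

lemma psum_add_le: "0 \<le> s \<Longrightarrow> psum s (n + m) \<le> psum s n * psum s m"
  unfolding psum_def sum_words_add sum_product
  by (intro sum_mono den_append_powr) (auto simp: words_def)

lemma psum_add_ge: "0 \<le> s \<Longrightarrow> psum s n * psum s m \<le> 4 powr s * psum s (n + m)"
proof -
  assume "0 \<le> s"
  then have "psum s n * psum s m
      \<le> (\<Sum>u\<in>words n. \<Sum>v\<in>words m. 4 powr s * den (u @ v) powr (- 2 * s))"
    unfolding psum_def sum_product
    by (intro sum_mono den_append_powr) (auto simp: words_def)
  then show ?thesis by (simp add: psum_def sum_words_add sum_distrib_left)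
qed

lemma psum_mult_le: "0 \<le> s \<Longrightarrow> psum s (k * n) \<le> psum s n ^ k"
proof (induction k)
  case (Suc k)
  have "psum s (Suc k * n) \<le> psum s n * psum s (k * n)"
    using psum_add_le[of s n "k * n"] Suc by simp
  also have "\<dots> \<le> psum s n * psum s n ^ k"
    using Suc by (intro mult_left_mono psum_nonneg) auto
  finally show ?case by simp
qed (simp add: psum_0)

lemma psum_mult_ge: "0 \<le> s \<Longrightarrow> (psum s n / 4 powr s) ^ k \<le> psum s (k * n)"
proof (induction k)
  case (Suc k)
  have "(psum s n / 4 powr s) ^ Suc k \<le> psum s n / 4 powr s * psum s (k * n)"
    unfolding power_Suc using Suc psum_nonneg[of s n] by (intro mult_left_mono) auto
  also have "\<dots> \<le> psum s (n + k * n)"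
    using psum_add_ge[of s n "k * n"] Suc by (simp add: field_simps)
  finally show ?case by simp
qed (simp add: psum_0)

lemma psum_antimono: "s \<le> t \<Longrightarrow> psum t n \<le> psum s n"
  unfolding psum_def using den_word_ge1
  by (intro sum_mono powr_mono) (auto simp: words_def)

lemma isCont_psum: "isCont (\<lambda>s. psum s n) t"
proof -
  have "den w \<noteq> 0" if "w \<in> words n" for w
    using den_word_ge1[of w] that by (auto simp: words_def)
  then show ?thesis unfolding psum_def by (intro continuous_intros) auto
qed

text \<open>\<delta> is the supremum of the \<open>s\<close> with all
  \<open>psum s n \<ge> 1\<close>; the lower bound persists at \<delta> by continuity. If
  \<open>psum \<delta> m\<close> exceeded \<open>4 powr \<delta>\<close>, then
  \<open>psum s m > 4 powr s\<close> would still hold for some \<open>s > \<delta>\<close>. With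
  \<open>psum s n < 1\<close> the two halves of quasi-multiplicativity contradict each other at
  length \<open>m * n\<close>. The two-sided bound plays the part of a conformal measure.\<close>

lemma ex_critical_exponent:
  "\<exists>\<delta>\<ge>0. (\<forall>n. 1 \<le> psum \<delta> n \<and> psum \<delta> n \<le> 4 powr \<delta>) \<and> (\<forall>s>\<delta>. \<exists>n. psum s n < 1)"
proof -
  define S where "S = {s. 0 \<le> s \<and> (\<forall>n. 1 \<le> psum s n)}"
  have "psum 0 n \<ge> 1" for n
  proof -
    have "psum 0 n = (\<Sum>w\<in>words n. 1)"
      unfolding psum_def using den_word_ge1 by (intro sum.cong) (force simp: words_def)+
    then have "psum 0 n = real (card A ^ n)" by (simp add: card_words)
    moreover have "1 \<le> card A ^ n" using two_le_card by simp
    ultimately show ?thesis by linarith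
  qed
  then have 0: "0 \<in> S" by (simp add: S_def)
  define t where "t = real (card A)"
  \<comment> \<open>Length 2 is needed because the letter 1 alone has denominator 1, whereas words
    of length 2 have denominator at least 2. Then \<open>card A < 2 ^ card A\<close> makes
    \<open>card A\<close> an upper bound for \<open>S\<close>.\<close>
  have t: "psum t 2 < 1"
  proof -
    have "psum t 2 \<le> (\<Sum>w\<in>words 2. 2 powr (- 2 * t))"
      unfolding psum_def
    proof (intro sum_mono powr_mono2')
      fix w assume "w \<in> words 2"
      then have "int 2 \<le> den w" using den_ge_length[OF word_pos] by (metis (mono_tags) mem_Collect_eq words_def)
      then show "2 \<le> real_of_int (den w)" by simp
    qed (auto simp: t_def)
    also have "\<dots> = real (card A) ^ 2 * 2 powr (- 2 * t)" by (simp add: card_words)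
    also have "2 powr (- 2 * t) = inverse ((2 ^ card A) ^ 2)"
      by (simp add: t_def powr_minus powr_realpow power_mult[symmetric] mult.commute flip: powr_numeral)
        (metis of_nat_mult of_nat_numeral powr_realpow zero_less_numeral mult.commute)
    also have "real (card A) ^ 2 * inverse ((2 ^ card A) ^ 2) < 1"
    proof -
      have "real (card A) < 2 ^ card A" by simp
      then have "real (card A) ^ 2 < (2 ^ card A) ^ 2" by (intro power_strict_mono) auto
      then show ?thesis by (simp add: field_simps)
    qed
    finally show ?thesis .
  qed
  have bdd: "s \<le> t" if "s \<in> S" for s
  proof (rule ccontr)
    assume "\<not> s \<le> t"
    then have "psum s 2 < 1" using psum_antimono[of t s 2] t by simp
    moreover have "1 \<le> psum s 2" using that unfolding S_def by blast
    ultimately show False by simp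
  qed
  define \<delta> where "\<delta> = Sup S"
  have le: "s \<le> \<delta>" if "s \<in> S" for s
    unfolding \<delta>_def using that bdd by (intro cSup_upper bdd_aboveI)
  have nonneg: "0 \<le> \<delta>" using le 0 by blast
  have lower: "1 \<le> psum \<delta> n" for n
  proof (rule ccontr)
    assume "\<not> 1 \<le> psum \<delta> n"
    then have "eventually (\<lambda>s. psum s n < 1) (nhds \<delta>)"
      using isCont_psum[where n = n and t = \<delta>] by (intro order_tendstoD(2)[of "\<lambda>s. psum s n" "psum \<delta> n"])
        (auto simp: isCont_def tendsto_nhds_iff)
    then obtain e where e: "e > 0" "\<And>s. dist s \<delta> < e \<Longrightarrow> psum s n < 1"
      unfolding eventually_nhds_metric by blast
    have "s \<le> \<delta> - e / 2" if "s \<in> S" for s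
    proof (rule ccontr)
      assume "\<not> s \<le> \<delta> - e / 2"
      then have "psum s n \<le> psum (\<delta> - e / 2) n" by (intro psum_antimono) auto
      also have "\<dots> < 1" using e by (auto simp: dist_real_def)
      finally have "psum s n < 1" .
      moreover have "1 \<le> psum s n" using that unfolding S_def by blast
      ultimately show False by simp
    qed
    then have "\<delta> \<le> \<delta> - e / 2" unfolding \<delta>_def using 0 by (intro cSup_least) auto
    then show False using e by simp
  qed
  have above: "\<exists>n. psum s n < 1" if "s > \<delta>" for s
  proof (rule ccontr)
    assume "\<nexists>n. psum s n < 1"
    then have "s \<in> S" using that nonneg by (auto simp: S_def not_less)
    then show False using le that by force
  qed
  have upper: "psum \<delta> m \<le> 4 powr \<delta>" for m
  proof (rule ccontr)
    assume "\<not> psum \<delta> m \<le> 4 powr \<delta>"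
    moreover have "isCont (\<lambda>s. psum s m - 4 powr s) \<delta>"
      by (intro continuous_intros isCont_psum) auto
    ultimately have "eventually (\<lambda>s. 0 < psum s m - 4 powr s) (nhds \<delta>)"
      by (intro order_tendstoD(1)[of "\<lambda>s. psum s m - 4 powr s" "psum \<delta> m - 4 powr \<delta>"])
        (auto simp: isCont_def tendsto_nhds_iff)
    then obtain e where e: "e > 0" "\<And>s. dist s \<delta> < e \<Longrightarrow> 0 < psum s m - 4 powr s"
      unfolding eventually_nhds_metric by blast
    define s where "s = \<delta> + e / 2"
    have s: "4 powr s < psum s m" "s > \<delta>" "0 \<le> s"
      using e(2)[of s] e(1) nonneg by (auto simp: s_def dist_real_def)
    obtain n where n: "psum s n < 1" using above s by blast
    have "1 \<le> 4 powr s" using s by (intro ge_one_powr_ge_zero) auto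
    then have "m \<noteq> 0" using s psum_0[of s] by (intro notI) simp
    then have "psum s n ^ m < 1" using n psum_nonneg[of s n] by (simp add: power_less_one_iff)
    then have "psum s (m * n) < 1" using psum_mult_le[OF s(3), of m n] by simp
    moreover have "1 \<le> (psum s m / 4 powr s) ^ n" using s by (intro one_le_power) (simp add: field_simps)
    ultimately show False using psum_mult_ge[OF s(3), of m n] by (simp add: mult.commute)
  qed
  show ?thesis using nonneg lower upper above by blast
qed

text \<open>The balls of radius \<open>1 / (den w)\<^sup>2\<close> around \<open>cfrac w\<close>,
  for the words of length \<open>k * n\<close>, cover the limit set and cost at most
  \<open>2 powr s * psum s n ^ k\<close>, which tends to 0 as \<open>k\<close> grows.\<close>

lemma hausdorff_measure_limit_set_eq_0:
  assumes s: "0 < s" and n: "psum s n < 1"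
  shows "hausdorff_measure s (cfrac_limit_set A) = 0"
proof -
  have "hausdorff_premeasure s \<epsilon> (cfrac_limit_set A) \<le> 0" if \<epsilon>: "\<epsilon> > 0" for \<epsilon>
  proof (rule tendsto_lowerbound)
    have "n \<noteq> 0" using n psum_0 by (metis less_irrefl)
    show "((\<lambda>k. ennreal (2 powr s * psum s n ^ k)) \<longlongrightarrow> 0) sequentially"
    proof -
      have "(\<lambda>k. 2 powr s * psum s n ^ k) \<longlonglongrightarrow> 2 powr s * 0"
        using n psum_nonneg[of s n] by (intro tendsto_intros LIMSEQ_realpow_zero) auto
      then have "(\<lambda>k. ennreal (2 powr s * psum s n ^ k)) \<longlonglongrightarrow> ennreal 0"
        by (intro tendsto_ennrealI) simp
      then show ?thesis by simp
    qed
    have "(\<lambda>k. 2 / (real k)\<^sup>2) \<longlonglongrightarrow> 0"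
      by (intro tendsto_divide_0[OF tendsto_const] filterlim_at_top_imp_at_infinity
          filterlim_pow_at_top filterlim_real_sequentially) auto
    then have "eventually (\<lambda>k. 2 / (real k)\<^sup>2 < \<epsilon>) sequentially"
      using \<epsilon> by (rule order_tendstoD)
    then show "eventually (\<lambda>k. hausdorff_premeasure s \<epsilon> (cfrac_limit_set A)
        \<le> ennreal (2 powr s * psum s n ^ k)) sequentially"
      using eventually_gt_at_top[of 0]
    proof eventually_elim
      case (elim k)
      let ?K = "k * n"
      obtain ws where ws: "set ws = words ?K" "distinct ws"
        using finite_distinct_list[OF finite_words] by blast
      \<comment> \<open>The finite cover is continued to a sequence by empty sets, whose gauge is
        0.\<close>
      define U where "U i = (if i < length ws then cball (cfrac (ws ! i)) (1 / (den (ws ! i))\<^sup>2) else {})"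
        for i
      have wsA: "set (ws ! i) \<subseteq> A" "length (ws ! i) = ?K" if "i < length ws" for i
        using ws nth_mem[OF that] by (auto simp: words_def)
      have cover: "cfrac_limit_set A \<subseteq> (\<Union>i. U i)"
      proof
        fix x assume "x \<in> cfrac_limit_set A"
        then obtain d where d: "\<forall>j. d j \<in> A" "(\<lambda>k. cfrac (map d [0..<k])) \<longlonglongrightarrow> x"
          by (auto simp: cfrac_limit_set_def)
        define w where "w = map d [0..<?K]"
        have w: "w \<in> words ?K" using d by (auto simp: w_def words_def)
        then obtain i where i: "i < length ws" "ws ! i = w" using ws by (metis in_set_conv_nth)
        have "x \<in> cball (cfrac w) (1 / (den w)\<^sup>2)"
        proof (rule Lim_in_closed_set[OF closed_cball _ _ d(2)])
          show "\<forall>\<^sub>F j in sequentially. cfrac (map d [0..<j]) \<in> cball (cfrac w) (1 / (den w)\<^sup>2)"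
            using eventually_ge_at_top[of ?K]
          proof eventually_elim
            case (elim j)
            then have "map d [0..<j] = w @ map d [?K..<j]"
              unfolding w_def map_append[symmetric] by (metis le0 upt_add_eq_append le_add_diff_inverse)
            moreover have "\<bar>cfrac (w @ map d [?K..<j]) - cfrac w\<bar> \<le> 1 / (den w)\<^sup>2"
              using w d by (intro cfrac_append_dist word_pos) (auto simp: words_def)
            ultimately show ?case by (simp add: dist_real_def abs_minus_commute)
          qed
        qed simp
        then show "x \<in> (\<Union>i. U i)" using i by (auto simp: U_def)
      qed
      \<comment> \<open>Denominators are at least the length of the word, so the diameters shrink
        uniformly, at least as fast as \<open>2 / k\<^sup>2\<close>.\<close>
      have diam: "bounded (U i) \<and> diameter (U i) \<le> \<epsilon>" for i
      proof (cases "i < length ws")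
        case True
        have "real ?K \<le> real_of_int (den (ws ! i))"
          using den_ge_length[OF word_pos[OF wsA(1)[OF True]]] wsA(2)[OF True]
          by (metis of_int_le_iff of_int_of_nat_eq)
        moreover have "real k \<le> real ?K" using \<open>n \<noteq> 0\<close> by (simp add: mult_le_cancel_left1)
        ultimately have "real k \<le> real_of_int (den (ws ! i))" by linarith
        then have "(real k)\<^sup>2 \<le> (real_of_int (den (ws ! i)))\<^sup>2" by (intro power_mono) auto
        then have "2 / (real_of_int (den (ws ! i)))\<^sup>2 \<le> 2 / (real k)\<^sup>2"
          using elim by (intro divide_left_mono mult_pos_pos) (auto intro: less_le_trans)
        then show ?thesis using True elim by (simp add: U_def)
      qed (use \<epsilon> in \<open>auto simp: U_def\<close>)
      have "hausdorff_premeasure s \<epsilon> (cfrac_limit_set A) \<le> (\<Sum>i. hausdorff_gauge s (U i))"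
        unfolding hausdorff_premeasure_def using cover diam by (intro Inf_lower) blast
      also have "\<dots> = (\<Sum>i<length ws. hausdorff_gauge s (U i))"
        by (intro suminf_finite) (auto simp: U_def hausdorff_gauge_def)
      also have "\<dots> = (\<Sum>i<length ws. ennreal (2 powr s * den (ws ! i) powr (- 2 * s)))"
      proof (intro sum.cong refl)
        fix i assume i: "i \<in> {..<length ws}"
        then have "real_of_int (den (ws ! i)) \<ge> 1" using den_word_ge1 wsA by blast
        then have "(2 / (real_of_int (den (ws ! i)))\<^sup>2) powr s = 2 powr s * den (ws ! i) powr (- 2 * s)"
          using powr_powr[of "real_of_int (den (ws ! i))" 2 s]
          by (simp add: powr_divide powr_minus divide_inverse[symmetric] powr_numeral)
        then show "hausdorff_gauge s (U i) = ennreal (2 powr s * den (ws ! i) powr (- 2 * s))"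
          using i s by (simp add: U_def hausdorff_gauge_def)
      qed
      also have "\<dots> = ennreal (\<Sum>i<length ws. 2 powr s * den (ws ! i) powr (- 2 * s))"
        by (intro sum_ennreal) auto
      also have "(\<Sum>i<length ws. 2 powr s * den (ws ! i) powr (- 2 * s)) = 2 powr s * psum s ?K"
        unfolding psum_def sum_distrib_left ws(1)[symmetric]
        by (simp add: sum_list_sum_nth sum_list_distinct_conv_sum_set[OF ws(2), symmetric] atLeast0LessThan)
      also have "ennreal \<dots> \<le> ennreal (2 powr s * psum s n ^ k)"
        using s by (intro ennreal_leI mult_left_mono psum_mult_le) auto
      finally show ?case .
    qed
  qed auto
  then show ?thesis by (simp add: hausdorff_measure_def)
qed

lemma hausdorff_dim_le_exponent:
  assumes "0 \<le> \<delta>" "\<forall>s>\<delta>. \<exists>n. psum s n < 1"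
  shows "hausdorff_dim (cfrac_limit_set A) \<le> ennreal \<delta>"
proof (rule ennreal_le_epsilon)
  fix e :: real assume "e > 0"
  then have "hausdorff_measure (\<delta> + e) (cfrac_limit_set A) = 0"
    using assms hausdorff_measure_limit_set_eq_0[of "\<delta> + e"] by (metis add_nonneg_pos less_add_same_cancel1)
  then have "hausdorff_dim (cfrac_limit_set A) \<le> ennreal (\<delta> + e)"
    unfolding hausdorff_dim_def using assms \<open>e > 0\<close>
    by (intro Inf_lower CollectI exI[of _ "\<delta> + e"]) auto
  then show "hausdorff_dim (cfrac_limit_set A) \<le> ennreal \<delta> + ennreal e"
    using assms \<open>e > 0\<close> by (simp add: ennreal_plus)
qed

end

section \<open>Counting words by denominator\<close>

lemma card_le_fibres:
  assumes "finite S" and "\<And>b. b \<in> f ` S \<Longrightarrow> real (card {s \<in> S. f s = b}) \<le> k"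
  shows "real (card S) \<le> k * real (card (f ` S))"
proof -
  have "card S = (\<Sum>b\<in>f ` S. card {s \<in> S. f s = b})"
    using sum.image_gen[OF assms(1), of "\<lambda>_. 1::nat" f] by simp
  then have "real (card S) = (\<Sum>b\<in>f ` S. real (card {s \<in> S. f s = b}))" by simp
  also have "\<dots> \<le> (\<Sum>b\<in>f ` S. k)" using assms(2) by (rule sum_mono)
  finally show ?thesis by (simp add: mult.commute)
qed

lemma card_le_fibres':
  assumes "finite S" "finite T" "f ` S \<subseteq> T" "0 \<le> k"
    and "\<And>b. b \<in> T \<Longrightarrow> real (card {s \<in> S. f s = b}) \<le> k"
  shows "real (card S) \<le> k * real (card T)"
proof -
  have "real (card S) \<le> k * real (card (f ` S))"
    using assms by (intro card_le_fibres) auto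
  also have "\<dots> \<le> k * real (card T)"
    using assms by (intro mult_left_mono) (auto intro: card_mono)
  finally show ?thesis .
qed

lemma powr_minus_mult_le:
  fixes x :: real
  assumes "0 < x" shows "x powr (- a) * b \<le> c \<longleftrightarrow> b \<le> x powr a * c"
proof -
  have "x powr (- a) * b = b / x powr a" by (simp add: powr_minus_divide)
  then show ?thesis using assms by (simp add: pos_divide_le_eq mult.commute[of c])
qed

locale critical_alphabet = alphabet +
  fixes \<delta> :: real
  assumes psum_ge: "1 \<le> psum \<delta> n" and psum_le: "psum \<delta> n \<le> 4 powr \<delta>" and delta_nonneg: "0 \<le> \<delta>"
begin

text \<open>Appending a letter multiplies the denominator by at most \<open>a0\<close>: the letter
  itself, plus 1 because \<open>denp w \<le> den w\<close>.\<close>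

definition a0 :: real where "a0 = real (Max A) + 1"

text \<open>A stopping-time section of the tree of words: the words at which the denominator first
  reaches \<open>B\<close>. Every word over the alphabet with denominator at least \<open>B\<close>
  has exactly one prefix here, and for \<open>B \<ge> 1\<close> all members have denominators
  between \<open>B\<close> and \<open>a0 * B\<close>. Fixing the length instead would let
  denominators vary exponentially.\<close>

definition stop :: "real \<Rightarrow> nat list set" where
  "stop B = {w. set w \<subseteq> A \<and> B \<le> real_of_int (den w) \<and>
     (w = [] \<or> real_of_int (den (butlast w)) < B)}"

lemma a0_ge: "2 \<le> a0"
proof -
  have "A \<noteq> {}" using two_le_card by auto
  then have "Max A \<in> A" using finite_A by (intro Max_in)
  then show ?thesis using zero_notin_A unfolding a0_def by (cases "Max A") auto
qed

lemma A_le: "a \<in> A \<Longrightarrow> real a + 1 \<le> a0"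
  using finite_A by (simp add: a0_def)

section \<open>Words stopped at a given size of the denominator\<close>

lemma den_snoc_le:
  assumes "set w \<subseteq> A" "a \<in> A"
  shows "den (w @ [a]) \<le> a0 * den w"
proof -
  have "real_of_int (den (w @ [a])) = real a * den w + denp w" by (simp add: den_snoc)
  also have "\<dots> \<le> real a * den w + den w"
    using denp_le_den[OF word_pos[OF assms(1)]] by simp
  also have "\<dots> = (real a + 1) * den w" by (simp add: algebra_simps)
  also have "\<dots> \<le> a0 * den w"
    using A_le[OF assms(2)] den_word_ge1[OF assms(1)] by (intro mult_right_mono) auto
  finally show ?thesis .
qed

lemma stopD:
  fixes B :: real
  assumes "w \<in> stop B" "1 \<le> B"
  shows "set w \<subseteq> A" "B \<le> den w" "den w \<le> a0 * B"
proof -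
  show w: "set w \<subseteq> A" "B \<le> den w" using assms by (auto simp: stop_def)
  show "den w \<le> a0 * B"
  proof (cases w rule: rev_cases)
    case Nil
    have "2 * 1 \<le> a0 * B" using a0_ge assms by (intro mult_mono) auto
    then show ?thesis using Nil by simp
  next
    case (snoc v a)
    then have "den v < B" "set v \<subseteq> A" "a \<in> A" using assms by (auto simp: stop_def)
    then have "den w \<le> a0 * den v" using snoc den_snoc_le by simp
    also have "\<dots> \<le> a0 * B" using \<open>den v < B\<close> a0_ge by (intro mult_left_mono) auto
    finally show ?thesis .
  qed
qed

lemma finite_den_le: "finite {w. set w \<subseteq> A \<and> den w \<le> (B::real)}"
proof -
  have "{w. set w \<subseteq> A \<and> den w \<le> B} \<subseteq> {w. set w \<subseteq> A \<and> length w \<le> nat \<lfloor>B\<rfloor>}"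
  proof clarify
    fix w assume w: "set w \<subseteq> A" "den w \<le> B"
    have "int (length w) \<le> den w" using den_ge_length word_pos w by blast
    moreover have "den w \<le> \<lfloor>B\<rfloor>" using w by (simp add: le_floor_iff)
    ultimately show "length w \<le> nat \<lfloor>B\<rfloor>" by linarith
  qed
  then show ?thesis using finite_lists_length_le[OF finite_A] by (rule finite_subset)
qed

lemma finite_stop: "1 \<le> (B::real) \<Longrightarrow> finite (stop B)"
  using stopD by (intro finite_subset[OF _ finite_den_le[of "a0 * B"]]) auto

lemma den_prefix_le:
  assumes "set (u @ v) \<subseteq> A" shows "den u \<le> den (u @ v)"
  using assms by (intro den_append_left_le word_pos) auto

lemma stop_prefix:
  fixes B :: real
  assumes "set w \<subseteq> A" "B \<le> den w"
  obtains u v where "u \<in> stop B" "w = u @ v"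
proof -
  define n where "n = (LEAST n. B \<le> den (take n w))"
  have ex: "B \<le> den (take (length w) w)" using assms by simp
  have n: "B \<le> den (take n w)" unfolding n_def using ex by (rule LeastI)
  have nle: "n \<le> length w" unfolding n_def using ex by (rule Least_le)
  have less: "den (take m w) < B" if "m < n" for m
    using not_less_Least[of m "\<lambda>n. B \<le> den (take n w)"] that by (simp add: n_def)
  have "take n w \<in> stop B"
  proof (cases n)
    case 0
    then show ?thesis using n by (simp add: stop_def)
  next
    case (Suc m)
    have "butlast (take n w) = take m w" using nle Suc by (simp add: butlast_take)
    then show ?thesis using n less[of m] Suc assms(1) set_take_subset[of n w] by (auto simp: stop_def)
  qed
  then show thesis using that[of "take n w" "drop n w"] by simp
qed

text \<open>No stopped word is a proper prefix of another one, since the longer word would have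
  reached \<open>B\<close> before its last letter.\<close>

lemma stop_unique:
  fixes B :: real
  assumes "u \<in> stop B" "u' \<in> stop B" "u @ v = u' @ v'" "set (u @ v) \<subseteq> A"
  shows "u = u' \<and> v = v'"
proof -
  have False if u: "u \<in> stop B" "u @ x \<in> stop B" "x \<noteq> []" for u x
  proof -
    have "u @ x \<noteq> []" using u by simp
    then have "den (butlast (u @ x)) < B" using u(2) unfolding stop_def by blast
    moreover have "butlast (u @ x) = u @ butlast x" using u by (simp add: butlast_append)
    moreover have "den u \<le> den (u @ butlast x)"
      using u by (intro den_prefix_le) (auto simp: stop_def dest: in_set_butlastD)
    ultimately show False using u by (auto simp: stop_def)
  qed
  note no_ext = this
  obtain x where "u = u' @ x \<and> x @ v = v' \<or> u @ x = u' \<and> v = x @ v'"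
    using assms(3) unfolding append_eq_append_conv2 by blast
  then show ?thesis
    using no_ext[of u' x] no_ext[of u x] assms(1,2) by (cases "x = []") auto
qed

text \<open>A word of large fixed length splits uniquely into a stopped prefix and a tail. Up to the
  constants of quasi-multiplicativity, \<open>psum \<delta> n\<close> is therefore the sum over the
  prefixes weighted by \<open>psum \<delta>\<close> of the tail lengths, and all these
  \<open>psum\<close> values lie between 1 and \<open>4 powr \<delta>\<close>.\<close>

lemma sum_stop_powr:
  fixes B :: real
  assumes "1 \<le> B"
  shows "4 powr (- \<delta>) \<le> (\<Sum>w\<in>stop B. den w powr (- 2 * \<delta>))"
    and "(\<Sum>w\<in>stop B. den w powr (- 2 * \<delta>)) \<le> 16 powr \<delta>"
proof -
  \<comment> \<open>Because \<open>length w \<le> den w\<close>, no stopped word is longer than this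
    \<open>n\<close>, and every word of length \<open>n\<close> has already reached
    \<open>B\<close>.\<close>
  define n where "n = nat \<lceil>a0 * B\<rceil>"
  let ?W = "Sigma (stop B) (\<lambda>w. words (n - length w))"
  have len: "length w \<le> n" if "w \<in> stop B" for w
  proof -
    have "real (length w) \<le> den w"
      using den_ge_length[OF word_pos[OF stopD(1)[OF that assms]]] by simp
    also have "\<dots> \<le> a0 * B" using stopD[OF that assms] by simp
    finally show ?thesis unfolding n_def by linarith
  qed
  have bij: "bij_betw (\<lambda>(u, v). u @ v) ?W (words n)"
    unfolding bij_betw_def
  proof (intro conjI)
    show "inj_on (\<lambda>(u, v). u @ v) ?W"
    proof (rule inj_onI)
      fix p q assume pq: "p \<in> ?W" "q \<in> ?W" "(\<lambda>(u, v). u @ v) p = (\<lambda>(u, v). u @ v) q"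
      have "set (fst p @ snd p) \<subseteq> A" using pq(1) stopD(1)[of "fst p" B] assms by (auto simp: words_def)
      moreover have "fst p \<in> stop B" "fst q \<in> stop B" "fst p @ snd p = fst q @ snd q"
        using pq by (auto simp: case_prod_unfold)
      ultimately have "fst p = fst q \<and> snd p = snd q" by (metis stop_unique)
      then show "p = q" by (simp add: prod_eq_iff)
    qed
    show "(\<lambda>(u, v). u @ v) ` ?W = words n"
    proof (intro equalityI subsetI)
      fix w assume "w \<in> (\<lambda>(u, v). u @ v) ` ?W"
      then obtain u v where uv: "w = u @ v" "u \<in> stop B" "v \<in> words (n - length u)" by auto
      then show "w \<in> words n" using len[of u] stopD(1)[of u B] assms by (auto simp: words_def)
    next
      fix w assume w: "w \<in> words n"
      have "B \<le> a0 * B" using a0_ge assms by simp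
      also have "\<dots> \<le> real (length w)" using w unfolding words_def n_def by simp linarith
      also have "\<dots> \<le> den w"
        using den_ge_length[of w] word_pos[of w] w by (simp add: words_def)
      finally have "B \<le> den w" .
      then obtain u v where "u \<in> stop B" "w = u @ v"
        using stop_prefix[of w B] w unfolding words_def by auto
      then show "w \<in> (\<lambda>(u, v). u @ v) ` ?W"
        using w by (intro image_eqI[of _ _ "(u, v)"]) (auto simp: words_def)
    qed
  qed
  have "psum \<delta> n = (\<Sum>(u, v)\<in>?W. den (u @ v) powr (- 2 * \<delta>))"
    unfolding psum_def by (subst sum.reindex_bij_betw[OF bij, symmetric]) (simp add: case_prod_unfold)
  also have "\<dots> = (\<Sum>u\<in>stop B. \<Sum>v\<in>words (n - length u). den (u @ v) powr (- 2 * \<delta>))"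
    using finite_stop[OF assms] finite_words by (subst sum.Sigma) auto
  finally have eq: "psum \<delta> n = (\<Sum>u\<in>stop B. \<Sum>v\<in>words (n - length u). den (u @ v) powr (- 2 * \<delta>))" .
  have "1 \<le> psum \<delta> n" by (rule psum_ge)
  also have "\<dots> \<le> (\<Sum>u\<in>stop B. den u powr (- 2 * \<delta>) * psum \<delta> (n - length u))"
    unfolding eq unfolding psum_def sum_distrib_left
    using stopD(1)[OF _ assms] delta_nonneg by (intro sum_mono den_append_powr) (auto simp: words_def)
  also have "\<dots> \<le> (\<Sum>u\<in>stop B. den u powr (- 2 * \<delta>) * 4 powr \<delta>)"
    by (intro sum_mono mult_left_mono psum_le) auto
  also have "\<dots> = 4 powr \<delta> * (\<Sum>u\<in>stop B. den u powr (- 2 * \<delta>))"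
    by (simp add: sum_distrib_left mult.commute)
  finally show "4 powr (- \<delta>) \<le> (\<Sum>w\<in>stop B. den w powr (- 2 * \<delta>))"
    using powr_minus_mult_le[of 4 \<delta> 1] by simp
  have "(\<Sum>u\<in>stop B. den u powr (- 2 * \<delta>) * 1)
      \<le> (\<Sum>u\<in>stop B. den u powr (- 2 * \<delta>) * psum \<delta> (n - length u))"
    by (intro sum_mono mult_left_mono psum_ge) auto
  also have "\<dots> \<le> (\<Sum>u\<in>stop B. \<Sum>v\<in>words (n - length u). 4 powr \<delta> * den (u @ v) powr (- 2 * \<delta>))"
    unfolding psum_def sum_distrib_left
    using stopD(1)[OF _ assms] delta_nonneg by (intro sum_mono den_append_powr) (auto simp: words_def)
  also have "\<dots> = 4 powr \<delta> * psum \<delta> n" unfolding eq by (simp add: sum_distrib_left)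
  also have "\<dots> \<le> 4 powr \<delta> * 4 powr \<delta>" by (intro mult_left_mono psum_le) auto
  also have "\<dots> = 16 powr \<delta>" by (simp add: powr_mult[symmetric])
  finally show "(\<Sum>w\<in>stop B. den w powr (- 2 * \<delta>)) \<le> 16 powr \<delta>" by simp
qed

lemma card_stop_ge:
  fixes B :: real
  assumes "1 \<le> B" shows "4 powr (- \<delta>) * B powr (2 * \<delta>) \<le> card (stop B)"
proof -
  have "4 powr (- \<delta>) \<le> (\<Sum>w\<in>stop B. den w powr (- 2 * \<delta>))" by (rule sum_stop_powr(1)[OF assms])
  also have "\<dots> \<le> (\<Sum>w\<in>stop B. B powr (- 2 * \<delta>))"
  proof (intro sum_mono powr_mono2')
    fix w assume "w \<in> stop B"
    then show "0 < B" "B \<le> den w" using stopD[of w B] assms by auto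
  qed (use delta_nonneg in auto)
  also have "\<dots> = B powr (- (2 * \<delta>)) * card (stop B)" by simp
  finally have "4 powr (- \<delta>) \<le> B powr (- (2 * \<delta>)) * card (stop B)" .
  then have "B powr (2 * \<delta>) * 4 powr (- \<delta>) \<le> B powr (2 * \<delta>) * (B powr (- (2 * \<delta>)) * card (stop B))"
    by (intro mult_left_mono) auto
  also have "\<dots> = card (stop B)" using assms by (simp add: powr_minus)
  finally show ?thesis by (simp add: mult.commute)
qed

lemma card_stop_le:
  fixes B :: real
  assumes "1 \<le> B" shows "card (stop B) \<le> (16 powr \<delta> * a0 powr (2 * \<delta>)) * B powr (2 * \<delta>)"
proof -
  have "card (stop B) * (a0 * B) powr (- 2 * \<delta>) = (\<Sum>w\<in>stop B. (a0 * B) powr (- 2 * \<delta>))" by simp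
  also have "\<dots> \<le> (\<Sum>w\<in>stop B. den w powr (- 2 * \<delta>))"
  proof (intro sum_mono powr_mono2')
    fix w assume "w \<in> stop B"
    then show "0 < real_of_int (den w)" "den w \<le> a0 * B" using stopD[of w B] assms by auto
  qed (use delta_nonneg in auto)
  also have "\<dots> \<le> 16 powr \<delta>" by (rule sum_stop_powr(2)[OF assms])
  finally have "(a0 * B) powr (- (2 * \<delta>)) * card (stop B) \<le> 16 powr \<delta>" by (simp add: mult.commute)
  then have "card (stop B) \<le> (a0 * B) powr (2 * \<delta>) * 16 powr \<delta>"
    using assms a0_ge by (subst (asm) powr_minus_mult_le) auto
  then show ?thesis using assms a0_ge by (simp add: powr_mult mult_ac)
qed

text \<open>Cut at the prefix stopped at about \<open>B / c\<close>: the tail then has denominator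
  at most \<open>c * c\<close> and belongs to a fixed finite set.\<close>

lemma card_den_range_le:
  fixes c :: real
  assumes "1 \<le> c"
  shows "\<exists>C>0. \<forall>B\<ge>1. real (card {w. set w \<subseteq> A \<and> B / c \<le> den w \<and> den w \<le> c * B}) \<le> C * B powr (2 * \<delta>)"
proof -
  define F where "F = {w. set w \<subseteq> A \<and> den w \<le> c * c}"
  define C where "C = 16 powr \<delta> * a0 powr (2 * \<delta>) * card F + 1"
  have "real (card {w. set w \<subseteq> A \<and> B / c \<le> den w \<and> den w \<le> c * B}) \<le> C * B powr (2 * \<delta>)"
    if B: "1 \<le> B" for B
  proof -
    \<comment> \<open>The maximum keeps the threshold at least 1 when \<open>B < c\<close>; every
      denominator still reaches it, being at least 1.\<close>
    define B' where "B' = max 1 (B / c)"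
    have B': "1 \<le> B'" "B' \<le> B" "B \<le> c * B'"
    proof -
      show "1 \<le> B'" by (simp add: B'_def)
      have "B / c \<le> B / 1" using B assms by (intro divide_left_mono) auto
      then show "B' \<le> B" using B by (simp add: B'_def)
      have "B = c * (B / c)" using assms by simp
      also have "\<dots> \<le> c * B'" using assms by (intro mult_left_mono) (auto simp: B'_def)
      finally show "B \<le> c * B'" .
    qed
    let ?S = "{w. set w \<subseteq> A \<and> B / c \<le> den w \<and> den w \<le> c * B}"
    have sub: "?S \<subseteq> (\<lambda>(u, v). u @ v) ` (stop B' \<times> F)"
    proof
      fix w assume w: "w \<in> ?S"
      then have "B' \<le> den w" using den_word_ge1[of w] by (auto simp: B'_def)
      then obtain u v where uv: "u \<in> stop B'" "w = u @ v" using stop_prefix[of w B'] w by auto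
      have vA: "set v \<subseteq> A" using w uv by auto
      have "B' * den v \<le> real_of_int (den u) * den v"
        using stopD[OF uv(1) B'(1)] den_word_ge1[OF vA] by (intro mult_right_mono) auto
      also have "\<dots> \<le> den w"
        using den_append_ge[OF word_pos[OF stopD(1)[OF uv(1) B'(1)]] word_pos[OF vA]] uv(2)
        by (simp flip: of_int_mult)
      also have "\<dots> \<le> c * B" using w by simp
      also have "\<dots> \<le> c * (c * B')" using B' assms by (intro mult_left_mono) auto
      finally have "den v \<le> c * c" using B' by (simp add: mult.assoc[symmetric])
      then show "w \<in> (\<lambda>(u, v). u @ v) ` (stop B' \<times> F)"
        using uv vA by (intro image_eqI[of _ _ "(u, v)"]) (auto simp: F_def)
    qed
    have fin: "finite (stop B' \<times> F)" using finite_stop[OF B'(1)] finite_den_le by (simp add: F_def)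
    have "card ?S \<le> card (stop B' \<times> F)"
      using card_mono[OF finite_imageI[OF fin] sub] card_image_le[OF fin] by (rule order_trans)
    then have "card ?S \<le> card (stop B') * card F" by (simp only: card_cartesian_product)
    then have "real (card ?S) \<le> real (card (stop B') * card F)" by (simp only: of_nat_le_iff)
    then have "real (card ?S) \<le> real (card (stop B')) * real (card F)" by (simp only: of_nat_mult)
    also have "\<dots> \<le> (16 powr \<delta> * a0 powr (2 * \<delta>) * B' powr (2 * \<delta>)) * card F"
      by (intro mult_right_mono card_stop_le[OF B'(1)]) auto
    also have "\<dots> \<le> (16 powr \<delta> * a0 powr (2 * \<delta>) * B powr (2 * \<delta>)) * card F"
      using B' delta_nonneg by (intro mult_right_mono mult_left_mono powr_mono2) auto
    also have "\<dots> = (16 powr \<delta> * a0 powr (2 * \<delta>) * card F) * B powr (2 * \<delta>)" by (simp only: mult_ac)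
    also have "\<dots> \<le> C * B powr (2 * \<delta>)" unfolding C_def by (intro mult_right_mono) auto
    finally show ?thesis .
  qed
  moreover have "C > 0" unfolding C_def by (intro add_nonneg_pos) auto
  ultimately show ?thesis by blast
qed

lemma finite_den_range: "finite {w. set w \<subseteq> A \<and> P w \<and> den w \<le> (B::real)}"
  by (rule finite_subset[OF _ finite_den_le[of B]]) auto

text \<open>Either vector determines the word up to the parity of its length.\<close>

lemma card_same_vector_le:
  assumes "finite S" "S \<subseteq> {w. set w \<subseteq> A}"
  shows "real (card {w \<in> S. (den w, num w) = b}) \<le> 2"
    and "real (card {w \<in> S. (den w, denp w) = b}) \<le> 2"
proof -
  have pos: "0 \<notin> set w" if "w \<in> S" for w using assms that word_pos by blast
  have 1: "inj_on (\<lambda>w. even (length w)) {w \<in> S. (den w, num w) = b}"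
    by (intro inj_onI word_unique) (auto simp: pos)
  have 2: "inj_on (\<lambda>w. even (length w)) {w \<in> S. (den w, denp w) = b}"
    by (intro inj_onI word_unique_prefix) (auto simp: pos)
  have U: "finite (UNIV :: bool set)" by simp
  show "real (card {w \<in> S. (den w, num w) = b}) \<le> 2"
    using card_inj_on_le[OF 1 subset_UNIV U] by simp
  show "real (card {w \<in> S. (den w, denp w) = b}) \<le> 2"
    using card_inj_on_le[OF 2 subset_UNIV U] by simp
qed

text \<open>The stopped words, of number at least a constant times
  \<open>B powr (2 * \<delta>)\<close>, are mapped at most two to one into the
  \<open>O(B\<^sup>2)\<close> integer points of a square. The bound is later used to replace
  \<open>D powr \<delta>\<close> by \<open>D\<close> and \<open>L powr (2 * \<delta>)\<close> by
  \<open>L\<^sup>2\<close>.\<close>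

lemma delta_le_1: "\<delta> \<le> 1"
proof (rule ccontr)
  assume "\<not> \<delta> \<le> 1"
  define C where "C = 2 * (a0 + 1) * (a0 + 1) * 4 powr \<delta>"
  have le: "B powr (2 * \<delta>) \<le> C * B powr 2" if B: "1 \<le> B" for B
  proof -
    define T where "T = {0..\<lfloor>a0 * B\<rfloor>} \<times> {0..\<lfloor>a0 * B\<rfloor>}"
    have nn: "0 \<le> a0 * B" using a0_ge B by simp
    have "real (card (stop B)) \<le> 2 * real (card T)"
    proof (rule card_le_fibres'[where f = "\<lambda>w. (den w, num w)"])
      show "(\<lambda>w. (den w, num w)) ` stop B \<subseteq> T"
      proof clarify
        fix w assume w: "w \<in> stop B"
        have "den w \<le> \<lfloor>a0 * B\<rfloor>" using stopD[OF w B] by (simp add: le_floor_iff)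
        then show "(den w, num w) \<in> T"
          using num_le_den[OF word_pos[OF stopD(1)[OF w B]]] num_nonneg[of w] den_nonneg[of w] by (simp add: T_def)
      qed
      show "real (card {s \<in> stop B. (den s, num s) = b}) \<le> 2" for b
        using stopD(1)[OF _ B] by (intro card_same_vector_le finite_stop B) auto
    qed (auto simp: finite_stop B T_def)
    also have "real (card T) = (real_of_int \<lfloor>a0 * B\<rfloor> + 1) * (real_of_int \<lfloor>a0 * B\<rfloor> + 1)"
      using nn by (simp add: T_def)
    also have "2 * \<dots> \<le> 2 * ((a0 + 1) * B * ((a0 + 1) * B))"
    proof -
      have "real_of_int \<lfloor>a0 * B\<rfloor> + 1 \<le> a0 * B + B" using B of_int_floor_le[of "a0 * B"] by linarith
      then have "real_of_int \<lfloor>a0 * B\<rfloor> + 1 \<le> (a0 + 1) * B" by (simp add: algebra_simps)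
      then show ?thesis using nn B a0_ge by (intro mult_left_mono mult_mono) auto
    qed
    finally have "4 powr (- \<delta>) * B powr (2 * \<delta>) \<le> 2 * ((a0 + 1) * B * ((a0 + 1) * B))"
      using card_stop_ge[OF B] by linarith
    then have "B powr (2 * \<delta>) \<le> 4 powr \<delta> * (2 * ((a0 + 1) * B * ((a0 + 1) * B)))"
      by (subst (asm) powr_minus_mult_le) auto
    also have "\<dots> = C * B powr 2" using B by (simp add: C_def power2_eq_square mult_ac)
    finally show ?thesis .
  qed
  have "C > 0" using a0_ge by (auto simp: C_def)
  \<comment> \<open>Solves \<open>B powr (2 * \<delta> - 2) = C + 1\<close>, one more than the bound
    \<open>C\<close> permits.\<close>
  define B where "B = (C + 1) powr (1 / (2 * \<delta> - 2))"
  have e: "2 * \<delta> - 2 > 0" using \<open>\<not> \<delta> \<le> 1\<close> by simp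
  have B1: "1 \<le> B" unfolding B_def using e \<open>C > 0\<close> by (intro ge_one_powr_ge_zero) auto
  have "B powr (2 * \<delta> - 2) * B powr 2 = B powr (2 * \<delta>)" by (simp add: powr_add[symmetric])
  then have "B powr (2 * \<delta> - 2) * B powr 2 \<le> C * B powr 2" using le[OF B1] by simp
  then have "B powr (2 * \<delta> - 2) \<le> C" using B1 by (subst (asm) mult_le_cancel_right_pos) auto
  moreover have "B powr (2 * \<delta> - 2) = C + 1"
    unfolding B_def powr_powr using e \<open>C > 0\<close> by simp
  ultimately show False by simp
qed

end

section \<open>Exponential sums\<close>

definition ee :: "real \<Rightarrow> complex" where "ee t = cis (2 * pi * t)"

definition dnorm :: "real \<Rightarrow> real" where "dnorm t = \<bar>t - of_int (round t)\<bar>"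

lemma norm_ee [simp]: "norm (ee t) = 1"
  by (simp add: ee_def)

lemma ee_add: "ee (s + t) = ee s * ee t"
  by (simp add: ee_def cis_mult algebra_simps)

lemma cnj_ee: "cnj (ee t) = ee (- t)"
  by (simp add: ee_def cis_cnj)

lemma ee_of_int [simp]: "ee (of_int n) = 1"
  by (simp add: ee_def cis_multiple_2pi)

lemma ee_0 [simp]: "ee 0 = 1"
  by (simp add: ee_def)

lemma ee_mult_nat: "ee (of_nat k * t) = ee t ^ k"
  by (induction k) (simp_all add: ee_add distrib_right)

lemma dnorm_nonneg: "0 \<le> dnorm t"
  by (simp add: dnorm_def)

lemma dnorm_le_half: "dnorm t \<le> 1 / 2"
  unfolding dnorm_def using of_int_round_abs_le[of t] by (simp add: abs_minus_commute)

lemma dnorm_le: "dnorm t \<le> \<bar>t - of_int n\<bar>"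
  unfolding dnorm_def using round_diff_minimal[of t n] by (simp add: abs_minus_commute)

lemma dnormE: obtains n :: int where "dnorm t = \<bar>t - of_int n\<bar>"
  by (simp add: dnorm_def)

lemma dnorm_diff_le: "dnorm (s - t) \<le> dnorm s + dnorm t"
  using dnorm_le[of "s - t" "round s - round t"] by (simp add: dnorm_def)

lemma dnorm_mult_le: "dnorm (of_int n * t) \<le> \<bar>of_int n\<bar> * dnorm t"
  using dnorm_le[of "of_int n * t" "n * round t"] by (simp add: dnorm_def abs_mult[symmetric] algebra_simps)

lemma dnorm_add_int: "dnorm (t + of_int n) \<le> dnorm t"
  using dnorm_le[of "t + of_int n" "round t + n"] by (simp add: dnorm_def)

lemma dnorm_minus: "dnorm (- t) = dnorm t"
proof -
  have "dnorm (- s) \<le> dnorm s" for s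
    using dnorm_le[of "- s" "- round s"] by (simp add: dnorm_def)
  from this[of t] this[of "- t"] show ?thesis by simp
qed

lemma dnorm_small: "\<bar>t\<bar> \<le> 1 / 2 \<Longrightarrow> dnorm t = \<bar>t\<bar>"
proof -
  assume t: "\<bar>t\<bar> \<le> 1 / 2"
  obtain n where n: "dnorm t = \<bar>t - of_int n\<bar>" by (rule dnormE)
  have "\<bar>t\<bar> \<le> \<bar>t - of_int n\<bar>" using t by (cases "n = 0") linarith+
  then show ?thesis using n dnorm_le[of t 0] by simp
qed

text \<open>The right side is \<open>2 * \<bar>sin (pi * r)\<bar>\<close> for the residue
  \<open>r\<close> in [-1/2, 1/2]. The cubic Taylor estimate yields
  \<open>\<bar>sin x\<bar> \<ge> \<bar>x\<bar> / 3\<close> on \<open>\<bar>x\<bar> \<le> 2\<close>,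
  which leaves enough room since pi lies between 2 and 4.\<close>

lemma dnorm_le_norm_one_minus_ee: "dnorm t \<le> norm (1 - ee t)"
proof -
  define r where "r = t - of_int (round t)"
  have r: "\<bar>r\<bar> = dnorm t" by (simp add: r_def dnorm_def)
  have "ee t = ee (r + of_int (round t))" by (simp add: r_def)
  then have er: "ee t = ee r" unfolding ee_add by simp
  define x where "x = pi * r"
  have "pi * \<bar>r\<bar> \<le> 4 * (1 / 2)"
    using r dnorm_le_half[of t] pi_less_4 by (intro mult_mono) auto
  then have xb: "\<bar>x\<bar> \<le> 2" by (simp add: x_def abs_mult)
  have "\<bar>sin x - (\<Sum>m<3. sin_coeff m * x ^ m)\<bar> \<le> inverse (fact 3) * \<bar>x\<bar> ^ 3"
    by (rule Maclaurin_sin_bound)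
  moreover have "(\<Sum>m<3. sin_coeff m * x ^ m) = x"
    by (simp add: sin_coeff_def eval_nat_numeral)
  moreover have "inverse (fact 3) * \<bar>x\<bar> ^ 3 \<le> 2 / 3 * \<bar>x\<bar>"
  proof -
    have "\<bar>x\<bar> * \<bar>x\<bar> \<le> 2 * 2" using xb by (intro mult_mono) auto
    then have "\<bar>x\<bar> * \<bar>x\<bar> * \<bar>x\<bar> \<le> 4 * \<bar>x\<bar>" by (intro mult_right_mono) auto
    then show ?thesis by (simp add: eval_nat_numeral)
  qed
  ultimately have "\<bar>x\<bar> / 3 \<le> \<bar>sin x\<bar>" by linarith
  moreover have "norm (1 - ee r) = 2 * \<bar>sin x\<bar>"
    using dist_exp_i_1[of "2 * pi * r"]
    by (simp add: ee_def cis_conv_exp x_def norm_minus_commute)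
  ultimately have "2 / 3 * \<bar>x\<bar> \<le> norm (1 - ee r)" by linarith
  moreover have "2 * \<bar>r\<bar> \<le> \<bar>x\<bar>" using pi_ge_two by (simp add: x_def abs_mult mult_right_mono)
  ultimately have "\<bar>r\<bar> \<le> norm (1 - ee r)" by linarith
  then show ?thesis using er r by simp
qed

section \<open>Orthogonality of characters and Parseval's identity\<close>

lemma sum_ee_eq:
  assumes "0 < P"
  shows "(\<Sum>j<P. ee (real j * (of_int m / real P))) = (if int P dvd m then of_nat P else 0)"
proof -
  define z where "z = ee (of_int m / real P)"
  have sum: "(\<Sum>j<P. ee (real j * (of_int m / real P))) = (\<Sum>j<P. z ^ j)"
    unfolding z_def by (simp only: ee_mult_nat)
  show ?thesis
  proof (cases "int P dvd m")
    case True
    then obtain k where "m = int P * k" by blast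
    then have "of_int m / real P = of_int k" using assms by simp
    then have "z = 1" by (simp add: z_def)
    then show ?thesis using sum True by simp
  next
    case False
    have "z \<noteq> 1"
    proof
      assume "z = 1"
      then have "dnorm (of_int m / real P) \<le> 0"
        using dnorm_le_norm_one_minus_ee[of "of_int m / real P"] by (simp add: z_def)
      then have "of_int m / real P = of_int (round (of_int m / real P))" by (simp add: dnorm_def)
      then obtain k :: int where "of_int m / real P = of_int k" by blast
      then have "real_of_int m = of_int (int P * k)" using assms by (simp add: field_simps)
      then have "m = int P * k" by (simp only: of_int_eq_iff)
      then show False using False by simp
    qed
    moreover have "z ^ P = 1"
      using assms unfolding z_def ee_mult_nat[symmetric] by simp
    ultimately show ?thesis using sum False by (simp add: geometric_sum)
  qed
qed

text \<open>Elements of \<open>D\<close> lie in one period, so distinct ones are incongruent modulo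
  \<open>P\<close> and only the diagonal of the expanded square survives.\<close>

lemma parseval:
  assumes "0 < P" "finite D" "D \<subseteq> {0..<int P}"
  shows "(\<Sum>j<P. (norm (\<Sum>d\<in>D. of_real (r d) * ee (real j / real P * of_int d)))\<^sup>2)
      = real P * (\<Sum>d\<in>D. (r d)\<^sup>2)"
proof -
  let ?t = "\<lambda>j d. of_real (r d) * ee (real j / real P * of_int d)"
  have "complex_of_real (\<Sum>j<P. (norm (\<Sum>d\<in>D. ?t j d))\<^sup>2)
      = (\<Sum>j<P. \<Sum>d\<in>D. \<Sum>d'\<in>D. ?t j d * cnj (?t j d'))"
    by (simp add: complex_norm_square sum_product cnj_sum del: of_real_power)
  also have "\<dots> = (\<Sum>j<P. \<Sum>d\<in>D. \<Sum>d'\<in>D. of_real (r d * r d') * ee (real j * (of_int (d - d') / real P)))"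
    by (intro sum.cong refl) (simp add: cnj_ee ee_add[symmetric] algebra_simps diff_divide_distrib)
  also have "\<dots> = (\<Sum>d\<in>D. \<Sum>d'\<in>D. \<Sum>j<P. of_real (r d * r d') * ee (real j * (of_int (d - d') / real P)))"
    by (subst sum.swap) (intro sum.cong refl sum.swap)
  also have "\<dots> = (\<Sum>d\<in>D. \<Sum>d'\<in>D. of_real (r d * r d') * (if int P dvd (d - d') then of_nat P else 0))"
    by (simp only: sum_distrib_left[symmetric] sum_ee_eq[OF assms(1)])
  also have "\<dots> = (\<Sum>d\<in>D. \<Sum>d'\<in>D. if d' = d then of_real (r d * r d') * of_nat P else 0)"
  proof (intro sum.cong refl)
    fix d d' assume "d \<in> D" "d' \<in> D"
    then have "0 \<le> d" "d < int P" "0 \<le> d'" "d' < int P" using assms(3) by auto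
    then have "\<bar>d - d'\<bar> < int P" by linarith
    then have "int P dvd (d - d') \<longleftrightarrow> d' = d"
      using dvd_imp_le_int[of "d - d'" "int P"] by (cases "d = d'") auto
    then show "of_real (r d * r d') * (if int P dvd (d - d') then of_nat P else 0)
        = (if d' = d then complex_of_real (r d * r d') * of_nat P else 0)" by simp
  qed
  also have "\<dots> = (\<Sum>d\<in>D. of_real (r d * r d) * of_nat P)"
    using assms(2) by (intro sum.cong refl) simp
  also have "\<dots> = complex_of_real (real P * (\<Sum>d\<in>D. (r d)\<^sup>2))"
    by (simp add: sum_distrib_left power2_eq_square mult_ac)
  finally show ?thesis by (simp only: of_real_eq_iff)
qed

subsection \<open>Second differences\<close>

text \<open>Brings the shifts by 0, 1 and 2 to one common range, so that they can be combined
  termwise. No boundary terms appear because \<open>h\<close> vanishes from \<bar>n\<bar> = R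
  on.\<close>

lemma sum_shift_support:
  fixes h :: "int \<Rightarrow> real" and z :: "int \<Rightarrow> complex"
  assumes "\<And>n. R \<le> \<bar>n\<bar> \<Longrightarrow> h n = 0" "0 \<le> k" "k \<le> 2"
  shows "(\<Sum>n\<in>{-R..R}. of_real (h n) * z (n + k)) = (\<Sum>n\<in>{-R-2..R}. of_real (h (n + 2 - k)) * z (n + 2))"
proof -
  have "(\<Sum>n\<in>{-R-2..R}. of_real (h (n + 2 - k)) * z (n + 2)) = (\<Sum>n\<in>{-R-k..R+2-k}. of_real (h n) * z (n + k))"
    by (rule sum.reindex_bij_witness[of _ "\<lambda>n. n + k - 2" "\<lambda>n. n + 2 - k"]) auto
  also have "\<dots> = (\<Sum>n\<in>{-R..R}. of_real (h n) * z (n + k))"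
    using assms by (intro sum.mono_neutral_right) auto
  finally show ?thesis by simp
qed

text \<open>Summation by parts twice: multiplying by \<open>(1 - ee \<xi>)\<^sup>2\<close> moves two
  differences onto \<open>h\<close>, and this factor has modulus at least
  \<open>(dnorm \<xi>)\<^sup>2\<close>. Quadratic decay is just what \<open>sum_le_layers\<close>
  can use.\<close>

lemma norm_sum_second_diff:
  fixes h :: "int \<Rightarrow> real"
  assumes supp: "\<And>n. R \<le> \<bar>n\<bar> \<Longrightarrow> h n = 0"
  shows "norm (\<Sum>n\<in>{-R..R}. of_real (h n) * ee (of_int n * \<xi>)) * (dnorm \<xi>)\<^sup>2
    \<le> (\<Sum>n\<in>{-R-2..R}. \<bar>h (n + 2) - 2 * h (n + 1) + h n\<bar>)"
proof -
  let ?z = "\<lambda>n. ee (of_int n * \<xi>)" and ?s = "\<Sum>n\<in>{-R..R}. of_real (h n) * ee (of_int n * \<xi>)"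
  have z: "?z (n + k) = ?z n * ee (of_int k * \<xi>)" for n k
    by (simp add: ee_add[symmetric] algebra_simps)
  have sh: "?s * ee (of_int k * \<xi>) = (\<Sum>n\<in>{-R-2..R}. of_real (h (n + 2 - k)) * ?z (n + 2))"
    if "0 \<le> k" "k \<le> 2" for k
    using sum_shift_support[where R = R and h = h and z = ?z, OF supp that]
    by (simp only: z[of _ k] sum_distrib_right mult.assoc)
  have "?s * (1 - ee \<xi>)\<^sup>2 = ?s * ee (of_int 0 * \<xi>) - 2 * (?s * ee (of_int 1 * \<xi>)) + ?s * ee (of_int 2 * \<xi>)"
  proof -
    have "ee (of_int 2 * \<xi>) = ee \<xi> * ee \<xi>" unfolding ee_add[symmetric] by simp
    then show ?thesis by (simp add: power2_eq_square algebra_simps)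
  qed
  also have "\<dots> = (\<Sum>n\<in>{-R-2..R}. of_real (h (n + 2)) * ?z (n + 2))
      - 2 * (\<Sum>n\<in>{-R-2..R}. of_real (h (n + 1)) * ?z (n + 2))
      + (\<Sum>n\<in>{-R-2..R}. of_real (h n) * ?z (n + 2))"
    using sh[of 0] sh[of 1] sh[of 2] by (simp add: add.commute[of 1])
  also have "\<dots> = (\<Sum>n\<in>{-R-2..R}. of_real (h (n + 2) - 2 * h (n + 1) + h n) * ?z (n + 2))"
    unfolding sum_distrib_left sum_subtractf[symmetric] sum.distrib[symmetric]
    by (intro sum.cong refl) (simp only: of_real_add of_real_diff of_real_mult of_real_numeral ring_distribs mult.assoc)
  finally have eq: "?s * (1 - ee \<xi>)\<^sup>2 = (\<Sum>n\<in>{-R-2..R}. of_real (h (n + 2) - 2 * h (n + 1) + h n) * ?z (n + 2))" .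
  have "norm ?s * (norm (1 - ee \<xi>))\<^sup>2 = norm (\<Sum>n\<in>{-R-2..R}. of_real (h (n + 2) - 2 * h (n + 1) + h n) * ?z (n + 2))"
    unfolding eq[symmetric] norm_mult norm_power ..
  also have "\<dots> \<le> (\<Sum>n\<in>{-R-2..R}. norm (of_real (h (n + 2) - 2 * h (n + 1) + h n) * ?z (n + 2)))"
    by (rule norm_sum)
  also have "\<dots> = (\<Sum>n\<in>{-R-2..R}. \<bar>h (n + 2) - 2 * h (n + 1) + h n\<bar>)"
    by (intro sum.cong refl) (simp only: norm_mult norm_ee norm_of_real mult_1_right)
  finally have "norm ?s * (norm (1 - ee \<xi>))\<^sup>2 \<le> (\<Sum>n\<in>{-R-2..R}. \<bar>h (n + 2) - 2 * h (n + 1) + h n\<bar>)" .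
  moreover have "norm ?s * (dnorm \<xi>)\<^sup>2 \<le> norm ?s * (norm (1 - ee \<xi>))\<^sup>2"
    using dnorm_le_norm_one_minus_ee[of \<xi>] dnorm_nonneg[of \<xi>] by (intro mult_left_mono power_mono) auto
  ultimately show ?thesis by linarith
qed

text \<open>For \<open>l \<ge> 1\<close> the trapezoid equal to 1 on
  \<open>\<bar>t\<bar> \<le> l - 1\<close>, to 0 on \<open>\<bar>t\<bar> \<ge> l\<close>, and linear
  in between. In this form its second differences are, up to signs, those of four convex functions,
  and second differences of convex functions are nonnegative with a telescoping sum.\<close>

definition tz :: "real \<Rightarrow> real \<Rightarrow> real" where
  "tz l t = (\<bar>t - l\<bar> - \<bar>t - l + 1\<bar> - \<bar>t + l - 1\<bar> + \<bar>t + l\<bar>) / 2"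

lemma tz_bounds: "1 \<le> l \<Longrightarrow> 0 \<le> tz l t" "1 \<le> l \<Longrightarrow> tz l t \<le> 1"
  unfolding tz_def by (auto simp: abs_if)

lemma tz_eq_1: "1 \<le> l \<Longrightarrow> \<bar>t\<bar> \<le> l - 1 \<Longrightarrow> tz l t = 1"
  unfolding tz_def by (auto simp: abs_if split: if_splits)

lemma tz_eq_0: "1 \<le> l \<Longrightarrow> l \<le> \<bar>t\<bar> \<Longrightarrow> tz l t = 0"
  unfolding tz_def by (auto simp: abs_if split: if_splits)

lemma tz_lipschitz: "\<bar>tz l s - tz l t\<bar> \<le> 2 * \<bar>s - t\<bar>"
proof -
  have "\<bar>\<bar>s - c\<bar> - \<bar>t - c\<bar>\<bar> \<le> \<bar>s - t\<bar>" for c by linarith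
  note 1 = this
  have 2: "\<bar>(a - b - c + d) / 2 - (a' - b' - c' + d') / 2\<bar> \<le> 2 * e"
    if "\<bar>a - a'\<bar> \<le> e" "\<bar>b - b'\<bar> \<le> e" "\<bar>c - c'\<bar> \<le> e" "\<bar>d - d'\<bar> \<le> e"
    for a b c d a' b' c' d' e :: real
    using that unfolding abs_le_iff by (simp add: field_simps)
  show ?thesis unfolding tz_def
    using 1[of l] 1[of "l - 1"] 1[of "1 - l"] 1[of "- l"] by (intro 2) (simp_all add: algebra_simps)
qed

definition sdiff :: "(int \<Rightarrow> real) \<Rightarrow> int \<Rightarrow> real" where
  "sdiff h n = h (n + 2) - 2 * h (n + 1) + h n"

lemma sum_sdiff: "a \<le> b \<Longrightarrow> (\<Sum>n\<in>{a..b}. sdiff h n) = (h (b + 2) - h (b + 1)) - (h (a + 1) - h a)"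
proof (induction b rule: int_ge_induct)
  case base then show ?case by (simp add: sdiff_def)
next
  case (step b)
  have "{a..b + 1} = insert (b + 1) {a..b}" using step by auto
  then show ?case using step by (simp add: sdiff_def algebra_simps)
qed

lemma sum_sdiff_abs_le: "(\<Sum>n\<in>{a..b}. sdiff (\<lambda>n. \<bar>\<alpha> * of_int n + \<gamma>\<bar>) n) \<le> 2 * \<bar>\<alpha>\<bar>"
proof (cases "a \<le> b")
  case True
  show ?thesis unfolding sum_sdiff[OF True] by (simp add: algebra_simps)
qed simp

lemma sdiff_abs_nonneg: "0 \<le> sdiff (\<lambda>n. \<bar>\<alpha> * of_int n + \<gamma>\<bar>) n"
proof -
  have "\<alpha> * of_int (n + 2) + \<gamma> + (\<alpha> * of_int n + \<gamma>) = 2 * (\<alpha> * of_int (n + 1) + \<gamma>)"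
    by (simp add: algebra_simps)
  then show ?thesis unfolding sdiff_def by linarith
qed

text \<open>Each of the four kinks contributes at most \<open>2 * \<bar>\<alpha>\<bar>\<close>, and
  the division by 2 in \<open>tz\<close> halves the total.\<close>

lemma sum_abs_sdiff_tz:
  "(\<Sum>n\<in>{a..b}. \<bar>sdiff (\<lambda>n. tz l (\<alpha> * of_int n + \<gamma>)) n\<bar>) \<le> 4 * \<bar>\<alpha>\<bar>"
proof -
  let ?f = "\<lambda>c. sdiff (\<lambda>n. \<bar>\<alpha> * of_int n + c\<bar>)"
  have "\<bar>sdiff (\<lambda>n. tz l (\<alpha> * of_int n + \<gamma>)) n\<bar>
      \<le> (?f (\<gamma> - l) n + ?f (\<gamma> - l + 1) n + ?f (\<gamma> + l - 1) n + ?f (\<gamma> + l) n) / 2" for n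
  proof -
    have lin: "sdiff (\<lambda>n. (a n - b n - c n + d n) / 2) n = (sdiff a n - sdiff b n - sdiff c n + sdiff d n) / 2"
      for a b c d unfolding sdiff_def by argo
    have "tz l (\<alpha> * of_int n + \<gamma>) = (\<bar>\<alpha> * of_int n + (\<gamma> - l)\<bar> - \<bar>\<alpha> * of_int n + (\<gamma> - l + 1)\<bar>
        - \<bar>\<alpha> * of_int n + (\<gamma> + l - 1)\<bar> + \<bar>\<alpha> * of_int n + (\<gamma> + l)\<bar>) / 2" for n
      unfolding tz_def by (simp only: add.assoc add_diff_eq diff_add_eq)
    then have eq: "sdiff (\<lambda>n. tz l (\<alpha> * of_int n + \<gamma>)) n
        = (?f (\<gamma> - l) n - ?f (\<gamma> - l + 1) n - ?f (\<gamma> + l - 1) n + ?f (\<gamma> + l) n) / 2"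
      by (simp only: lin)
    have "\<bar>(a - b - c + d) / 2\<bar> \<le> (a + b + c + d) / 2" if "0 \<le> a" "0 \<le> b" "0 \<le> c" "0 \<le> d"
      for a b c d :: real using that unfolding abs_le_iff by (simp add: field_simps)
    then show ?thesis unfolding eq by (metis sdiff_abs_nonneg)
  qed
  then have "(\<Sum>n\<in>{a..b}. \<bar>sdiff (\<lambda>n. tz l (\<alpha> * of_int n + \<gamma>)) n\<bar>)
      \<le> (\<Sum>n\<in>{a..b}. (?f (\<gamma> - l) n + ?f (\<gamma> - l + 1) n + ?f (\<gamma> + l - 1) n + ?f (\<gamma> + l) n) / 2)"
    by (rule sum_mono)
  also have "\<dots> = ((\<Sum>n\<in>{a..b}. ?f (\<gamma> - l) n) + (\<Sum>n\<in>{a..b}. ?f (\<gamma> - l + 1) n)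
      + (\<Sum>n\<in>{a..b}. ?f (\<gamma> + l - 1) n) + (\<Sum>n\<in>{a..b}. ?f (\<gamma> + l) n)) / 2"
    by (simp only: sum.distrib sum_divide_distrib[symmetric])
  also have "\<dots> \<le> 4 * \<bar>\<alpha>\<bar>"
    using sum_sdiff_abs_le[where a = a and b = b and \<alpha> = \<alpha> and \<gamma> = "\<gamma> - l"]
      sum_sdiff_abs_le[where a = a and b = b and \<alpha> = \<alpha> and \<gamma> = "\<gamma> - l + 1"]
      sum_sdiff_abs_le[where a = a and b = b and \<alpha> = \<alpha> and \<gamma> = "\<gamma> + l - 1"]
      sum_sdiff_abs_le[where a = a and b = b and \<alpha> = \<alpha> and \<gamma> = "\<gamma> + l"]
    by simp
  finally show ?thesis .
qed

text \<open>Besides the total second difference, the size and the Lipschitz constant are recorded,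
  which makes the class stable under products.\<close>

definition tame :: "int \<Rightarrow> real \<Rightarrow> real \<Rightarrow> (int \<Rightarrow> real) \<Rightarrow> bool" where
  "tame R \<kappa> V h \<longleftrightarrow> (\<forall>n. \<bar>h n\<bar> \<le> 1) \<and> (\<forall>n. \<bar>h (n + 1) - h n\<bar> \<le> \<kappa>) \<and>
     (\<Sum>n\<in>{-R-2..R}. \<bar>sdiff h n\<bar>) \<le> V"

lemma tame_tz:
  assumes "1 \<le> l" "\<bar>\<alpha>\<bar> \<le> \<kappa>"
  shows "tame R (2 * \<kappa>) (4 * \<kappa>) (\<lambda>n. tz l (\<alpha> * of_int n + \<gamma>))"
  unfolding tame_def
proof (intro conjI allI)
  fix n
  show "\<bar>tz l (\<alpha> * of_int n + \<gamma>)\<bar> \<le> 1" using tz_bounds[OF assms(1), of "\<alpha> * of_int n + \<gamma>"] by simp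
  have "\<bar>tz l (\<alpha> * of_int (n + 1) + \<gamma>) - tz l (\<alpha> * of_int n + \<gamma>)\<bar> \<le> 2 * \<bar>\<alpha>\<bar>"
    using tz_lipschitz[of l "\<alpha> * of_int (n + 1) + \<gamma>" "\<alpha> * of_int n + \<gamma>"] by (simp add: algebra_simps)
  then show "\<bar>tz l (\<alpha> * of_int (n + 1) + \<gamma>) - tz l (\<alpha> * of_int n + \<gamma>)\<bar> \<le> 2 * \<kappa>" using assms by linarith
next
  show "(\<Sum>n\<in>{-R-2..R}. \<bar>sdiff (\<lambda>n. tz l (\<alpha> * of_int n + \<gamma>)) n\<bar>) \<le> 4 * \<kappa>"
    using sum_abs_sdiff_tz[where a = "-R-2" and b = R and l = l and \<alpha> = \<alpha> and \<gamma> = \<gamma>] assms by linarith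
qed

text \<open>Leibniz rule for second differences. The mixed term is a product of two first
  differences and costs \<open>2 * \<kappa> * \<mu>\<close> at each of the \<open>2 * R + 3\<close>
  points.\<close>

lemma tame_mult:
  assumes f: "tame R \<kappa> V f" and g: "tame R \<mu> W g" and R: "0 \<le> R"
  shows "tame R (\<kappa> + \<mu>) (V + W + 2 * \<kappa> * \<mu> * (2 * of_int R + 3)) (\<lambda>n. f n * g n)"
  unfolding tame_def
proof (intro conjI allI)
  have f1: "\<bar>f n\<bar> \<le> 1" "\<bar>f (n + 1) - f n\<bar> \<le> \<kappa>" and g1: "\<bar>g n\<bar> \<le> 1" "\<bar>g (n + 1) - g n\<bar> \<le> \<mu>" for n
    using f g by (auto simp: tame_def)
  have nn: "0 \<le> \<kappa>" "0 \<le> \<mu>" using f1(2)[of 0] g1(2)[of 0] by linarith+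
  have prod: "\<bar>x * y\<bar> \<le> a * b" if "\<bar>x\<bar> \<le> a" "\<bar>y\<bar> \<le> b" for x y a b :: real
    using that unfolding abs_mult by (intro mult_mono) auto
  fix n
  show "\<bar>f n * g n\<bar> \<le> 1" using prod[OF f1(1) g1(1), of n n] by simp
  have "f (n + 1) * g (n + 1) - f n * g n = (f (n + 1) - f n) * g (n + 1) + f n * (g (n + 1) - g n)"
    by (simp add: algebra_simps)
  then show "\<bar>f (n + 1) * g (n + 1) - f n * g n\<bar> \<le> \<kappa> + \<mu>"
    using prod[OF f1(2) g1(1), of n "n + 1"] prod[OF f1(1) g1(2), of n n] by linarith
  have sd: "\<bar>sdiff (\<lambda>n. f n * g n) n\<bar> \<le> \<bar>sdiff f n\<bar> + \<bar>sdiff g n\<bar> + 2 * \<kappa> * \<mu>" for n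
  proof -
    have "sdiff (\<lambda>n. f n * g n) n = sdiff f n * g (n + 2)
        + 2 * ((f (n + 1) - f n) * (g (n + 1 + 1) - g (n + 1))) + f n * sdiff g n"
      by (simp add: sdiff_def algebra_simps)
    moreover have "\<bar>sdiff f n * g (n + 2)\<bar> \<le> \<bar>sdiff f n\<bar> * 1" "\<bar>f n * sdiff g n\<bar> \<le> 1 * \<bar>sdiff g n\<bar>"
      using f1 g1 by (intro prod; simp)+
    moreover have "\<bar>(f (n + 1) - f n) * (g (n + 1 + 1) - g (n + 1))\<bar> \<le> \<kappa> * \<mu>"
      using f1 g1 by (intro prod)
    ultimately show ?thesis by linarith
  qed
  have "(\<Sum>n\<in>{-R-2..R}. \<bar>sdiff (\<lambda>n. f n * g n) n\<bar>)
      \<le> (\<Sum>n\<in>{-R-2..R}. \<bar>sdiff f n\<bar> + \<bar>sdiff g n\<bar> + 2 * \<kappa> * \<mu>)"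
    by (intro sum_mono sd)
  also have "\<dots> = (\<Sum>n\<in>{-R-2..R}. \<bar>sdiff f n\<bar>) + (\<Sum>n\<in>{-R-2..R}. \<bar>sdiff g n\<bar>)
      + real (card {-R-2..R}) * (2 * \<kappa> * \<mu>)"
    by (simp add: sum.distrib)
  also have "real (card {-R-2..R}) = 2 * of_int R + 3" using R by simp
  finally show "(\<Sum>n\<in>{-R-2..R}. \<bar>sdiff (\<lambda>n. f n * g n) n\<bar>) \<le> V + W + 2 * \<kappa> * \<mu> * (2 * of_int R + 3)"
    using f g by (simp add: tame_def algebra_simps)
qed

text \<open>Three trapezoids of slope at most \<open>\<Lambda> / M\<close> over a range of length
  \<open>O(M)\<close> have total second difference \<open>O(1 / M)\<close>. Against the trivial
  bound \<open>O(M)\<close> this saves the factor \<open>(M * dnorm \<xi>)\<^sup>2\<close>.\<close>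

lemma kernel_one_dim:
  fixes M \<Lambda> :: real
  assumes M: "1 \<le> M" and L: "1 \<le> \<Lambda>" and l: "1 \<le> l"
    and sl: "\<bar>\<alpha>\<bar> \<le> \<Lambda> / M" "\<bar>\<alpha>\<^sub>1\<bar> \<le> \<Lambda> / M" "\<bar>\<alpha>\<^sub>2\<bar> \<le> \<Lambda> / M"
    and R: "0 \<le> R" "of_int R \<le> \<Lambda> * M" and supp: "\<And>n::int. R \<le> \<bar>n\<bar> \<Longrightarrow> 2 \<le> \<bar>\<alpha> * of_int n\<bar>"
  shows "norm (\<Sum>n\<in>{-R..R}. of_real (tz 2 (\<alpha> * of_int n) * (tz l (\<alpha>\<^sub>1 * of_int n + \<gamma>\<^sub>1) * tz l (\<alpha>\<^sub>2 * of_int n + \<gamma>\<^sub>2)))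
      * ee (of_int n * \<xi>)) * (dnorm \<xi>)\<^sup>2 \<le> (12 * \<Lambda> + 24 * \<Lambda>\<^sup>2 * (2 * \<Lambda> + 3)) / M"
    (is "norm (\<Sum>n\<in>_. of_real (?h n) * _) * _ \<le> _")
proof -
  define \<kappa> where "\<kappa> = \<Lambda> / M"
  have k: "0 \<le> \<kappa>" using M L by (simp add: \<kappa>_def)
  have t0: "tame R (2 * \<kappa>) (4 * \<kappa>) (\<lambda>n. tz 2 (\<alpha> * of_int n))"
    using tame_tz[of 2 \<alpha> \<kappa> R 0] sl by (simp add: \<kappa>_def)
  have t1: "tame R (2 * \<kappa>) (4 * \<kappa>) (\<lambda>n. tz l (\<alpha>\<^sub>1 * of_int n + \<gamma>\<^sub>1))"
    and t2: "tame R (2 * \<kappa>) (4 * \<kappa>) (\<lambda>n. tz l (\<alpha>\<^sub>2 * of_int n + \<gamma>\<^sub>2))"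
    using sl l unfolding \<kappa>_def by (intro tame_tz; simp)+
  have "tame R (2 * \<kappa> + (2 * \<kappa> + 2 * \<kappa>)) (4 * \<kappa> + (4 * \<kappa> + 4 * \<kappa> + 2 * (2 * \<kappa>) * (2 * \<kappa>) * (2 * of_int R + 3))
      + 2 * (2 * \<kappa>) * (2 * \<kappa> + 2 * \<kappa>) * (2 * of_int R + 3)) ?h"
    by (rule tame_mult[OF t0 tame_mult[OF t1 t2 R(1)] R(1)])
  then have "(\<Sum>n\<in>{-R-2..R}. \<bar>sdiff ?h n\<bar>) \<le> 4 * \<kappa> + (4 * \<kappa> + 4 * \<kappa> + 2 * (2 * \<kappa>) * (2 * \<kappa>) * (2 * of_int R + 3))
      + 2 * (2 * \<kappa>) * (2 * \<kappa> + 2 * \<kappa>) * (2 * of_int R + 3)"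
    unfolding tame_def by blast
  also have "\<dots> = 12 * \<kappa> + 24 * \<kappa>\<^sup>2 * (2 * of_int R + 3)"
    by (simp add: power2_eq_square algebra_simps)
  also have "\<dots> \<le> 12 * \<kappa> + 24 * \<kappa>\<^sup>2 * ((2 * \<Lambda> + 3) * M)"
  proof -
    have "2 * of_int R + 3 \<le> (2 * \<Lambda> + 3) * M" using R M by (simp add: algebra_simps)
    then show ?thesis by (intro add_left_mono mult_left_mono) auto
  qed
  also have "\<dots> = (12 * \<Lambda> + 24 * \<Lambda>\<^sup>2 * (2 * \<Lambda> + 3)) / M"
    using M by (simp add: \<kappa>_def field_simps power2_eq_square)
  finally have V: "(\<Sum>n\<in>{-R-2..R}. \<bar>sdiff ?h n\<bar>) \<le> (12 * \<Lambda> + 24 * \<Lambda>\<^sup>2 * (2 * \<Lambda> + 3)) / M" .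
  have "?h n = 0" if "R \<le> \<bar>n\<bar>" for n using tz_eq_0[of 2] supp[OF that] by simp
  then show ?thesis using V norm_sum_second_diff[of R ?h \<xi>] unfolding sdiff_def by (smt (verit))
qed

text \<open>The matrix entry produced by the dual form of the large sieve for the vectors
  \<open>y\<close> and \<open>z\<close>: a smoothly truncated sum over all integer vectors of a box,
  with \<xi> the difference of the two frequency vectors.\<close>

definition kern :: "int \<Rightarrow> real \<Rightarrow> (real \<Rightarrow> real) \<Rightarrow> int \<times> int \<Rightarrow> int \<times> int \<Rightarrow> real \<times> real \<Rightarrow> complex" where
  "kern R \<alpha> F y z \<xi> = (\<Sum>(x\<^sub>1, x\<^sub>2)\<in>{-R..R} \<times> {-R..R}.
     of_real (tz 2 (\<alpha> * of_int x\<^sub>1) * tz 2 (\<alpha> * of_int x\<^sub>2) *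
       (F (of_int (x\<^sub>1 * fst y + x\<^sub>2 * snd y)) * F (of_int (x\<^sub>1 * fst z + x\<^sub>2 * snd z)))) *
     ee (of_int x\<^sub>1 * fst \<xi> + of_int x\<^sub>2 * snd \<xi>))"

lemma kern_swap: "kern R \<alpha> F y z \<xi> = kern R \<alpha> F (prod.swap y) (prod.swap z) (prod.swap \<xi>)"
  unfolding kern_def
  by (rule sum.reindex_bij_witness[of _ prod.swap prod.swap]) (auto simp: add.commute mult_ac)

text \<open>The first summand is the trivial bound for the double sum; the second is a trivial sum
  in one variable times the bound of \<open>kernel_one_dim\<close> in the other.\<close>

definition kernC :: "real \<Rightarrow> real" where
  "kernC \<Lambda> = (2 * \<Lambda> + 1)\<^sup>2 + (2 * \<Lambda> + 1) * (12 * \<Lambda> + 24 * \<Lambda>\<^sup>2 * (2 * \<Lambda> + 3))"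

text \<open>Only the second variable is summed with cancellation, the first one trivially. By
  \<open>kern_swap\<close> the roles can be exchanged, so the kernel decays in the larger of the two
  distances.\<close>

lemma kern_bound_snd:
  fixes M \<Lambda> N :: real
  assumes M: "1 \<le> M" and L: "1 \<le> \<Lambda>" and l: "1 \<le> l"
    and sl: "\<bar>\<alpha>\<bar> \<le> \<Lambda> / M" "\<bar>of_int (snd y) / N\<bar> \<le> \<Lambda> / M" "\<bar>of_int (snd z) / N\<bar> \<le> \<Lambda> / M"
    and R: "0 \<le> R" "of_int R \<le> \<Lambda> * M" and supp: "\<And>n::int. R \<le> \<bar>n\<bar> \<Longrightarrow> 2 \<le> \<bar>\<alpha> * of_int n\<bar>"
  shows "norm (kern R \<alpha> (\<lambda>t. tz l (t / N - c)) y z \<xi>) * (M * dnorm (snd \<xi>))\<^sup>2 \<le> kernC \<Lambda> * M\<^sup>2"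
    and "norm (kern R \<alpha> (\<lambda>t. tz l (t / N - c)) y z \<xi>) \<le> kernC \<Lambda> * M\<^sup>2"
proof -
  let ?C = "12 * \<Lambda> + 24 * \<Lambda>\<^sup>2 * (2 * \<Lambda> + 3)"
  let ?F = "\<lambda>t. tz l (t / N - c)"
  have C: "0 \<le> ?C" using L by simp
  have cardR: "real (card {-R..R}) \<le> (2 * \<Lambda> + 1) * M"
    using R M by (simp add: algebra_simps)
  have tz1: "\<bar>tz l t\<bar> \<le> 1" "\<bar>tz 2 t\<bar> \<le> 1" for t
    using tz_bounds[of l t] tz_bounds[of 2 t] l by auto
  have prod: "\<bar>x * y\<bar> \<le> 1" if "\<bar>x\<bar> \<le> 1" "\<bar>y\<bar> \<le> 1" for x y :: real
    using that unfolding abs_mult by (simp add: mult_le_one)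
  define h where "h x\<^sub>1 n = tz 2 (\<alpha> * of_int n) * (tz l (of_int (snd y) / N * of_int n + (of_int (x\<^sub>1 * fst y) / N - c))
      * tz l (of_int (snd z) / N * of_int n + (of_int (x\<^sub>1 * fst z) / N - c)))" for x\<^sub>1 n
  have eq: "kern R \<alpha> ?F y z \<xi> = (\<Sum>x\<^sub>1\<in>{-R..R}. of_real (tz 2 (\<alpha> * of_int x\<^sub>1)) * ee (of_int x\<^sub>1 * fst \<xi>) *
      (\<Sum>n\<in>{-R..R}. of_real (h x\<^sub>1 n) * ee (of_int n * snd \<xi>)))"
  proof -
    have "kern R \<alpha> ?F y z \<xi> = (\<Sum>x\<^sub>1\<in>{-R..R}. \<Sum>x\<^sub>2\<in>{-R..R}. of_real (tz 2 (\<alpha> * of_int x\<^sub>1)) * ee (of_int x\<^sub>1 * fst \<xi>) *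
      (of_real (h x\<^sub>1 x\<^sub>2) * ee (of_int x\<^sub>2 * snd \<xi>)))"
      unfolding kern_def sum.cartesian_product
    proof (intro sum.cong refl, clarify)
      fix x\<^sub>1 x\<^sub>2
      have "of_int (snd w) / N * of_int x\<^sub>2 + (of_int (x\<^sub>1 * fst w) / N - c)
          = of_int (x\<^sub>1 * fst w + x\<^sub>2 * snd w) / N - c" for w :: "int \<times> int"
        by (simp add: add_divide_distrib mult.commute)
      then show "of_real (tz 2 (\<alpha> * of_int x\<^sub>1) * tz 2 (\<alpha> * of_int x\<^sub>2) *
         (tz l (of_int (x\<^sub>1 * fst y + x\<^sub>2 * snd y) / N - c) * tz l (of_int (x\<^sub>1 * fst z + x\<^sub>2 * snd z) / N - c))) *
         ee (of_int x\<^sub>1 * fst \<xi> + of_int x\<^sub>2 * snd \<xi>)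
        = of_real (tz 2 (\<alpha> * of_int x\<^sub>1)) * ee (of_int x\<^sub>1 * fst \<xi>) * (of_real (h x\<^sub>1 x\<^sub>2) * ee (of_int x\<^sub>2 * snd \<xi>))"
        unfolding h_def ee_add by (simp only: of_real_mult mult_ac)
    qed
    then show ?thesis by (simp only: sum_distrib_left)
  qed
  have one: "norm (\<Sum>n\<in>{-R..R}. of_real (h x\<^sub>1 n) * ee (of_int n * snd \<xi>)) * (dnorm (snd \<xi>))\<^sup>2 \<le> ?C / M" for x\<^sub>1
    unfolding h_def by (rule kernel_one_dim[OF M L l sl R supp])
  have "norm (kern R \<alpha> ?F y z \<xi>) * (dnorm (snd \<xi>))\<^sup>2
      \<le> (\<Sum>x\<^sub>1\<in>{-R..R}. norm (\<Sum>n\<in>{-R..R}. of_real (h x\<^sub>1 n) * ee (of_int n * snd \<xi>))) * (dnorm (snd \<xi>))\<^sup>2"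
    unfolding eq
  proof (intro mult_right_mono sum_norm_le)
    fix x\<^sub>1
    show "norm (of_real (tz 2 (\<alpha> * of_int x\<^sub>1)) * ee (of_int x\<^sub>1 * fst \<xi>) *
        (\<Sum>n\<in>{-R..R}. of_real (h x\<^sub>1 n) * ee (of_int n * snd \<xi>)))
      \<le> norm (\<Sum>n\<in>{-R..R}. of_real (h x\<^sub>1 n) * ee (of_int n * snd \<xi>))"
      using tz1(2) by (simp add: norm_mult mult_left_le_one_le)
  qed auto
  also have "\<dots> = (\<Sum>x\<^sub>1\<in>{-R..R}. norm (\<Sum>n\<in>{-R..R}. of_real (h x\<^sub>1 n) * ee (of_int n * snd \<xi>)) * (dnorm (snd \<xi>))\<^sup>2)"
    by (rule sum_distrib_right)
  also have "\<dots> \<le> (\<Sum>x\<^sub>1\<in>{-R..R}. ?C / M)" by (intro sum_mono one)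
  also have "\<dots> = real (card {-R..R}) * (?C / M)" by simp
  also have "\<dots> \<le> ((2 * \<Lambda> + 1) * M) * (?C / M)"
    using C M by (intro mult_right_mono cardR) auto
  also have "\<dots> = (2 * \<Lambda> + 1) * ?C" using M by simp
  also have "\<dots> \<le> kernC \<Lambda>" by (simp add: kernC_def)
  finally have "norm (kern R \<alpha> ?F y z \<xi>) * (dnorm (snd \<xi>))\<^sup>2 * M\<^sup>2 \<le> kernC \<Lambda> * M\<^sup>2"
    by (intro mult_right_mono) auto
  then show "norm (kern R \<alpha> ?F y z \<xi>) * (M * dnorm (snd \<xi>))\<^sup>2 \<le> kernC \<Lambda> * M\<^sup>2"
    by (simp add: power_mult_distrib mult_ac)
  have "norm (kern R \<alpha> ?F y z \<xi>) \<le> (\<Sum>x\<in>{-R..R} \<times> {-R..R}. 1)"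
    unfolding kern_def
  proof (intro sum_norm_le, clarify)
    fix x\<^sub>1 x\<^sub>2
    show "norm (of_real (tz 2 (\<alpha> * of_int x\<^sub>1) * tz 2 (\<alpha> * of_int x\<^sub>2) *
         (tz l (of_int (x\<^sub>1 * fst y + x\<^sub>2 * snd y) / N - c) * tz l (of_int (x\<^sub>1 * fst z + x\<^sub>2 * snd z) / N - c))) *
         ee (of_int x\<^sub>1 * fst \<xi> + of_int x\<^sub>2 * snd \<xi>)) \<le> 1"
      unfolding norm_mult norm_ee norm_of_real by (simp only: mult_1_right) (intro prod tz1)
  qed
  also have "\<dots> = real (card {-R..R}) * real (card {-R..R})" by (simp add: card_cartesian_product)
  also have "\<dots> \<le> ((2 * \<Lambda> + 1) * M) * ((2 * \<Lambda> + 1) * M)"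
    using cardR L M by (intro mult_mono) auto
  also have "\<dots> = (2 * \<Lambda> + 1)\<^sup>2 * M\<^sup>2" by (simp add: power2_eq_square)
  also have "\<dots> \<le> kernC \<Lambda> * M\<^sup>2" unfolding kernC_def using C L by (intro mult_right_mono) auto
  finally show "norm (kern R \<alpha> ?F y z \<xi>) \<le> kernC \<Lambda> * M\<^sup>2" .
qed

text \<open>Charge every index to the least \<open>j\<close> with \<open>d i \<le> 2 ^ j\<close>;
  there \<open>K i \<le> 4 * Q / (2 ^ j)\<^sup>2\<close>. The quadratic growth of the counts cancels
  the quadratic decay exactly, so all \<open>k + 1\<close> levels contribute alike and a logarithm
  is lost.\<close>

lemma sum_le_layers:
  fixes K d :: "'i \<Rightarrow> real"
  assumes "finite I" "0 \<le> Q" "\<And>i. i \<in> I \<Longrightarrow> K i \<le> Q" "\<And>i. i \<in> I \<Longrightarrow> K i * (d i)\<^sup>2 \<le> Q"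
    "\<And>i. i \<in> I \<Longrightarrow> d i \<le> 2 ^ k" "\<And>i. i \<in> I \<Longrightarrow> 0 \<le> K i"
    and card: "\<And>j. j \<le> k \<Longrightarrow> real (card {i \<in> I. d i \<le> 2 ^ j}) \<le> A0 * (2 ^ j)\<^sup>2"
  shows "(\<Sum>i\<in>I. K i) \<le> 4 * Q * A0 * (real k + 1)"
proof -
  have "K i \<le> (\<Sum>j\<le>k. if d i \<le> 2 ^ j then 4 * Q / (2 ^ j)\<^sup>2 else 0)" if i: "i \<in> I" for i
  proof -
    define j where "j = (LEAST j. d i \<le> 2 ^ j)"
    have j: "d i \<le> 2 ^ j" unfolding j_def using assms(5)[OF i] by (rule LeastI)
    have jk: "j \<le> k" unfolding j_def using assms(5)[OF i] by (rule Least_le)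
    have "K i \<le> 4 * Q / (2 ^ j)\<^sup>2"
    proof (cases j)
      case 0
      then show ?thesis using assms(3)[OF i] assms(2) by simp
    next
      case (Suc m)
      then have "2 ^ m < d i" using not_less_Least[of m "\<lambda>j. d i \<le> 2 ^ j"] by (simp add: j_def)
      then have "(2 ^ m)\<^sup>2 \<le> (d i)\<^sup>2" by (intro power_mono) auto
      then have "K i * (2 ^ m)\<^sup>2 \<le> K i * (d i)\<^sup>2" using assms(6)[OF i] by (intro mult_left_mono)
      then have "K i * (2 ^ m)\<^sup>2 \<le> Q" using assms(4)[OF i] by linarith
      then show ?thesis using Suc by (simp add: field_simps power_mult_distrib)
    qed
    also have "\<dots> = (\<Sum>j'\<in>{j}. if d i \<le> 2 ^ j' then 4 * Q / (2 ^ j')\<^sup>2 else 0)" using j by simp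
    also have "\<dots> \<le> (\<Sum>j\<le>k. if d i \<le> 2 ^ j then 4 * Q / (2 ^ j)\<^sup>2 else 0)"
      using jk assms(2) by (intro sum_mono2) auto
    finally show ?thesis .
  qed
  then have "(\<Sum>i\<in>I. K i) \<le> (\<Sum>i\<in>I. \<Sum>j\<le>k. if d i \<le> 2 ^ j then 4 * Q / (2 ^ j)\<^sup>2 else 0)"
    by (rule sum_mono)
  also have "\<dots> = (\<Sum>j\<le>k. \<Sum>i\<in>I. if d i \<le> 2 ^ j then 4 * Q / (2 ^ j)\<^sup>2 else 0)" by (rule sum.swap)
  also have "\<dots> = (\<Sum>j\<le>k. real (card {i \<in> I. d i \<le> 2 ^ j}) * (4 * Q / (2 ^ j)\<^sup>2))"
    using assms(1) by (simp add: sum.If_cases Int_def)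
  also have "\<dots> \<le> (\<Sum>j\<le>k. (A0 * (2 ^ j)\<^sup>2) * (4 * Q / (2 ^ j)\<^sup>2))"
    using card assms(2) by (intro sum_mono mult_right_mono) auto
  also have "\<dots> = (\<Sum>j\<le>k. 4 * Q * A0)" by (intro sum.cong refl) simp
  also have "\<dots> = 4 * Q * A0 * (real k + 1)" by (simp add: algebra_simps)
  finally show ?thesis .
qed

subsection \<open>A large sieve inequality for bilinear forms\<close>

definition ip :: "int \<times> int \<Rightarrow> int \<times> int \<Rightarrow> int" where
  "ip a b = fst a * fst b + snd a * snd b"

text \<open>Duality: \<open>T\<close> is the sum over \<open>u\<close> of \<open>Bf (x u)\<close>,
  which is linear in the conjugates of \<open>S\<close>. After Cauchy-Schwarz over \<open>u\<close>,
  positivity allows the prefix vectors to be replaced by all of \<open>B\<close> with weight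
  \<open>W\<close>, at multiplicity at most 2. The opened square is a form with kernel
  \<open>Ker\<close>, bounded through its row sums \<open>G\<close> as in Schur's test, and one
  factor \<open>T\<close> cancels.\<close>

lemma large_sieve:
  fixes x :: "'u \<Rightarrow> int \<times> int" and y :: "'v \<Rightarrow> int \<times> int" and W :: "int \<times> int \<Rightarrow> real"
    and F :: "real \<Rightarrow> real" and \<Theta> :: "real set"
  assumes fin: "finite U" "finite Y" "finite \<Theta>" "finite B"
    and xB: "x ` U \<subseteq> B" and fib: "\<And>b. real (card {u \<in> U. x u = b}) \<le> 2"
    and G0: "0 \<le> G" and W: "\<And>b. 0 \<le> W b" "\<And>u. u \<in> U \<Longrightarrow> W (x u) = 1"
    and G: "\<And>p :: real \<times> 'v. p \<in> \<Theta> \<times> Y \<Longrightarrow> (\<Sum>q\<in>\<Theta> \<times> Y. norm (\<Sum>b\<in>B. of_real (W b * (F (ip b (y (snd p))) * F (ip b (y (snd q)))))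
        * ee (fst p * ip b (y (snd p)) - fst q * ip b (y (snd q))))) \<le> G"
  shows "(\<Sum>\<theta>\<in>\<Theta>. (norm (\<Sum>u\<in>U. \<Sum>v\<in>Y. of_real (F (ip (x u) (y v))) * ee (\<theta> * ip (x u) (y v))))\<^sup>2)
    \<le> 2 * real (card U) * real (card Y) * G"
proof -
  define S where "S \<theta> = (\<Sum>u\<in>U. \<Sum>v\<in>Y. of_real (F (ip (x u) (y v))) * ee (\<theta> * ip (x u) (y v)))" for \<theta> :: real
  define T where "T = (\<Sum>\<theta>\<in>\<Theta>. (norm (S \<theta>))\<^sup>2)"
  define t where "t p b = cnj (S (fst p)) * (of_real (F (ip b (y (snd p)))) * ee (fst p * ip b (y (snd p))))" for p :: "real \<times> 'v" and b
  define Bf where "Bf b = (\<Sum>p\<in>\<Theta> \<times> Y. t p b)" for b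
  define Ker where "Ker p q = (\<Sum>b\<in>B. of_real (W b * (F (ip b (y (snd p))) * F (ip b (y (snd q)))))
        * ee (fst p * ip b (y (snd p)) - fst q * ip b (y (snd q))))" for p q :: "real \<times> 'v"
  let ?P = "\<Theta> \<times> Y"
  have T0: "0 \<le> T" unfolding T_def by (intro sum_nonneg) auto
  have "complex_of_real T = (\<Sum>\<theta>\<in>\<Theta>. cnj (S \<theta>) * S \<theta>)"
    unfolding T_def of_real_sum complex_norm_square by (simp add: mult.commute)
  also have "\<dots> = (\<Sum>\<theta>\<in>\<Theta>. \<Sum>u\<in>U. \<Sum>v\<in>Y. t (\<theta>, v) (x u))"
    by (subst (2) S_def) (simp add: sum_distrib_left t_def)
  also have "\<dots> = (\<Sum>u\<in>U. \<Sum>\<theta>\<in>\<Theta>. \<Sum>v\<in>Y. t (\<theta>, v) (x u))" by (rule sum.swap)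
  also have "\<dots> = (\<Sum>u\<in>U. Bf (x u))" unfolding Bf_def sum.cartesian_product by (simp add: case_prod_unfold)
  finally have "T \<le> (\<Sum>u\<in>U. norm (Bf (x u)))"
    using norm_sum[of "\<lambda>u. Bf (x u)" U] T0 by (metis abs_of_nonneg norm_of_real)
  then have "T\<^sup>2 \<le> (\<Sum>u\<in>U. norm (Bf (x u)))\<^sup>2" using T0 by (intro power_mono)
  also have "\<dots> \<le> real (card U) * (\<Sum>u\<in>U. (norm (Bf (x u)))\<^sup>2)"
    using sum_squared_le_sum_of_squares[of "\<lambda>u. norm (Bf (x u))" U] by (simp add: mult.commute)
  also have "(\<Sum>u\<in>U. (norm (Bf (x u)))\<^sup>2) \<le> 2 * (\<Sum>b\<in>B. W b * (norm (Bf b))\<^sup>2)"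
  proof -
    have "(\<Sum>u\<in>U. (norm (Bf (x u)))\<^sup>2) = (\<Sum>u\<in>U. W (x u) * (norm (Bf (x u)))\<^sup>2)"
      using W(2) by (intro sum.cong refl) simp
    also have "\<dots> = (\<Sum>b\<in>x ` U. \<Sum>u\<in>{u \<in> U. x u = b}. W (x u) * (norm (Bf (x u)))\<^sup>2)"
      by (rule sum.image_gen[OF fin(1)])
    also have "\<dots> = (\<Sum>b\<in>x ` U. real (card {u \<in> U. x u = b}) * (W b * (norm (Bf b))\<^sup>2))"
      by (intro sum.cong refl) simp
    also have "\<dots> \<le> (\<Sum>b\<in>x ` U. 2 * (W b * (norm (Bf b))\<^sup>2))"
      using W by (intro sum_mono mult_right_mono fib) auto
    also have "\<dots> \<le> (\<Sum>b\<in>B. 2 * (W b * (norm (Bf b))\<^sup>2))"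
      using xB fin W by (intro sum_mono2) auto
    finally show ?thesis by (simp add: sum_distrib_left)
  qed
  finally have 1: "T\<^sup>2 \<le> 2 * real (card U) * (\<Sum>b\<in>B. W b * (norm (Bf b))\<^sup>2)" by (simp add: mult_left_mono)
  have sym: "norm (Ker q p) = norm (Ker p q)" for p q
  proof -
    have "Ker q p = cnj (Ker p q)"
      unfolding Ker_def cnj_sum by (intro sum.cong refl) (simp add: cnj_ee mult_ac)
    then show ?thesis by simp
  qed
  have "complex_of_real (\<Sum>b\<in>B. W b * (norm (Bf b))\<^sup>2) = (\<Sum>b\<in>B. \<Sum>p\<in>?P. \<Sum>q\<in>?P. of_real (W b) * (t p b * cnj (t q b)))"
    unfolding of_real_sum of_real_mult complex_norm_square Bf_def cnj_sum sum_product
    unfolding sum_distrib_left ..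
  also have "\<dots> = (\<Sum>p\<in>?P. \<Sum>b\<in>B. \<Sum>q\<in>?P. of_real (W b) * (t p b * cnj (t q b)))"
    by (rule sum.swap)
  also have "\<dots> = (\<Sum>p\<in>?P. \<Sum>q\<in>?P. \<Sum>b\<in>B. of_real (W b) * (t p b * cnj (t q b)))"
    by (intro sum.cong refl sum.swap)
  also have "\<dots> = (\<Sum>p\<in>?P. \<Sum>q\<in>?P. cnj (S (fst p)) * S (fst q) * Ker p q)"
    unfolding Ker_def sum_distrib_left
  proof (intro sum.cong refl)
    fix p q :: "real \<times> 'v" and b
    have "ee (fst p * ip b (y (snd p)) - fst q * ip b (y (snd q)))
        = ee (fst p * ip b (y (snd p))) * cnj (ee (fst q * ip b (y (snd q))))"
      unfolding cnj_ee ee_add[symmetric] by simp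
    then show "of_real (W b) * (t p b * cnj (t q b)) = cnj (S (fst p)) * S (fst q) *
        (of_real (W b * (F (ip b (y (snd p))) * F (ip b (y (snd q)))))
        * ee (fst p * ip b (y (snd p)) - fst q * ip b (y (snd q))))"
      by (simp add: t_def mult_ac)
  qed
  finally have eq: "complex_of_real (\<Sum>b\<in>B. W b * (norm (Bf b))\<^sup>2)
      = (\<Sum>p\<in>?P. \<Sum>q\<in>?P. cnj (S (fst p)) * S (fst q) * Ker p q)" .
  have "(\<Sum>b\<in>B. W b * (norm (Bf b))\<^sup>2) \<le> norm (\<Sum>p\<in>?P. \<Sum>q\<in>?P. cnj (S (fst p)) * S (fst q) * Ker p q)"
    unfolding eq[symmetric] norm_of_real by (rule abs_ge_self)
  also have "\<dots> \<le> (\<Sum>p\<in>?P. \<Sum>q\<in>?P. norm (S (fst p)) * norm (S (fst q)) * norm (Ker p q))"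
    by (intro sum_norm_le) (simp add: norm_mult)
  \<comment> \<open>Schur's test: the arithmetic-geometric mean inequality separates the two values
    of \<open>S\<close>, and since \<open>norm (Ker p q)\<close> is symmetric both halves lead to
    the same row sums.\<close>
  also have "\<dots> \<le> (\<Sum>p\<in>?P. \<Sum>q\<in>?P. ((norm (S (fst p)))\<^sup>2 * norm (Ker p q) + (norm (S (fst q)))\<^sup>2 * norm (Ker p q)) / 2)"
  proof (intro sum_mono)
    fix p q
    have "0 \<le> (norm (S (fst p)) - norm (S (fst q)))\<^sup>2 * norm (Ker p q)" by simp
    moreover have "(a - b)\<^sup>2 * c = a\<^sup>2 * c + b\<^sup>2 * c - 2 * (a * b * c)" for a b c :: real
      by (simp add: power2_eq_square algebra_simps)
    ultimately show "norm (S (fst p)) * norm (S (fst q)) * norm (Ker p q)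
        \<le> ((norm (S (fst p)))\<^sup>2 * norm (Ker p q) + (norm (S (fst q)))\<^sup>2 * norm (Ker p q)) / 2"
      by simp
  qed
  also have "\<dots> = ((\<Sum>p\<in>?P. \<Sum>q\<in>?P. (norm (S (fst p)))\<^sup>2 * norm (Ker p q))
      + (\<Sum>p\<in>?P. \<Sum>q\<in>?P. (norm (S (fst q)))\<^sup>2 * norm (Ker p q))) / 2"
    by (simp only: sum.distrib sum_divide_distrib[symmetric])
  also have "(\<Sum>p\<in>?P. \<Sum>q\<in>?P. (norm (S (fst q)))\<^sup>2 * norm (Ker p q))
      = (\<Sum>p\<in>?P. \<Sum>q\<in>?P. (norm (S (fst p)))\<^sup>2 * norm (Ker p q))"
    unfolding sum.swap[of "\<lambda>p q. (norm (S (fst q)))\<^sup>2 * norm (Ker p q)"]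
    by (intro sum.cong refl arg_cong2[where f = "(*)"] sym)
  also have "((\<Sum>p\<in>?P. \<Sum>q\<in>?P. (norm (S (fst p)))\<^sup>2 * norm (Ker p q))
      + (\<Sum>p\<in>?P. \<Sum>q\<in>?P. (norm (S (fst p)))\<^sup>2 * norm (Ker p q))) / 2
      = (\<Sum>p\<in>?P. (norm (S (fst p)))\<^sup>2 * (\<Sum>q\<in>?P. norm (Ker p q)))"
  proof -
    have "(a + a) / 2 = a" for a :: real by simp
    then show ?thesis unfolding sum_distrib_left by (simp only:)
  qed
  also have "\<dots> \<le> (\<Sum>p\<in>?P. (norm (S (fst p)))\<^sup>2 * G)"
    by (intro sum_mono mult_left_mono G[folded Ker_def]) auto
  also have "\<dots> = (\<Sum>\<theta>\<in>\<Theta>. \<Sum>v\<in>Y. (norm (S \<theta>))\<^sup>2 * G)"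
    unfolding sum.cartesian_product by (simp add: case_prod_unfold)
  also have "\<dots> = real (card Y) * G * T"
    unfolding T_def by (simp add: sum_distrib_left mult_ac)
  finally have "(\<Sum>b\<in>B. W b * (norm (Bf b))\<^sup>2) \<le> real (card Y) * G * T" .
  then have "T\<^sup>2 \<le> 2 * real (card U) * (real (card Y) * G * T)"
    using 1 by (intro order_trans[OF 1] mult_left_mono) auto
  then have le: "T * T \<le> (2 * real (card U) * real (card Y) * G) * T" by (simp add: power2_eq_square mult_ac)
  have "T \<le> 2 * real (card U) * real (card Y) * G"
  proof (cases "T = 0")
    case False
    then show ?thesis using le T0 by (simp add: mult_le_cancel_right)
  qed (use G0 in simp)
  then show ?thesis unfolding T_def S_def .
qed

section \<open>The generating exponential sum\<close>

context critical_alphabet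
begin

text \<open>Supported between \<open>N\<close> and \<open>(2 * a0 + 1) * N\<close> and equal to 1
  between \<open>2 * N\<close> and \<open>2 * a0 * N\<close>. The plateau contains the denominators
  of all words in \<open>stop (2 * N)\<close>; the slopes of order \<open>1 / N\<close> make
  \<open>kern_bound_snd\<close> applicable, which a sharp cut-off would not.\<close>

definition wt :: "nat \<Rightarrow> real \<Rightarrow> real" where
  "wt N t = tz a0 (t / real N - (a0 + 1))"

definition Wset :: "nat \<Rightarrow> nat list set" where
  "Wset N = {w. set w \<subseteq> A \<and> real_of_int (den w) \<le> (2 * a0 + 1) * real N}"

definition S :: "nat \<Rightarrow> real \<Rightarrow> complex" where
  "S N \<theta> = (\<Sum>w\<in>Wset N. of_real (wt N (den w)) * ee (\<theta> * of_int (den w)))"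

text \<open>The range forced on the tail by the support of \<open>wt N\<close> when the prefix has
  denominator between \<open>M\<close> and \<open>a0 * M\<close> and \<open>L = N / M\<close>; the 2
  in the lower end comes from \<open>den_append_le\<close>.\<close>

definition Yset :: "real \<Rightarrow> nat list set" where
  "Yset L = {v. set v \<subseteq> A \<and> L / (2 * a0) \<le> real_of_int (den v) \<and> real_of_int (den v) \<le> (2 * a0 + 1) * L}"

lemma finite_Wset: "finite (Wset N)"
  unfolding Wset_def by (rule finite_den_le)

lemma finite_Yset: "finite (Yset L)"
  unfolding Yset_def by (rule finite_subset[OF _ finite_den_le[of "(2 * a0 + 1) * L"]]) auto

lemma YsetD:
  assumes "v \<in> Yset L"
  shows "set v \<subseteq> A" "0 \<notin> set v" "L / (2 * a0) \<le> real_of_int (den v)" "real_of_int (den v) \<le> (2 * a0 + 1) * L"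
    "0 \<le> real_of_int (num v)" "real_of_int (num v) \<le> real_of_int (den v)" "1 \<le> real_of_int (den v)"
  using assms word_pos[of v] num_nonneg[of v] num_le_den[of v] den_word_ge1[of v] by (auto simp: Yset_def)

lemma wt_eq_0:
  assumes "0 < N" "t \<le> real N \<or> (2 * a0 + 1) * real N \<le> t"
  shows "wt N t = 0"
proof -
  have "t / real N \<le> 1 \<or> 2 * a0 + 1 \<le> t / real N" using assms by (auto simp: field_simps)
  then have "a0 \<le> \<bar>t / real N - (a0 + 1)\<bar>" by linarith
  then show ?thesis unfolding wt_def using a0_ge by (intro tz_eq_0) auto
qed

lemma wt_eq_1:
  assumes "0 < N" "2 * real N \<le> t" "t \<le> 2 * a0 * real N"
  shows "wt N t = 1"
proof -
  have "2 \<le> t / real N" "t / real N \<le> 2 * a0" using assms by (auto simp: field_simps)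
  then have "\<bar>t / real N - (a0 + 1)\<bar> \<le> a0 - 1" by linarith
  then show ?thesis unfolding wt_def using a0_ge by (intro tz_eq_1) auto
qed

lemma wt_nonneg: "0 \<le> wt N t"
  unfolding wt_def using a0_ge by (intro tz_bounds) auto

lemma den_append_ip: "den (u @ v) = ip (den u, denp u) (den v, num v)"
  by (simp add: ip_def den_append)

text \<open>Every word of the support has exactly one prefix in \<open>stop M\<close>, because its
  denominator is at least \<open>N \<ge> M\<close>. Restricting to nonzero weights makes
  concatenation a bijection; the pairs of weight 0 are restored afterwards to obtain a full
  product.\<close>

lemma S_decompose:
  assumes N: "0 < N" and M: "1 \<le> M" "M \<le> real N"
  shows "S N \<theta> = (\<Sum>u\<in>stop M. \<Sum>v\<in>Yset (real N / M).
    of_real (wt N (ip (den u, denp u) (den v, num v))) * ee (\<theta> * of_int (ip (den u, denp u) (den v, num v))))"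
proof -
  let ?g = "\<lambda>w. of_real (wt N (den w)) * ee (\<theta> * of_int (den w))"
  let ?Q = "{p \<in> stop M \<times> Yset (real N / M). wt N (den (fst p @ snd p)) \<noteq> 0}"
  have bij: "bij_betw (\<lambda>p. fst p @ snd p) ?Q {w \<in> Wset N. wt N (den w) \<noteq> 0}"
    unfolding bij_betw_def
  proof (intro conjI)
    show "inj_on (\<lambda>p. fst p @ snd p) ?Q"
    proof (rule inj_onI)
      fix p q assume pq: "p \<in> ?Q" "q \<in> ?Q" "fst p @ snd p = fst q @ snd q"
      have "set (fst p @ snd p) \<subseteq> A"
        using pq(1) stopD(1)[of "fst p" M] YsetD(1)[of "snd p" "real N / M"] M by auto
      moreover have "fst p \<in> stop M" "fst q \<in> stop M" using pq by auto
      ultimately have "fst p = fst q \<and> snd p = snd q" using stop_unique pq(3) by blast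
      then show "p = q" by (simp add: prod_eq_iff)
    qed
    show "(\<lambda>p. fst p @ snd p) ` ?Q = {w \<in> Wset N. wt N (den w) \<noteq> 0}"
    proof (intro equalityI subsetI)
      fix w assume "w \<in> (\<lambda>p. fst p @ snd p) ` ?Q"
      then obtain p where p: "p \<in> ?Q" "w = fst p @ snd p" by auto
      have "set w \<subseteq> A" using p stopD(1)[of "fst p" M] YsetD(1)[of "snd p" "real N / M"] M by auto
      moreover have "real_of_int (den w) \<le> (2 * a0 + 1) * real N"
        using p wt_eq_0[OF N, of "real_of_int (den w)"] by (cases "(2 * a0 + 1) * real N \<le> den w") auto
      ultimately show "w \<in> {w \<in> Wset N. wt N (den w) \<noteq> 0}" using p by (auto simp: Wset_def)
    next
      fix w assume w: "w \<in> {w \<in> Wset N. wt N (den w) \<noteq> 0}"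
      have wA: "set w \<subseteq> A" and up: "real_of_int (den w) \<le> (2 * a0 + 1) * real N" using w by (auto simp: Wset_def)
      have low: "real N \<le> den w" using w wt_eq_0[OF N, of "real_of_int (den w)"] by force
      then have "M \<le> den w" using M by simp
      then obtain u v where uv: "u \<in> stop M" "w = u @ v" using stop_prefix[OF wA] by blast
      note u = stopD[OF uv(1) M(1)]
      have vA: "set v \<subseteq> A" using wA uv by auto
      have v1: "1 \<le> real_of_int (den v)" using den_word_ge1[OF vA] .
      have d1: "real_of_int (den u) * real_of_int (den v) \<le> real_of_int (den w)"
        using den_append_ge[OF word_pos[OF u(1)] word_pos[OF vA]] uv(2) by (simp flip: of_int_mult)
      have "real_of_int (den w) \<le> real_of_int (2 * den u * den v)"
        using den_append_le[OF word_pos[OF u(1)] word_pos[OF vA]] uv(2) by (simp only: of_int_le_iff)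
      then have d2: "real_of_int (den w) \<le> 2 * (real_of_int (den u) * real_of_int (den v))" by simp
      have "M * den v \<le> real_of_int (den u) * den v" using u v1 by (intro mult_right_mono) auto
      then have "M * den v \<le> (2 * a0 + 1) * real N" using d1 up by linarith
      then have a: "real_of_int (den v) \<le> (2 * a0 + 1) * (real N / M)" using M by (simp add: field_simps)
      have "real_of_int (den u) * den v \<le> (a0 * M) * den v" using u v1 by (intro mult_right_mono) auto
      then have "real N \<le> 2 * (a0 * M * den v)" using d2 low by linarith
      then have b: "real N / M / (2 * a0) \<le> real_of_int (den v)" using M a0_ge by (simp add: field_simps)
      have "(u, v) \<in> ?Q" using uv a b vA w by (auto simp: Yset_def)
      then show "w \<in> (\<lambda>p. fst p @ snd p) ` ?Q" using uv by (intro image_eqI[of _ _ "(u, v)"]) auto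
    qed
  qed
  have "S N \<theta> = (\<Sum>w\<in>{w \<in> Wset N. wt N (den w) \<noteq> 0}. ?g w)"
    unfolding S_def by (rule sum.mono_neutral_right) (auto simp: finite_Wset)
  also have "\<dots> = (\<Sum>p\<in>?Q. ?g (fst p @ snd p))" by (rule sum.reindex_bij_betw[OF bij, symmetric])
  also have "\<dots> = (\<Sum>p\<in>stop M \<times> Yset (real N / M). ?g (fst p @ snd p))"
    by (rule sum.mono_neutral_left) (auto simp: finite_stop[OF M(1)] finite_Yset)
  also have "\<dots> = (\<Sum>u\<in>stop M. \<Sum>v\<in>Yset (real N / M). ?g (u @ v))"
    unfolding sum.cartesian_product by (simp add: case_prod_unfold)
  finally show ?thesis unfolding den_append_ip .
qed

text \<open>Describes where \<open>kern\<close> fails to decay: both coordinates of \<theta>'v' -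
  \<theta>v lie within \<open>r\<close> of an integer.\<close>

definition close :: "real \<Rightarrow> real \<times> nat list \<Rightarrow> real \<times> nat list \<Rightarrow> bool" where
  "close r p q \<longleftrightarrow> dnorm (fst q * of_int (den (snd q)) - fst p * of_int (den (snd p))) \<le> r \<and>
     dnorm (fst q * of_int (num (snd q)) - fst p * of_int (num (snd p))) \<le> r"

lemma card_Yset_le: "\<exists>C>0. \<forall>L\<ge>1. real (card (Yset L)) \<le> C * L powr (2 * \<delta>)"
proof -
  obtain C where C: "C > 0" "\<And>B. 1 \<le> B \<Longrightarrow> real (card {w. set w \<subseteq> A \<and> B / (2 * a0 + 1) \<le> den w \<and> den w \<le> (2 * a0 + 1) * B}) \<le> C * B powr (2 * \<delta>)"
    using card_den_range_le[of "2 * a0 + 1"] a0_ge by auto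
  have "real (card (Yset L)) \<le> C * L powr (2 * \<delta>)" if L: "1 \<le> L" for L
  proof -
    have "L / (2 * a0 + 1) \<le> L / (2 * a0)" using L a0_ge by (intro divide_left_mono) auto
    then have "Yset L \<subseteq> {w. set w \<subseteq> A \<and> L / (2 * a0 + 1) \<le> den w \<and> den w \<le> (2 * a0 + 1) * L}"
      unfolding Yset_def by auto
    then have "card (Yset L) \<le> card {w. set w \<subseteq> A \<and> L / (2 * a0 + 1) \<le> den w \<and> den w \<le> (2 * a0 + 1) * L}"
      by (intro card_mono finite_den_range)
    then show ?thesis using C(2)[OF L] by linarith
  qed
  then show ?thesis using C by blast
qed

text \<open>Reduces the mean square to counting close pairs. \<open>D\<close> measures distances in
  units of the resolution \<open>1 / M\<close>, and the quadratic dependence on \<open>D\<close> is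
  the one that \<open>sum_le_layers\<close> asks for. The numbers of prefixes and of tails multiply
  to order \<open>N powr (2 * \<delta>)\<close>.\<close>

lemma large_sieve_S:
  "\<exists>C>0. \<forall>N M Z A0. 0 < N \<longrightarrow> 1 \<le> M \<longrightarrow> M \<le> real N \<longrightarrow> finite Z \<longrightarrow> 0 \<le> A0 \<longrightarrow>
     (\<forall>p\<in>Z \<times> Yset (real N / M). \<forall>D. 1 \<le> D \<longrightarrow> D \<le> 2 * M \<longrightarrow>
        real (card {q \<in> Z \<times> Yset (real N / M). close (D / M) p q}) \<le> A0 * D\<^sup>2) \<longrightarrow>
     (\<Sum>\<theta>\<in>Z. (norm (S N \<theta>))\<^sup>2) \<le> C * real N powr (2 * \<delta>) * M\<^sup>2 * (1 + ln M) * A0"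
proof -
  obtain CY where CY: "CY > 0" "\<And>L. 1 \<le> L \<Longrightarrow> real (card (Yset L)) \<le> CY * L powr (2 * \<delta>)"
    using card_Yset_le by blast
  define CU where "CU = 16 powr \<delta> * a0 powr (2 * \<delta>)"
  have CU: "CU > 0" using a0_ge by (simp add: CU_def)
  define \<Lambda> where "\<Lambda> = 2 * a0 + 1"
  define KC where "KC = kernC \<Lambda>"
  have KC: "KC > 0" unfolding KC_def kernC_def \<Lambda>_def using a0_ge by (intro add_pos_nonneg) auto
  define C where "C = 16 * CU * CY * KC"
  have main: "(\<Sum>\<theta>\<in>Z. (norm (S N \<theta>))\<^sup>2) \<le> C * real N powr (2 * \<delta>) * M\<^sup>2 * (1 + ln M) * A0"
    if N: "0 < N" and M: "1 \<le> M" "M \<le> real N" and Z: "finite Z" and A0: "0 \<le> A0"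
      and cnt: "\<And>p D. p \<in> Z \<times> Yset (real N / M) \<Longrightarrow> 1 \<le> D \<Longrightarrow> D \<le> 2 * M \<Longrightarrow>
        real (card {q \<in> Z \<times> Yset (real N / M). close (D / M) p q}) \<le> A0 * D\<^sup>2"
    for N :: nat and M A0 :: real and Z :: "real set"
  proof -
    define Y where "Y = Yset (real N / M)"
    have finY: "finite Y" by (simp add: Y_def finite_Yset)
    \<comment> \<open>The cut-off \<open>tz 2 (\<alpha> * x)\<close> is then 1 for
      \<open>\<bar>x\<bar> \<le> a0 * M\<close>, hence at all prefix vectors, and 0 for
      \<open>\<bar>x\<bar> \<ge> R\<close>.\<close>
    define R where "R = \<lceil>2 * a0 * M\<rceil>"
    define \<alpha> where "\<alpha> = 1 / (a0 * M)"
    have a0M: "0 < a0 * M" using a0_ge M by simp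
    have R: "0 \<le> R" "of_int R \<le> \<Lambda> * M" "2 * a0 * M \<le> of_int R"
    proof -
      have "0 < 2 * a0 * M" using a0_ge M by (intro mult_pos_pos) auto
      then show "0 \<le> R" unfolding R_def by linarith
      have "of_int R \<le> 2 * a0 * M + 1" unfolding R_def by linarith
      then show "of_int R \<le> \<Lambda> * M" using M by (simp add: \<Lambda>_def algebra_simps)
      show "2 * a0 * M \<le> of_int R" unfolding R_def by simp
    qed
    have \<alpha>: "\<bar>\<alpha>\<bar> \<le> \<Lambda> / M"
    proof -
      have "1 / a0 \<le> 1" using a0_ge by simp
      then have "1 / a0 \<le> \<Lambda>" using a0_ge unfolding \<Lambda>_def by linarith
      then have "1 / a0 / M \<le> \<Lambda> / M" using M by (intro divide_right_mono) auto
      then have "1 / (a0 * M) \<le> \<Lambda> / M" by simp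
      moreover have "\<bar>\<alpha>\<bar> = \<alpha>" unfolding \<alpha>_def using a0M by (intro abs_of_nonneg) auto
      ultimately show ?thesis unfolding \<alpha>_def by simp
    qed
    have supp: "2 \<le> \<bar>\<alpha> * of_int n\<bar>" if "R \<le> \<bar>n\<bar>" for n
    proof -
      have "2 * a0 * M \<le> real_of_int \<bar>n\<bar>" using R(3) that by linarith
      then have "2 \<le> real_of_int \<bar>n\<bar> / (a0 * M)" using a0M by (subst pos_le_divide_eq) (auto simp: mult_ac)
      then show ?thesis using a0M by (simp add: \<alpha>_def)
    qed
    define yv where "yv v = (den v, num v)" for v
    have sl: "\<bar>of_int (fst (yv v)) / real N\<bar> \<le> \<Lambda> / M" "\<bar>of_int (snd (yv v)) / real N\<bar> \<le> \<Lambda> / M" if "v \<in> Y" for v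
    proof -
      note v = YsetD[OF that[unfolded Y_def]]
      have "real_of_int (den v) / real N \<le> (2 * a0 + 1) * (real N / M) / real N"
        using v N by (intro divide_right_mono) auto
      then have d: "real_of_int (den v) / real N \<le> \<Lambda> / M" using N by (simp add: \<Lambda>_def)
      then show "\<bar>of_int (fst (yv v)) / real N\<bar> \<le> \<Lambda> / M" using v N by (simp add: yv_def)
      have "real_of_int (num v) / real N \<le> real_of_int (den v) / real N" using v by (intro divide_right_mono) auto
      then show "\<bar>of_int (snd (yv v)) / real N\<bar> \<le> \<Lambda> / M" using d v N by (simp add: yv_def)
    qed
    define ker where "ker p q = kern R \<alpha> (wt N) (yv (snd p)) (yv (snd q))
        (fst p * of_int (den (snd p)) - fst q * of_int (den (snd q)),
         fst p * of_int (num (snd p)) - fst q * of_int (num (snd q)))" for p q :: "real \<times> nat list"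
    define dd where "dd p q = M * max (dnorm (fst q * of_int (den (snd q)) - fst p * of_int (den (snd p))))
        (dnorm (fst q * of_int (num (snd q)) - fst p * of_int (num (snd p))))" for p q :: "real \<times> nat list"
    have dd_close: "dd p q \<le> D \<longleftrightarrow> close (D / M) p q" for p q D
      using M by (simp add: dd_def close_def field_simps max_mult_distrib_right max_mult_distrib_left)
    have wt_eq: "wt N = (\<lambda>t. tz a0 (t / real N - (a0 + 1)))" by (simp add: wt_def fun_eq_iff)
    have L1: "1 \<le> \<Lambda>" "1 \<le> a0" using a0_ge by (auto simp: \<Lambda>_def)
    have ker_bounds: "norm (ker p q) \<le> KC * M\<^sup>2" "norm (ker p q) * (dd p q)\<^sup>2 \<le> KC * M\<^sup>2"
      if "p \<in> Z \<times> Y" "q \<in> Z \<times> Y" for p q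
    proof -
      have pY: "snd p \<in> Y" "snd q \<in> Y" using that by auto
      let ?\<xi> = "(fst p * of_int (den (snd p)) - fst q * of_int (den (snd q)),
         fst p * of_int (num (snd p)) - fst q * of_int (num (snd q)))"
      have b1: "norm (ker p q) * (M * dnorm (snd ?\<xi>))\<^sup>2 \<le> KC * M\<^sup>2" "norm (ker p q) \<le> KC * M\<^sup>2"
        unfolding ker_def KC_def wt_eq
        by (rule kern_bound_snd[OF M(1) L1 \<alpha> sl(2)[OF pY(1)] sl(2)[OF pY(2)] R(1,2) supp], assumption)+
      have sl': "\<bar>of_int (snd (prod.swap (yv v))) / real N\<bar> \<le> \<Lambda> / M" if "v \<in> Y" for v
        using sl(1)[OF that] by simp
      have b2: "norm (ker p q) * (M * dnorm (snd (prod.swap ?\<xi>)))\<^sup>2 \<le> KC * M\<^sup>2"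
        unfolding ker_def KC_def wt_eq kern_swap[of R \<alpha> _ "yv (snd p)"]
        by (rule kern_bound_snd[OF M(1) L1 \<alpha> sl'[OF pY(1)] sl'[OF pY(2)] R(1,2) supp], assumption)
      show "norm (ker p q) \<le> KC * M\<^sup>2" by (rule b1(2))
      have neg: "dnorm (a - b) = dnorm (b - a)" for a b using dnorm_minus[of "a - b"] by simp
      show "norm (ker p q) * (dd p q)\<^sup>2 \<le> KC * M\<^sup>2"
        using b1(1) b2 unfolding dd_def max_def
        by (simp add: neg[of "fst p * of_int (den (snd p))"] neg[of "fst p * of_int (num (snd p))"])
    qed
    \<comment> \<open>Ensures \<open>M \<le> 2 ^ k \<le> 2 * M\<close>: the levels reach every
      possible distance, and each \<open>D = 2 ^ j\<close> stays inside the range of the counting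
      hypothesis.\<close>
    define k where "k = nat \<lceil>log 2 M\<rceil>"
    have lg: "0 \<le> log 2 M" using M by simp
    have k1: "M \<le> 2 ^ k"
    proof -
      have "M = 2 powr (log 2 M)" using M by simp
      also have "\<dots> \<le> 2 powr (real k)" unfolding k_def by (intro powr_mono) (use lg in linarith)+
      finally show ?thesis by (simp add: powr_realpow)
    qed
    have k2: "2 ^ k \<le> 2 * M"
    proof -
      have "real k \<le> log 2 M + 1" unfolding k_def using lg by linarith
      then have "2 powr (real k) \<le> 2 powr (log 2 M + 1)" by (intro powr_mono) auto
      then show ?thesis using M by (simp add: powr_realpow powr_add)
    qed
    have k3: "real k + 1 \<le> 2 * (1 + ln M)"
    proof -
      have "real k \<le> log 2 M + 1" unfolding k_def using lg by linarith
      moreover have "log 2 M \<le> 2 * ln M"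
      proof -
        have "ln (1 / 2 :: real) \<le> 1 / 2 - 1" by (rule ln_le_minus_one) simp
        then have "1 / 2 \<le> ln (2 :: real)" by (simp add: ln_div)
        then have "ln M / ln 2 \<le> ln M / (1 / 2)" using M by (intro divide_left_mono) auto
        then show ?thesis by (simp add: log_def)
      qed
      ultimately show ?thesis by simp
    qed
    define G where "G = 4 * (KC * M\<^sup>2) * A0 * (real k + 1)"
    have sumker: "(\<Sum>q\<in>Z \<times> Y. norm (ker p q)) \<le> G" if p: "p \<in> Z \<times> Y" for p
      unfolding G_def
    proof (rule sum_le_layers[where d = "dd p"])
      show "finite (Z \<times> Y)" using Z finY by simp
      show "0 \<le> KC * M\<^sup>2" using KC by simp
      show "norm (ker p q) \<le> KC * M\<^sup>2" "norm (ker p q) * (dd p q)\<^sup>2 \<le> KC * M\<^sup>2" if "q \<in> Z \<times> Y" for q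
        using ker_bounds[OF p that] by auto
      show "dd p q \<le> 2 ^ k" if "q \<in> Z \<times> Y" for q
      proof -
        have "dnorm t \<le> 1" for t using dnorm_le_half[of t] by linarith
        then have "dd p q \<le> M * 1" unfolding dd_def using M
          by (intro mult_left_mono max.boundedI) auto
        then show ?thesis using k1 by simp
      qed
      show "real (card {q \<in> Z \<times> Y. dd p q \<le> 2 ^ j}) \<le> A0 * (2 ^ j)\<^sup>2" if "j \<le> k" for j
      proof -
        have "(2::real) ^ j \<le> 2 ^ k" using that by (intro power_increasing) auto
        then have "(2::real) ^ j \<le> 2 * M" using k2 by linarith
        then show ?thesis using cnt[of p "2 ^ j"] p unfolding dd_close Y_def by simp
      qed
    qed auto
    define B where "B = {-R..R} \<times> {-R..R}"
    define Wf where "Wf b = tz 2 (\<alpha> * of_int (fst b)) * tz 2 (\<alpha> * of_int (snd b))" for b :: "int \<times> int"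
    define xv where "xv u = (den u, denp u)" for u
    have xv: "\<bar>\<alpha> * of_int (fst (xv u))\<bar> \<le> 1" "\<bar>\<alpha> * of_int (snd (xv u))\<bar> \<le> 1" "xv u \<in> B" if "u \<in> stop M" for u
    proof -
      note u = stopD[OF that M(1)]
      have d: "0 \<le> real_of_int (den u)" "0 \<le> real_of_int (denp u)" "real_of_int (denp u) \<le> a0 * M"
        using den_nonneg[of u] denp_nonneg[of u] denp_le_den[OF word_pos[OF u(1)]] u(3) by auto
      show "\<bar>\<alpha> * of_int (fst (xv u))\<bar> \<le> 1" "\<bar>\<alpha> * of_int (snd (xv u))\<bar> \<le> 1"
      proof -
        have *: "\<bar>\<alpha> * t\<bar> \<le> 1" if "0 \<le> t" "t \<le> a0 * M" for t
        proof -
          have "t / (a0 * M) \<le> 1" using that a0M by (simp only: pos_divide_le_eq mult_1)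
          moreover have "0 \<le> t / (a0 * M)" using that a0M by (intro divide_nonneg_pos)
          moreover have "\<alpha> * t = t / (a0 * M)" by (simp add: \<alpha>_def)
          ultimately show ?thesis by simp
        qed
        show "\<bar>\<alpha> * of_int (fst (xv u))\<bar> \<le> 1" "\<bar>\<alpha> * of_int (snd (xv u))\<bar> \<le> 1"
          unfolding xv_def fst_conv snd_conv using d u by (auto intro!: *)
      qed
      have "real_of_int (den u) \<le> of_int R" "real_of_int (denp u) \<le> of_int R"
        using d u R(3) by auto
      then show "xv u \<in> B" using den_nonneg[of u] denp_nonneg[of u] by (simp add: B_def xv_def)
    qed
    have ls: "(\<Sum>\<theta>\<in>Z. (norm (\<Sum>u\<in>stop M. \<Sum>v\<in>Y. of_real (wt N (ip (xv u) (yv v))) * ee (\<theta> * ip (xv u) (yv v))))\<^sup>2)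
        \<le> 2 * real (card (stop M)) * real (card Y) * G"
    proof (rule large_sieve[where B = B and W = Wf])
      show "finite (stop M)" "finite Y" "finite Z" "finite B" using finite_stop[OF M(1)] finY Z by (auto simp: B_def)
      show "xv ` stop M \<subseteq> B" using xv by blast
      show "real (card {u \<in> stop M. xv u = b}) \<le> 2" for b
      proof -
        have "stop M \<subseteq> {w. set w \<subseteq> A}" by (auto simp: stop_def)
        then show ?thesis unfolding xv_def by (rule card_same_vector_le(2)[OF finite_stop[OF M(1)]])
      qed
      show "0 \<le> G" unfolding G_def using KC A0 by simp
      show "0 \<le> Wf b" for b unfolding Wf_def by (intro mult_nonneg_nonneg tz_bounds) auto
      show "Wf (xv u) = 1" if "u \<in> stop M" for u
        unfolding Wf_def using xv(1,2)[OF that] by (simp add: tz_eq_1)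
      fix p :: "real \<times> nat list" assume p: "p \<in> Z \<times> Y"
      have "(\<Sum>b\<in>B. of_real (Wf b * (wt N (ip b (yv (snd p))) * wt N (ip b (yv (snd q)))))
          * ee (fst p * ip b (yv (snd p)) - fst q * ip b (yv (snd q)))) = ker p q" for q :: "real \<times> nat list"
        unfolding ker_def kern_def B_def[symmetric]
      proof (intro sum.cong refl, clarify)
        fix x\<^sub>1 x\<^sub>2
        have ph: "fst p * of_int (ip (x\<^sub>1, x\<^sub>2) (yv (snd p))) - fst q * of_int (ip (x\<^sub>1, x\<^sub>2) (yv (snd q)))
          = of_int x\<^sub>1 * fst (fst p * of_int (den (snd p)) - fst q * of_int (den (snd q)),
             fst p * of_int (num (snd p)) - fst q * of_int (num (snd q)))
           + of_int x\<^sub>2 * snd (fst p * of_int (den (snd p)) - fst q * of_int (den (snd q)),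
             fst p * of_int (num (snd p)) - fst q * of_int (num (snd q)))"
          by (simp add: ip_def yv_def algebra_simps)
        show "of_real (Wf (x\<^sub>1, x\<^sub>2) * (wt N (ip (x\<^sub>1, x\<^sub>2) (yv (snd p))) * wt N (ip (x\<^sub>1, x\<^sub>2) (yv (snd q)))))
          * ee (fst p * ip (x\<^sub>1, x\<^sub>2) (yv (snd p)) - fst q * ip (x\<^sub>1, x\<^sub>2) (yv (snd q)))
          = of_real (tz 2 (\<alpha> * of_int x\<^sub>1) * tz 2 (\<alpha> * of_int x\<^sub>2) *
           (wt N (of_int (x\<^sub>1 * fst (yv (snd p)) + x\<^sub>2 * snd (yv (snd p)))) * wt N (of_int (x\<^sub>1 * fst (yv (snd q)) + x\<^sub>2 * snd (yv (snd q)))))) *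
           ee (of_int x\<^sub>1 * fst (fst p * of_int (den (snd p)) - fst q * of_int (den (snd q)),
             fst p * of_int (num (snd p)) - fst q * of_int (num (snd q)))
           + of_int x\<^sub>2 * snd (fst p * of_int (den (snd p)) - fst q * of_int (den (snd q)),
             fst p * of_int (num (snd p)) - fst q * of_int (num (snd q))))"
          unfolding ph Wf_def by (simp only: ip_def fst_conv snd_conv)
      qed
      then show "(\<Sum>q\<in>Z \<times> Y. norm (\<Sum>b\<in>B. of_real (Wf b * (wt N (ip b (yv (snd p))) * wt N (ip b (yv (snd q)))))
          * ee (fst p * ip b (yv (snd p)) - fst q * ip b (yv (snd q))))) \<le> G"
        using sumker[OF p] by simp
    qed
    have L1': "1 \<le> real N / M" using M by simp
    have "(\<Sum>\<theta>\<in>Z. (norm (S N \<theta>))\<^sup>2) \<le> 2 * real (card (stop M)) * real (card Y) * G"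
      using ls unfolding S_decompose[OF N M] Y_def xv_def yv_def .
    also have "\<dots> \<le> 2 * (CU * M powr (2 * \<delta>)) * (CY * (real N / M) powr (2 * \<delta>)) * G"
    proof -
      have G0: "0 \<le> G" unfolding G_def using KC A0 by simp
      have "real (card (stop M)) * real (card Y) \<le> (CU * M powr (2 * \<delta>)) * (CY * (real N / M) powr (2 * \<delta>))"
        using card_stop_le[OF M(1)] CY(2)[OF L1'] CU unfolding CU_def[symmetric] Y_def
        by (intro mult_mono) auto
      then have "2 * (real (card (stop M)) * real (card Y)) * G \<le> 2 * ((CU * M powr (2 * \<delta>)) * (CY * (real N / M) powr (2 * \<delta>))) * G"
        using G0 by (intro mult_right_mono mult_left_mono) auto
      then show ?thesis by (simp only: mult.assoc)
    qed
    also have "M powr (2 * \<delta>) * (real N / M) powr (2 * \<delta>) = real N powr (2 * \<delta>)"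
      using M N by (simp add: powr_divide)
    then have "2 * (CU * M powr (2 * \<delta>)) * (CY * (real N / M) powr (2 * \<delta>)) * G = 2 * CU * CY * real N powr (2 * \<delta>) * G"
      by (metis (no_types, opaque_lifting) mult.assoc mult.left_commute)
    also have "\<dots> = 8 * CU * CY * real N powr (2 * \<delta>) * (KC * M\<^sup>2) * A0 * (real k + 1)" by (simp add: G_def mult_ac)
    also have "\<dots> \<le> 8 * CU * CY * real N powr (2 * \<delta>) * (KC * M\<^sup>2) * A0 * (2 * (1 + ln M))"
      using CU CY(1) KC A0 by (intro mult_left_mono k3) auto
    also have "\<dots> = C * real N powr (2 * \<delta>) * M\<^sup>2 * (1 + ln M) * A0" by (simp add: C_def mult_ac)
    finally show ?thesis .
  qed
  have "C > 0" using CU CY KC by (simp add: C_def)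
  show ?thesis
  proof (rule exI[of _ C], intro conjI allI impI)
    show "C > 0" by fact
    fix N :: nat and M A0 :: real and Z :: "real set"
    assume as: "0 < N" "1 \<le> M" "M \<le> real N" "finite Z" "0 \<le> A0"
      and cnt: "\<forall>p\<in>Z \<times> Yset (real N / M). \<forall>D. 1 \<le> D \<longrightarrow> D \<le> 2 * M \<longrightarrow>
        real (card {q \<in> Z \<times> Yset (real N / M). close (D / M) p q}) \<le> A0 * D\<^sup>2"
    show "(\<Sum>\<theta>\<in>Z. (norm (S N \<theta>))\<^sup>2) \<le> C * real N powr (2 * \<delta>) * M\<^sup>2 * (1 + ln M) * A0"
      by (rule main[OF as cnt[rule_format]])
  qed
qed

end

section \<open>Grid points, lattice vectors and cylinders\<close>

lemma card_int_between_le: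
  fixes a b :: real
  assumes "a \<le> b + 1"
  shows "finite {n::int. a \<le> n \<and> n \<le> b}" "real (card {n::int. a \<le> n \<and> n \<le> b}) \<le> b - a + 1"
proof -
  have eq: "{n::int. a \<le> n \<and> n \<le> b} = {\<lceil>a\<rceil>..\<lfloor>b\<rfloor>}" by (auto simp: ceiling_le_iff le_floor_iff)
  show "finite {n::int. a \<le> n \<and> n \<le> b}" unfolding eq by simp
  have "real (card {\<lceil>a\<rceil>..\<lfloor>b\<rfloor>}) \<le> b - a + 1"
  proof (cases "\<lceil>a\<rceil> \<le> \<lfloor>b\<rfloor> + 1")
    case True
    have "real (card {\<lceil>a\<rceil>..\<lfloor>b\<rfloor>}) = of_int (\<lfloor>b\<rfloor> - \<lceil>a\<rceil> + 1)" using True by simp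
    also have "\<dots> \<le> b - a + 1" by (simp, linarith)
    finally show ?thesis .
  qed (use assms in auto)
  then show "real (card {n::int. a \<le> n \<and> n \<le> b}) \<le> b - a + 1" unfolding eq .
qed

section \<open>Counting grid points\<close>

definition grid :: "nat \<Rightarrow> real set" where
  "grid P = (\<lambda>j. real j / real P) ` {..<P}"

lemma finite_grid: "finite (grid P)"
  by (simp add: grid_def)

lemma card_grid_le: "card (grid P) \<le> P"
  unfolding grid_def using card_image_le[of "{..<P}"] by fastforce

lemma gridD: "\<theta> \<in> grid P \<Longrightarrow> 0 \<le> \<theta> \<and> \<theta> < 1"
  by (auto simp: grid_def)

lemma card_grid_interval_le:
  assumes "0 < P" "0 \<le> r" "J \<subseteq> grid P" "\<And>\<theta>. \<theta> \<in> J \<Longrightarrow> \<bar>\<theta> - c\<bar> \<le> r"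
  shows "real (card J) \<le> 2 * r * real P + 1"
proof -
  let ?I = "{n::int. (c - r) * real P \<le> n \<and> n \<le> (c + r) * real P}"
  have ge: "(c - r) * real P \<le> (c + r) * real P + 1"
    using assms by (simp add: algebra_simps add_nonneg_nonneg)
  have sub: "J \<subseteq> (\<lambda>n. of_int n / real P) ` ?I"
  proof
    fix \<theta> assume "\<theta> \<in> J"
    then obtain j where j: "\<theta> = real j / real P" using assms by (auto simp: grid_def)
    have "\<bar>real j / real P - c\<bar> \<le> r" using assms(4)[OF \<open>\<theta> \<in> J\<close>] j by simp
    then have "c - r \<le> real j / real P" "real j / real P \<le> c + r" by linarith+
    then have "int j \<in> ?I" using assms(1) by (simp add: pos_le_divide_eq pos_divide_le_eq)
    then show "\<theta> \<in> (\<lambda>n. of_int n / real P) ` ?I" using j by (intro image_eqI[of _ _ "int j"]) auto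
  qed
  have "card J \<le> card ((\<lambda>n. of_int n / real P) ` ?I)"
    by (intro card_mono sub finite_imageI card_int_between_le ge)
  also have "\<dots> \<le> card ?I" by (intro card_image_le card_int_between_le ge)
  finally have "real (card J) \<le> real (card ?I)" by simp
  also have "\<dots> \<le> (c + r) * real P - (c - r) * real P + 1" by (rule card_int_between_le(2)[OF ge])
  finally show ?thesis by (simp add: algebra_simps)
qed

text \<open>Closeness is modulo 1. Differences of points of [0, 1) round to -1, 0 or 1, and each
  case confines the point to an interval around a translate of one fixed element.\<close>

lemma card_grid_close_le:
  assumes "0 < P" "0 \<le> r" "J \<subseteq> grid P" "\<And>\<theta> \<theta>'. \<theta> \<in> J \<Longrightarrow> \<theta>' \<in> J \<Longrightarrow> dnorm (\<theta> - \<theta>') \<le> r"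
  shows "real (card J) \<le> 3 * (2 * r * real P + 1)"
proof (cases "J = {}")
  case False
  then obtain \<theta>0 where t0: "\<theta>0 \<in> J" by blast
  have fin: "finite J" using assms(3) finite_grid finite_subset by blast
  have "real (card J) \<le> (2 * r * real P + 1) * real (card {-1..1::int})"
  proof (rule card_le_fibres'[where f = "\<lambda>\<theta>. round (\<theta> - \<theta>0)"])
    show "(\<lambda>\<theta>. round (\<theta> - \<theta>0)) ` J \<subseteq> {- 1..1}"
    proof clarify
      fix \<theta> assume "\<theta> \<in> J"
      then have "0 \<le> \<theta>" "\<theta> < 1" "0 \<le> \<theta>0" "\<theta>0 < 1" using gridD assms(3) t0 by blast+
      moreover have "\<bar>(\<theta> - \<theta>0) - of_int (round (\<theta> - \<theta>0))\<bar> \<le> 1 / 2"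
        using dnorm_le_half[of "\<theta> - \<theta>0"] by (simp add: dnorm_def)
      ultimately have "\<bar>real_of_int (round (\<theta> - \<theta>0))\<bar> < 2" by linarith
      then show "round (\<theta> - \<theta>0) \<in> {- 1..1}" by (simp, linarith)
    qed
    fix b :: int
    show "real (card {s \<in> J. round (s - \<theta>0) = b}) \<le> 2 * r * real P + 1"
    proof (rule card_grid_interval_le[where c = "\<theta>0 + b"])
      fix \<theta> assume "\<theta> \<in> {s \<in> J. round (s - \<theta>0) = b}"
      then have "dnorm (\<theta> - \<theta>0) \<le> r" "round (\<theta> - \<theta>0) = b" using assms(4) t0 by auto
      then show "\<bar>\<theta> - (\<theta>0 + of_int b)\<bar> \<le> r" by (simp add: dnorm_def algebra_simps)
    qed (use assms in auto)
  qed (use fin assms in auto)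
  then show ?thesis by simp
qed (use assms in auto)

text \<open>While \<theta> runs through [0, 1), the product \<theta>y meets \<open>O(y)\<close>
  integer translates of \<alpha>, and near each of them \<theta> is confined to radius
  \<open>\<epsilon> / y\<close>.\<close>

lemma card_grid_linear_le:
  fixes y :: int
  assumes "0 < P" "1 \<le> y" "0 \<le> \<epsilon>"
  shows "real (card {\<theta> \<in> grid P. dnorm (\<theta> * of_int y - \<alpha>) \<le> \<epsilon>}) \<le> 6 * \<epsilon> * real P + 3 * of_int y"
proof (cases "\<epsilon> \<le> 1 / 2")
  case False
  have "card {\<theta> \<in> grid P. dnorm (\<theta> * of_int y - \<alpha>) \<le> \<epsilon>} \<le> card (grid P)"
    by (intro card_mono finite_grid) auto
  then have "real (card {\<theta> \<in> grid P. dnorm (\<theta> * of_int y - \<alpha>) \<le> \<epsilon>}) \<le> 1 * real P"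
    using card_grid_le[of P] by linarith
  also have "\<dots> \<le> 6 * \<epsilon> * real P" using False by (intro mult_right_mono) auto
  finally show ?thesis using assms by linarith
next
  case True
  let ?J = "{\<theta> \<in> grid P. dnorm (\<theta> * of_int y - \<alpha>) \<le> \<epsilon>}"
  let ?I = "{n::int. - \<alpha> - 1 / 2 \<le> n \<and> n \<le> of_int y - \<alpha> + 1 / 2}"
  have y: "1 \<le> real_of_int y" using assms by simp
  have ge: "- \<alpha> - 1 / 2 \<le> of_int y - \<alpha> + 1 / 2 + 1" using y by linarith
  have fib: "real (card ?J) \<le> (2 * (\<epsilon> / of_int y) * real P + 1) * real (card ?I)"
  proof (rule card_le_fibres'[where f = "\<lambda>\<theta>. round (\<theta> * of_int y - \<alpha>)"])
    show "(\<lambda>\<theta>. round (\<theta> * of_int y - \<alpha>)) ` ?J \<subseteq> ?I"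
    proof clarify
      fix \<theta> assume t: "\<theta> \<in> grid P"
      have "0 \<le> \<theta>" "\<theta> \<le> 1" using gridD[OF t] by auto
      then have "0 \<le> \<theta> * of_int y" "\<theta> * of_int y \<le> 1 * of_int y" using y by (auto intro!: mult_right_mono)
      moreover have "\<bar>(\<theta> * of_int y - \<alpha>) - of_int (round (\<theta> * of_int y - \<alpha>))\<bar> \<le> 1 / 2"
        using dnorm_le_half[of "\<theta> * of_int y - \<alpha>"] by (simp add: dnorm_def)
      ultimately show "- \<alpha> - 1 / 2 \<le> round (\<theta> * of_int y - \<alpha>) \<and> round (\<theta> * of_int y - \<alpha>) \<le> of_int y - \<alpha> + 1 / 2"
        by linarith
    qed
    show "finite ?I" by (rule card_int_between_le(1)[OF ge])
    fix b :: int
    show "real (card {s \<in> ?J. round (s * of_int y - \<alpha>) = b}) \<le> 2 * (\<epsilon> / of_int y) * real P + 1"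
    proof (rule card_grid_interval_le[where c = "(\<alpha> + b) / of_int y"])
      fix \<theta> assume "\<theta> \<in> {s \<in> ?J. round (s * of_int y - \<alpha>) = b}"
      then have "\<bar>\<theta> * of_int y - \<alpha> - of_int b\<bar> \<le> \<epsilon>" by (auto simp: dnorm_def)
      moreover have "\<theta> - (\<alpha> + of_int b) / of_int y = (\<theta> * of_int y - \<alpha> - of_int b) / of_int y"
        using y by (simp add: field_simps)
      ultimately show "\<bar>\<theta> - (\<alpha> + of_int b) / of_int y\<bar> \<le> \<epsilon> / of_int y"
        using y by (simp add: divide_right_mono)
    qed (use assms y in auto)
  qed (use finite_grid assms y in auto)
  have "real (card ?I) \<le> of_int y - \<alpha> + 1 / 2 - (- \<alpha> - 1 / 2) + 1" by (rule card_int_between_le(2)[OF ge])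
  then have "real (card ?I) \<le> 3 * of_int y" using y by linarith
  then have "(2 * (\<epsilon> / of_int y) * real P + 1) * real (card ?I) \<le> (2 * (\<epsilon> / of_int y) * real P + 1) * (3 * of_int y)"
    using assms y by (intro mult_left_mono) auto
  also have "\<dots> = 6 * \<epsilon> * real P + 3 * of_int y" using y by (simp add: field_simps)
  finally show ?thesis using fib by linarith
qed

text \<open>A determinant divisible by \<open>q\<close> against a primitive vector means being a
  multiple of that vector modulo \<open>q\<close>; two such multiples are proportional modulo
  \<open>q\<close>.\<close>

lemma dvd_wedge:
  fixes q :: int
  assumes "coprime y1 y2" "q dvd y1 * z2 - y2 * z1" "q dvd y1 * w2 - y2 * w1"
  shows "q dvd z1 * w2 - z2 * w1"
proof -
  obtain r s where rs: "r * y1 + s * y2 = 1" using assms(1) bezout_int[of y1 y2] by auto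
  have "z1 * w2 - z2 * w1 = (r * y1 + s * y2) * (z1 * w2 - z2 * w1)" using rs by simp
  also have "\<dots> = (r * z1 + s * z2) * (y1 * w2 - y2 * w1) - (r * w1 + s * w2) * (y1 * z2 - y2 * z1)"
    by (simp add: algebra_simps)
  finally show ?thesis using assms by simp
qed

text \<open>The difference of the two vectors has determinant 0 with a primitive vector and is
  therefore an integer multiple of it.\<close>

lemma wedge_eq_imp:
  fixes y1 y2 :: int
  assumes "coprime y1 y2" "y1 * z2 - y2 * z1 = y1 * w2 - y2 * w1"
  obtains t where "z1 - w1 = t * y1" "z2 - w2 = t * y2"
proof -
  obtain r s where rs: "r * y1 + s * y2 = 1" using assms(1) bezout_int[of y1 y2] by auto
  have e: "y1 * (z2 - w2) = y2 * (z1 - w1)" using assms(2) by (simp add: algebra_simps)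
  define t where "t = r * (z1 - w1) + s * (z2 - w2)"
  have "t * y1 = (r * y1) * (z1 - w1) + s * (y1 * (z2 - w2))" by (simp add: t_def algebra_simps)
  also have "\<dots> = (r * y1 + s * y2) * (z1 - w1)" unfolding e by (simp add: algebra_simps)
  finally have 1: "z1 - w1 = t * y1" using rs by simp
  have "t * y2 = r * (y2 * (z1 - w1)) + (s * y2) * (z2 - w2)" by (simp add: t_def algebra_simps)
  also have "\<dots> = (r * y1 + s * y2) * (z2 - w2)" unfolding e[symmetric] by (simp add: algebra_simps)
  finally have 2: "z2 - w2 = t * y2" using rs by simp
  show thesis using that[OF 1 2] .
qed

lemma card_separated_le:
  fixes V :: "real set"
  assumes "finite V" "0 < s" "0 \<le> h" "\<And>x. x \<in> V \<Longrightarrow> \<bar>x - c\<bar> \<le> h"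
    and sep: "\<And>x y. x \<in> V \<Longrightarrow> y \<in> V \<Longrightarrow> x \<noteq> y \<Longrightarrow> s \<le> \<bar>x - y\<bar>"
  shows "real (card V) \<le> 2 * h / s + 2"
proof -
  let ?I = "{n::int. (c - h) / s - 1 \<le> n \<and> n \<le> (c + h) / s}"
  have "(c - h) / s \<le> (c + h) / s" using assms by (intro divide_right_mono) auto
  then have ge: "(c - h) / s - 1 \<le> (c + h) / s + 1" by linarith
  have inj: "inj_on (\<lambda>x. \<lfloor>x / s\<rfloor>) V"
  proof (rule inj_onI, rule ccontr)
    fix x y assume xy: "x \<in> V" "y \<in> V" "\<lfloor>x / s\<rfloor> = \<lfloor>y / s\<rfloor>" "x \<noteq> y"
    then have "\<bar>x / s - y / s\<bar> < 1" by linarith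
    then have "\<bar>x - y\<bar> < s" using assms(2) by (simp add: diff_divide_distrib[symmetric])
    then show False using sep[OF xy(1,2,4)] by simp
  qed
  have sub: "(\<lambda>x. \<lfloor>x / s\<rfloor>) ` V \<subseteq> ?I"
  proof clarify
    fix x assume "x \<in> V"
    then have "c - h \<le> x" "x \<le> c + h" using assms(4)[of x] by linarith+
    then have "(c - h) / s \<le> x / s" "x / s \<le> (c + h) / s" using assms(2) by (auto intro: divide_right_mono)
    then show "(c - h) / s - 1 \<le> \<lfloor>x / s\<rfloor> \<and> \<lfloor>x / s\<rfloor> \<le> (c + h) / s" by linarith
  qed
  have "card V \<le> card ?I" by (rule card_inj_on_le[OF inj sub card_int_between_le(1)[OF ge]])
  then have "real (card V) \<le> real (card ?I)" by simp
  also have "\<dots> \<le> (c + h) / s - ((c - h) / s - 1) + 1" by (rule card_int_between_le(2)[OF ge])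
  also have "\<dots> = 2 * h / s + 2" using assms(2) by (simp add: field_simps)
  finally show ?thesis .
qed

text \<open>Determinant of the vectors (den, num) of two words. By \<open>cfrac_diff_eq\<close> it
  measures the distance of their values, and by \<open>wg_append\<close> a common prefix changes
  only its sign.\<close>

definition wg :: "nat list \<Rightarrow> nat list \<Rightarrow> int" where
  "wg v w = den v * num w - num v * den w"

lemma wg_append: "wg (u @ s) (u @ t) = (- 1) ^ length u * wg s t"
  unfolding continuant_det[symmetric] wg_def by (simp add: den_append num_append algebra_simps)

lemma cfrac_diff_eq:
  assumes "0 \<notin> set v" "0 \<notin> set w"
  shows "\<bar>cfrac w - cfrac v\<bar> = \<bar>real_of_int (wg v w)\<bar> / (real_of_int (den v) * real_of_int (den w))"
proof -
  have p: "0 < real_of_int (den v)" "0 < real_of_int (den w)" using den_pos assms by force+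
  then have "cfrac w - cfrac v = real_of_int (wg v w) / (real_of_int (den v) * real_of_int (den w))"
    using assms by (simp add: cfrac_eq wg_def field_simps)
  then show ?thesis using p by (simp add: abs_mult)
qed

lemma abs_wg_le:
  assumes "0 \<notin> set v" "0 \<notin> set w" shows "\<bar>wg v w\<bar> \<le> den v * den w"
proof -
  have "den v * num w \<le> den v * den w" "num v * den w \<le> den v * den w"
    using assms num_le_den den_nonneg by (auto intro: mult_left_mono mult_right_mono)
  moreover have "0 \<le> den v * num w" "0 \<le> num v * den w" using den_nonneg num_nonneg by auto
  ultimately show ?thesis unfolding wg_def by linarith
qed

context critical_alphabet
begin

text \<open>Fix the word \<open>v0\<close> of largest denominator. The determinants with
  \<open>v0\<close> are multiples of \<open>q\<close> of size at most \<open>B\<^sup>2\<close>.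
  Words with equal determinant have vectors differing by a multiple of that of \<open>v0\<close>,
  and the multiple is 0 since both denominators lie between 1 and \<open>den v0\<close>.\<close>

lemma card_wg_divisible_le:
  fixes q :: int and B :: real
  assumes "finite V" "V \<subseteq> {w. set w \<subseteq> A}" "1 \<le> q" "\<And>v. v \<in> V \<Longrightarrow> real_of_int (den v) \<le> B"
    and dvd: "\<And>v w. v \<in> V \<Longrightarrow> w \<in> V \<Longrightarrow> q dvd wg v w"
  shows "real (card V) \<le> 2 * (2 * B\<^sup>2 / q + 1)"
proof (cases "V = {}")
  case False
  have "Max (den ` V) \<in> den ` V" using assms(1) False by (intro Max_in) auto
  then obtain v0 where v0: "v0 \<in> V" "den v0 = Max (den ` V)" by auto
  have mx: "den v \<le> den v0" if "v \<in> V" for v using that assms(1) v0 by simp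
  have pos: "0 \<notin> set v" if "v \<in> V" for v using that assms(2) word_pos by blast
  have d1: "1 \<le> den v" if "v \<in> V" for v using den_pos[OF pos[OF that]] .
  let ?Q = "real_of_int q"
  have Q: "1 \<le> ?Q" using assms by simp
  have Bpos: "0 \<le> B\<^sup>2 / ?Q" using Q by simp
  let ?I = "{n::int. - (B\<^sup>2 / ?Q) \<le> n \<and> n \<le> B\<^sup>2 / ?Q}"
  have ge: "- (B\<^sup>2 / ?Q) \<le> B\<^sup>2 / ?Q + 1" using Bpos by linarith
  have "real (card V) \<le> 2 * real (card ?I)"
  proof (rule card_le_fibres'[where f = "\<lambda>v. wg v0 v div q"])
    show "(\<lambda>v. wg v0 v div q) ` V \<subseteq> ?I"
    proof clarify
      fix v assume v: "v \<in> V"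
      define k where "k = wg v0 v div q"
      have e: "wg v0 v = q * k" unfolding k_def using dvd_mult_div_cancel[OF dvd[OF v0(1) v]] by simp
      have "\<bar>wg v0 v\<bar> \<le> den v0 * den v" using abs_wg_le pos v v0 by blast
      then have "real_of_int \<bar>wg v0 v\<bar> \<le> real_of_int (den v0 * den v)" by (simp only: of_int_le_iff)
      then have "\<bar>real_of_int (wg v0 v)\<bar> \<le> real_of_int (den v0) * real_of_int (den v)" by simp
      also have "\<dots> \<le> B * B" using assms(4)[OF v] assms(4)[OF v0(1)] d1[OF v] d1[OF v0(1)]
        by (intro mult_mono) auto
      finally have "\<bar>real_of_int (wg v0 v)\<bar> \<le> B\<^sup>2" by (simp add: power2_eq_square)
      then have "\<bar>?Q * real_of_int k\<bar> \<le> B\<^sup>2" unfolding e by simp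
      then have "?Q * \<bar>real_of_int k\<bar> \<le> B\<^sup>2" using Q by (simp add: abs_mult)
      then have "\<bar>real_of_int k\<bar> \<le> B\<^sup>2 / ?Q" using Q by (subst pos_le_divide_eq) (auto simp: mult.commute)
      then show "- (B\<^sup>2 / ?Q) \<le> wg v0 v div q \<and> wg v0 v div q \<le> B\<^sup>2 / ?Q" unfolding k_def[symmetric] by linarith
    qed
    show "finite ?I" by (rule card_int_between_le(1)[OF ge])
    fix b :: int
    let ?F = "{s \<in> V. wg v0 s div q = b}"
    have same: "(den s, num s) = (den s', num s')" if s: "s \<in> ?F" "s' \<in> ?F" for s s'
    proof -
      have "wg v0 s = q * b" "wg v0 s' = q * b"
        using s dvd_mult_div_cancel[OF dvd[OF v0(1), of s]] dvd_mult_div_cancel[OF dvd[OF v0(1), of s']] by auto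
      then have "den v0 * num s - num v0 * den s = den v0 * num s' - num v0 * den s'" by (simp add: wg_def)
      then obtain t where t: "den s - den s' = t * den v0" "num s - num s' = t * num v0"
        by (rule wedge_eq_imp[OF coprime_den_num[of v0]])
      have "den s \<le> den v0" "den s' \<le> den v0" "1 \<le> den s" "1 \<le> den s'" using mx d1 s by blast+
      then have "\<bar>den s - den s'\<bar> < den v0" by linarith
      then have "\<bar>t\<bar> * den v0 < 1 * den v0" using t d1[OF v0(1)] by (simp add: abs_mult)
      then have "\<bar>t\<bar> < 1" using d1[OF v0(1)] by (simp only: mult_less_cancel_right_pos)
      then show ?thesis using t by simp
    qed
    show "real (card ?F) \<le> 2"
    proof (cases "?F = {}")
      case False
      then obtain s0 where s0: "s0 \<in> ?F" by blast
      have "?F \<subseteq> {w \<in> V. (den w, num w) = (den s0, num s0)}" using same[OF _ s0] by blast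
      then have "card ?F \<le> card {w \<in> V. (den w, num w) = (den s0, num s0)}"
        using assms(1) by (intro card_mono) auto
      then show ?thesis using card_same_vector_le(1)[OF assms(1,2), of "(den s0, num s0)"] by linarith
    next
      case True
      show ?thesis unfolding True by simp
    qed
  qed (use assms in auto)
  also have "real (card ?I) \<le> B\<^sup>2 / ?Q - (- (B\<^sup>2 / ?Q)) + 1" by (rule card_int_between_le(2)[OF ge])
  finally show ?thesis by (simp add: algebra_simps)
qed (use assms in auto)

text \<open>A fixed determinant puts the vectors on an arithmetic progression with difference the
  vector of \<open>v\<close>. All denominators are of order \<open>L\<close>, so only boundedly many
  terms of the progression qualify, each for at most two words.\<close>

lemma card_Yset_same_wg_le:
  assumes "v \<in> Yset L" "V \<subseteq> Yset L" "\<And>w. w \<in> V \<Longrightarrow> wg v w = m" "0 < L"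
  shows "real (card V) \<le> 2 * (4 * a0 * (2 * a0 + 1) + 1)"
proof (cases "V = {}")
  case False
  then obtain w0 where w0: "w0 \<in> V" by blast
  have fin: "finite V" using assms(2) finite_Yset finite_subset by blast
  have VA: "V \<subseteq> {w. set w \<subseteq> A}" using assms(2) by (auto simp: Yset_def)
  define T where "T = 2 * a0 * (2 * a0 + 1)"
  have T0: "0 \<le> T" using a0_ge by (simp add: T_def)
  let ?I = "{n::int. - T \<le> n \<and> n \<le> T}"
  have ge: "- T \<le> T + 1" using T0 by simp
  have ex: "\<exists>t. den w - den w0 = t * den v \<and> num w - num w0 = t * num v" if "w \<in> V" for w
  proof -
    have "den v * num w - num v * den w = den v * num w0 - num v * den w0"
      using assms(3)[OF that] assms(3)[OF w0] by (simp add: wg_def)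
    then obtain t where "den w - den w0 = t * den v" "num w - num w0 = t * num v"
      by (rule wedge_eq_imp[OF coprime_den_num[of v]])
    then show ?thesis by blast
  qed
  define f where "f w = (SOME t. den w - den w0 = t * den v \<and> num w - num w0 = t * num v)" for w
  have f: "den w - den w0 = f w * den v \<and> num w - num w0 = f w * num v" if "w \<in> V" for w
    unfolding f_def using ex[OF that] by (rule someI_ex)
  have "real (card V) \<le> 2 * real (card ?I)"
  proof (rule card_le_fibres'[where f = f])
    show "f ` V \<subseteq> ?I"
    proof clarify
      fix w assume w: "w \<in> V"
      have b: "1 \<le> real_of_int (den w)" "real_of_int (den w) \<le> (2 * a0 + 1) * L"
        "1 \<le> real_of_int (den w0)" "real_of_int (den w0) \<le> (2 * a0 + 1) * L"
        using YsetD(4,7)[OF subsetD[OF assms(2) w]] YsetD(4,7)[OF subsetD[OF assms(2) w0]] by blast+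
      have "real_of_int (den w - den w0) = real_of_int (f w * den v)"
        using conjunct1[OF f[OF w]] by (rule arg_cong)
      then have "real_of_int (den w) - real_of_int (den w0) = real_of_int (f w) * real_of_int (den v)" by simp
      then have "\<bar>real_of_int (f w) * real_of_int (den v)\<bar> \<le> (2 * a0 + 1) * L" using b by linarith
      then have "\<bar>real_of_int (f w)\<bar> * real_of_int (den v) \<le> (2 * a0 + 1) * L"
        using YsetD(7)[OF assms(1)] by (simp add: abs_mult)
      moreover have "\<bar>real_of_int (f w)\<bar> * (L / (2 * a0)) \<le> \<bar>real_of_int (f w)\<bar> * real_of_int (den v)"
        using YsetD(3)[OF assms(1)] by (intro mult_left_mono) auto
      ultimately have "\<bar>real_of_int (f w)\<bar> * (L / (2 * a0)) \<le> (2 * a0 + 1) * L" by linarith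
      then have "\<bar>real_of_int (f w)\<bar> * (L / (2 * a0)) * (2 * a0) \<le> (2 * a0 + 1) * L * (2 * a0)"
        using a0_ge by (intro mult_right_mono) auto
      then have "\<bar>real_of_int (f w)\<bar> * L \<le> (2 * a0 + 1) * L * (2 * a0)" using a0_ge by simp
      then have "\<bar>real_of_int (f w)\<bar> * L \<le> T * L" by (simp add: T_def mult_ac)
      then have "\<bar>real_of_int (f w)\<bar> \<le> T" using assms(4) by (simp only: mult_le_cancel_right_pos)
      then show "- T \<le> f w \<and> f w \<le> T" by linarith
    qed
    show "finite ?I" by (rule card_int_between_le(1)[OF ge])
    fix b :: int
    have "{s \<in> V. f s = b} \<subseteq> {w \<in> V. (den w, num w) = (den w0 + b * den v, num w0 + b * num v)}"
    proof
      fix w assume w: "w \<in> {s \<in> V. f s = b}"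
      then have "den w - den w0 = b * den v \<and> num w - num w0 = b * num v" using f[of w] by blast
      then have "(den w, num w) = (den w0 + b * den v, num w0 + b * num v)" by auto
      then show "w \<in> {w \<in> V. (den w, num w) = (den w0 + b * den v, num w0 + b * num v)}" using w by blast
    qed
    then have "card {s \<in> V. f s = b} \<le> card {w \<in> V. (den w, num w) = (den w0 + b * den v, num w0 + b * num v)}"
      using fin by (intro card_mono finite_Collect_conjI disjI1) simp_all
    then show "real (card {s \<in> V. f s = b}) \<le> 2"
      using card_same_vector_le(1)[OF fin VA, of "(den w0 + b * den v, num w0 + b * num v)"] by linarith
  qed (use fin in auto)
  also have "real (card ?I) \<le> T - - T + 1" by (rule card_int_between_le(2)[OF ge])
  also have "2 * (T - - T + 1) = 2 * (4 * a0 * (2 * a0 + 1) + 1)" by (simp add: T_def)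
  finally show ?thesis by simp
next
  case True
  have "0 \<le> a0 * (2 * a0 + 1)" using a0_ge by simp
  then show ?thesis unfolding True by simp
qed

text \<open>Upper regularity of the distribution of values: an interval of length of order
  \<open>r\<close> receives a proportion \<open>O(r powr \<delta>)\<close> of the stopped words. Cut
  at \<open>b = 1 / sqrt r\<close>, where cylinders have length about \<open>r\<close>. Distinct
  values of prefixes are at least \<open>r / a0\<^sup>2\<close> apart, so boundedly many prefixes
  are near \<open>c\<close>, and the tails number
  \<open>O((B / b) powr (2 * \<delta>))\<close>.\<close>

lemma card_stop_near_le:
  "\<exists>C>0. \<forall>B c r. 0 < r \<longrightarrow> r \<le> 1 \<longrightarrow> 1 \<le> r * B\<^sup>2 \<longrightarrow> 1 \<le> B \<longrightarrow>
     real (card {u \<in> stop B. \<bar>cfrac u - c\<bar> \<le> 2 * r}) \<le> C * B powr (2 * \<delta>) * r powr \<delta>"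
proof -
  have "1 \<le> 2 * a0" using a0_ge by simp
  from card_den_range_le[OF this] obtain C1 where C1: "C1 > 0"
    "\<And>B. 1 \<le> B \<Longrightarrow> real (card {w. set w \<subseteq> A \<and> B / (2 * a0) \<le> den w \<and> den w \<le> 2 * a0 * B}) \<le> C1 * B powr (2 * \<delta>)"
    by blast
  define C2 where "C2 = 2 * (6 * a0\<^sup>2 + 2)"
  have C2: "C2 > 0" using a0_ge by (simp add: C2_def add_nonneg_pos)
  have "real (card {u \<in> stop B. \<bar>cfrac u - c\<bar> \<le> 2 * r}) \<le> (C2 * C1) * B powr (2 * \<delta>) * r powr \<delta>"
    if r: "0 < r" "r \<le> 1" and rB: "1 \<le> r * B\<^sup>2" and B1: "1 \<le> B" for B c r
  proof -
    define b where "b = 1 / sqrt r"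
    have sr: "0 < sqrt r" "sqrt r \<le> 1" using r by auto
    have b1: "1 \<le> b" using sr by (simp add: b_def)
    have bb: "1 / b\<^sup>2 = r" using r by (simp add: b_def power_divide)
    have bB: "b \<le> B"
    proof -
      have "(1 / B)\<^sup>2 \<le> r" using rB B1 by (simp add: power_divide pos_divide_le_eq)
      then have "1 / B \<le> sqrt r" using real_le_rsqrt by blast
      then show ?thesis using sr B1 by (simp add: b_def field_simps)
    qed
    \<comment> \<open>Passing from \<open>u\<close> to its prefix moves the value by at most
      \<open>r\<close>, hence the 3 in place of 2.\<close>
    define T where "T = {t \<in> stop b. \<bar>cfrac t - c\<bar> \<le> 3 * r}"
    have finT: "finite T" unfolding T_def using finite_stop[OF b1] by simp
    have TA: "T \<subseteq> {w. set w \<subseteq> A}" unfolding T_def by (auto simp: stop_def)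
    define E where "E = {w. set w \<subseteq> A \<and> (B / b) / (2 * a0) \<le> den w \<and> den w \<le> 2 * a0 * (B / b)}"
    have finE: "finite E" unfolding E_def by (rule finite_den_range)
    have cardT: "real (card T) \<le> C2"
    proof -
      let ?v = "\<lambda>t. (den t, num t)"
      have 1: "real (card T) \<le> 2 * real (card (?v ` T))"
        using card_same_vector_le(1)[OF finT TA] by (intro card_le_fibres finT) auto
      have "inj_on (\<lambda>p. real_of_int (snd p) / real_of_int (fst p)) (?v ` T)"
      proof (rule inj_onI)
        fix p p' assume p: "p \<in> ?v ` T" "p' \<in> ?v ` T"
          and e: "real_of_int (snd p) / real_of_int (fst p) = real_of_int (snd p') / real_of_int (fst p')"
        obtain t t' where t: "p = ?v t" "t \<in> T" "p' = ?v t'" "t' \<in> T" using p by auto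
        have d: "1 \<le> den t" "1 \<le> den t'" using t TA den_pos word_pos by auto
        have "real_of_int (num t) * real_of_int (den t') = real_of_int (num t') * real_of_int (den t)"
          using e t d by (simp add: field_simps)
        then have "num t * den t' = num t' * den t" by (metis of_int_eq_iff of_int_mult)
        then have "\<bar>den t\<bar> * \<bar>num t'\<bar> = \<bar>den t'\<bar> * \<bar>num t\<bar>"
          using d num_nonneg[of t] num_nonneg[of t'] by (simp add: mult.commute)
        then have "\<bar>den t\<bar> = \<bar>den t'\<bar> \<and> \<bar>num t'\<bar> = \<bar>num t\<bar>"
          using coprime_crossproduct_int[of "den t" "num t" "den t'" "num t'"] coprime_den_num[of t] coprime_den_num[of t']
          by (simp add: coprime_commute)
        then show "p = p'" using t d num_nonneg[of t] num_nonneg[of t'] by simp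
      qed
      then have 2: "card (?v ` T) = card ((\<lambda>p. real_of_int (snd p) / real_of_int (fst p)) ` ?v ` T)"
        by (simp only: card_image)
      have "(\<lambda>p. real_of_int (snd p) / real_of_int (fst p)) ` ?v ` T = cfrac ` T"
        unfolding image_image using TA by (intro image_cong refl) (auto simp: cfrac_eq word_pos)
      then have 3: "card (?v ` T) = card (cfrac ` T)" using 2 by simp
      have "real (card (cfrac ` T)) \<le> 2 * (3 * r) / (r / a0\<^sup>2) + 2"
      proof (rule card_separated_le[where c = c])
        show "0 < r / a0\<^sup>2" using r a0_ge by simp
        show "\<bar>x - c\<bar> \<le> 3 * r" if "x \<in> cfrac ` T" for x using that by (auto simp: T_def)
        fix x y assume xy: "x \<in> cfrac ` T" "y \<in> cfrac ` T" "x \<noteq> y"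
        then obtain t t' where t: "x = cfrac t" "t \<in> T" "y = cfrac t'" "t' \<in> T" by auto
        have st: "t \<in> stop b" "t' \<in> stop b" using t by (auto simp: T_def)
        note s = stopD[OF st(1) b1] stopD[OF st(2) b1]
        have eq: "\<bar>x - y\<bar> = \<bar>real_of_int (wg t' t)\<bar> / (real_of_int (den t') * real_of_int (den t))"
          unfolding t using s by (intro cfrac_diff_eq word_pos)
        then have "wg t' t \<noteq> 0" using xy(3) by auto
        then have one: "1 \<le> \<bar>real_of_int (wg t' t)\<bar>" by linarith
        have pos: "0 < real_of_int (den t') * real_of_int (den t)" using s b1 by (intro mult_pos_pos) auto
        have "real_of_int (den t') * real_of_int (den t) \<le> (a0 * b) * (a0 * b)"
          using s b1 a0_ge by (intro mult_mono) auto
        then have "1 / ((a0 * b) * (a0 * b)) \<le> 1 / (real_of_int (den t') * real_of_int (den t))"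
          using pos by (intro divide_left_mono) auto
        also have "\<dots> \<le> \<bar>x - y\<bar>" unfolding eq using one pos by (intro divide_right_mono) auto
        also have "1 / ((a0 * b) * (a0 * b)) = (1 / b\<^sup>2) / a0\<^sup>2" by (simp add: power2_eq_square)
        finally show "r / a0\<^sup>2 \<le> \<bar>x - y\<bar>" unfolding bb .
      qed (use finT r in auto)
      also have "\<dots> = 6 * a0\<^sup>2 + 2" using r a0_ge by simp
      finally show ?thesis using 1 3 by (simp add: C2_def)
    qed
    have sub: "{u \<in> stop B. \<bar>cfrac u - c\<bar> \<le> 2 * r} \<subseteq> (\<lambda>(t, s). t @ s) ` (T \<times> E)"
    proof
      fix u assume "u \<in> {u \<in> stop B. \<bar>cfrac u - c\<bar> \<le> 2 * r}"
      then have u: "u \<in> stop B" "\<bar>cfrac u - c\<bar> \<le> 2 * r" by auto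
      note us = stopD[OF u(1) B1]
      have "b \<le> den u" using us bB by linarith
      then obtain t s where ts: "t \<in> stop b" "u = t @ s" using stop_prefix[OF us(1)] by blast
      note st = stopD[OF ts(1) b1]
      have sA: "set s \<subseteq> A" using us ts by auto
      have s1: "1 \<le> real_of_int (den s)" using den_word_ge1[OF sA] .
      have "\<bar>cfrac u - cfrac t\<bar> \<le> 1 / (den t)\<^sup>2"
        unfolding ts(2) using st(1) sA by (intro cfrac_append_dist word_pos)
      also have "\<dots> \<le> 1 / b\<^sup>2"
      proof -
        have "b\<^sup>2 \<le> (real_of_int (den t))\<^sup>2" using st b1 by (intro power_mono) auto
        then show ?thesis using b1 by (simp add: frac_le)
      qed
      finally have "\<bar>cfrac u - cfrac t\<bar> \<le> r" using bb by simp
      then have "t \<in> T" using u ts by (simp add: T_def)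
      have d1: "real_of_int (den t) * real_of_int (den s) \<le> real_of_int (den u)"
        using den_append_ge[OF word_pos[OF st(1)] word_pos[OF sA]] ts(2) by (simp flip: of_int_mult)
      have "real_of_int (den u) \<le> real_of_int (2 * den t * den s)"
        using den_append_le[OF word_pos[OF st(1)] word_pos[OF sA]] ts(2) by (simp only: of_int_le_iff)
      then have d2: "real_of_int (den u) \<le> 2 * (real_of_int (den t) * real_of_int (den s))" by simp
      have "b * real_of_int (den s) \<le> real_of_int (den t) * real_of_int (den s)" using st s1 by (intro mult_right_mono) auto
      then have "b * real_of_int (den s) \<le> a0 * B" using d1 us by linarith
      then have "real_of_int (den s) \<le> a0 * B / b" using b1 by (simp add: pos_le_divide_eq mult.commute)
      also have "\<dots> = a0 * (B / b)" by simp
      also have "\<dots> \<le> 2 * a0 * (B / b)" using a0_ge b1 B1 by (intro mult_right_mono) auto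
      finally have up: "real_of_int (den s) \<le> 2 * a0 * (B / b)" .
      have "real_of_int (den t) * real_of_int (den s) \<le> (a0 * b) * real_of_int (den s)" using st s1 by (intro mult_right_mono) auto
      then have "B \<le> 2 * ((a0 * b) * real_of_int (den s))" using d2 us by linarith
      then have "B \<le> real_of_int (den s) * (b * (2 * a0))" by (simp add: mult_ac)
      then have "B / (b * (2 * a0)) \<le> real_of_int (den s)" using b1 a0_ge by (subst pos_divide_le_eq) auto
      then have "s \<in> E" using up sA by (simp add: E_def)
      then show "u \<in> (\<lambda>(t, s). t @ s) ` (T \<times> E)" using \<open>t \<in> T\<close> ts by (intro image_eqI[of _ _ "(t, s)"]) auto
    qed
    have "card {u \<in> stop B. \<bar>cfrac u - c\<bar> \<le> 2 * r} \<le> card ((\<lambda>(t, s). t @ s) ` (T \<times> E))"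
      using finT finE by (intro card_mono sub) auto
    also have "\<dots> \<le> card (T \<times> E)" using finT finE by (intro card_image_le) auto
    finally have "card {u \<in> stop B. \<bar>cfrac u - c\<bar> \<le> 2 * r} \<le> card T * card E" by (simp only: card_cartesian_product)
    then have "real (card {u \<in> stop B. \<bar>cfrac u - c\<bar> \<le> 2 * r}) \<le> real (card T * card E)" by (simp only: of_nat_le_iff)
    then have "real (card {u \<in> stop B. \<bar>cfrac u - c\<bar> \<le> 2 * r}) \<le> real (card T) * real (card E)" by (simp only: of_nat_mult)
    also have "\<dots> \<le> C2 * (C1 * (B / b) powr (2 * \<delta>))"
      using cardT C1(2)[of "B / b"] bB b1 C2 unfolding E_def by (intro mult_mono) auto
    also have "(B / b) powr (2 * \<delta>) = B powr (2 * \<delta>) * r powr \<delta>"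
    proof -
      have "B / b = B * r powr (1 / 2)" using r by (simp add: b_def powr_half_sqrt)
      then have "(B / b) powr (2 * \<delta>) = B powr (2 * \<delta>) * (r powr (1 / 2)) powr (2 * \<delta>)"
        using B1 r by (simp add: powr_mult)
      then show ?thesis by (simp add: powr_powr)
    qed
    finally show ?thesis by (simp add: mult_ac)
  qed
  then show ?thesis using C1(1) C2 by (intro exI[of _ "C2 * C1"]) auto
qed

end

section \<open>Frequencies near rationals with small denominator\<close>

text \<open>Multiplied by \<open>q * q'\<close>, each near coincidence becomes an integer of modulus
  less than 1, hence 0. So the rational parts agree exactly modulo 1 in both coordinates, and the
  remainders differ by at most \<epsilon>. Since the vectors are primitive, a/q times the first
  vector has common denominator exactly \<open>q\<close>, and likewise for \<open>q'\<close>;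
  therefore \<open>q' = q\<close>.\<close>

lemma small_pair:
  fixes a q a' q' y1 y2 y1' y2' :: int and \<theta> \<theta>' \<beta> \<beta>' \<epsilon> :: real
  assumes cop: "coprime a q" "coprime a' q'" "coprime y1 y2" "coprime y1' y2'" and q: "0 < q" "0 < q'"
    and \<theta>: "\<theta> = a / q + \<beta>" "\<theta>' = a' / q' + \<beta>'"
    and d: "dnorm (\<theta>' * y1' - \<theta> * y1) \<le> \<epsilon>" "dnorm (\<theta>' * y2' - \<theta> * y2) \<le> \<epsilon>"
    and sm: "q * q' * (\<bar>\<beta> * y1\<bar> + \<bar>\<beta>' * y1'\<bar> + \<epsilon>) < 1" "q * q' * (\<bar>\<beta> * y2\<bar> + \<bar>\<beta>' * y2'\<bar> + \<epsilon>) < 1"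
  shows "q' = q" "q dvd y1 * y2' - y2 * y1'" "q dvd a' * y1' - a * y1" "q dvd a' * y2' - a * y2"
    "\<bar>\<beta>' * y1' - \<beta> * y1\<bar> \<le> \<epsilon>" "\<bar>\<beta>' * y2' - \<beta> * y2\<bar> \<le> \<epsilon>"
proof -
  have key: "\<exists>n::int. a' * q * y' = q' * (a * y + q * n) \<and> \<bar>\<beta>' * y' - \<beta> * y\<bar> \<le> \<epsilon>"
    if d: "dnorm (\<theta>' * y' - \<theta> * y) \<le> \<epsilon>" and sm: "q * q' * (\<bar>\<beta> * y\<bar> + \<bar>\<beta>' * y'\<bar> + \<epsilon>) < 1" for y y' :: int
  proof -
    obtain n where n: "dnorm (\<theta>' * y' - \<theta> * y) = \<bar>\<theta>' * y' - \<theta> * y - of_int n\<bar>" by (rule dnormE)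
    define k where "k = a' * q * y' - q' * (a * y + q * n)"
    have qq: "0 < real_of_int q * real_of_int q'" using q by simp
    have "real_of_int k = real_of_int q * real_of_int q' * ((\<theta>' * y' - \<theta> * y - of_int n) - (\<beta>' * y' - \<beta> * y))"
      unfolding \<theta> k_def using q by (simp add: field_simps)
    then have "\<bar>real_of_int k\<bar> = real_of_int q * real_of_int q' * \<bar>(\<theta>' * y' - \<theta> * y - of_int n) - (\<beta>' * y' - \<beta> * y)\<bar>"
      using q by (simp add: abs_mult)
    also have "\<dots> \<le> real_of_int q * real_of_int q' * (\<bar>\<beta> * y\<bar> + \<bar>\<beta>' * y'\<bar> + \<epsilon>)"
      using qq d n by (intro mult_left_mono) linarith+
    also have "\<dots> < 1" using sm by simp
    finally have k0: "k = 0" by linarith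
    then have e: "a' * q * y' = q' * (a * y + q * n)" by (simp add: k_def)
    have "real_of_int (a' * q * y') = real_of_int (q' * (a * y + q * n))" using e by (rule arg_cong)
    then have "a' / q' * y' - a / q * y - of_int n = 0" using q by (simp add: field_simps)
    then have "\<beta>' * y' - \<beta> * y = \<theta>' * y' - \<theta> * y - of_int n" unfolding \<theta> by (simp add: algebra_simps)
    then show ?thesis using e d n by auto
  qed
  obtain n1 where n1: "a' * q * y1' = q' * (a * y1 + q * n1)" "\<bar>\<beta>' * y1' - \<beta> * y1\<bar> \<le> \<epsilon>" using key[OF d(1) sm(1)] by auto
  obtain n2 where n2: "a' * q * y2' = q' * (a * y2 + q * n2)" "\<bar>\<beta>' * y2' - \<beta> * y2\<bar> \<le> \<epsilon>" using key[OF d(2) sm(2)] by auto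
  show "\<bar>\<beta>' * y1' - \<beta> * y1\<bar> \<le> \<epsilon>" "\<bar>\<beta>' * y2' - \<beta> * y2\<bar> \<le> \<epsilon>" by fact+
  \<comment> \<open>Bezout for a primitive vector: a common divisor of both \<open>e * z1\<close>
    and \<open>e * z2\<close> divides \<open>e\<close>.\<close>
  have common: "d dvd e" if cz: "coprime z1 z2" and dz: "d dvd e * z1" "d dvd e * z2" for d e z1 z2 :: int
  proof -
    obtain r s where rs: "r * z1 + s * z2 = 1" using cz bezout_int[of z1 z2] by auto
    have "r * (e * z1) + s * (e * z2) = e * (r * z1 + s * z2)" by (simp add: algebra_simps)
    then have "r * (e * z1) + s * (e * z2) = e" using rs by simp
    moreover have "d dvd r * (e * z1) + s * (e * z2)" by (rule dvd_add[OF dvd_mult[OF dz(1)] dvd_mult[OF dz(2)]])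
    ultimately show ?thesis by simp
  qed
  have "q' dvd q"
  proof (rule common[OF cop(4)])
    have "q' dvd a' * (q * y1')" "q' dvd a' * (q * y2')" using n1(1) n2(1) by (auto simp: mult.assoc[symmetric])
    then show "q' dvd q * y1'" "q' dvd q * y2'"
      using coprime_dvd_mult_right_iff[of q' a'] cop(2) by (auto simp: coprime_commute)
  qed
  moreover have "q dvd q'"
  proof (rule common[OF cop(3)])
    have "a * (q' * y1) = q * (a' * y1' - q' * n1)" "a * (q' * y2) = q * (a' * y2' - q' * n2)"
      using n1(1) n2(1) by (auto simp: algebra_simps)
    then have "q dvd a * (q' * y1)" "q dvd a * (q' * y2)" by auto
    then show "q dvd q' * y1" "q dvd q' * y2"
      using coprime_dvd_mult_right_iff[of q a] cop(1) by (auto simp: coprime_commute)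
  qed
  ultimately show qeq: "q' = q" using q by (simp add: zdvd_antisym_nonneg)
  have m1: "a' * y1' = a * y1 + q * n1" and m2: "a' * y2' = a * y2 + q * n2"
    using n1(1) n2(1) q unfolding qeq by (auto simp: mult.assoc mult.left_commute[of _ q])
  show "q dvd a' * y1' - a * y1" "q dvd a' * y2' - a * y2" unfolding m1 m2 by auto
  have "a' * (y1 * y2' - y2 * y1') = y1 * (a' * y2') - y2 * (a' * y1')" by (simp add: algebra_simps)
  also have "\<dots> = q * (y1 * n2 - y2 * n1)" unfolding m1 m2 by (simp add: algebra_simps)
  finally have "q dvd a' * (y1 * y2' - y2 * y1')" by simp
  then show "q dvd y1 * y2' - y2 * y1'"
    using coprime_dvd_mult_right_iff[of q a'] cop(2) qeq by (auto simp: coprime_commute)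
qed

context critical_alphabet
begin

text \<open>Exceeds every denominator in the support of \<open>wt N\<close>, so that
  \<open>parseval\<close> applies without aliasing, yet is of order \<open>N\<close>.\<close>

definition PN :: "nat \<Rightarrow> nat" where "PN N = (2 * Max A + 4) * N"

lemma PN_eq: "real (PN N) = (2 * a0 + 2) * real N"
  by (simp add: PN_def a0_def algebra_simps)

text \<open>The two constraints act on different ends of the word. Cut at \<open>L1\<close> of order
  \<open>L / sqrt X\<close>: the prefix is localised by \<open>card_stop_near_le\<close>, and for a
  given prefix the tails have pairwise determinants divisible by \<open>q\<close>, so
  \<open>card_wg_divisible_le\<close> applies. The square root makes the squared tail denominators
  of order \<open>X\<close>, and \<open>X / q \<ge> 1 / 2\<close> absorbs the additive
  constant.\<close>

lemma card_small_words_le: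
  "\<exists>C>0. \<forall>L X q v r. 1 \<le> X \<longrightarrow> 2 * a0 * X \<le> L \<longrightarrow> 1 \<le> q \<longrightarrow> real_of_int q \<le> 2 * X \<longrightarrow>
     1 / X \<le> r \<longrightarrow> r \<le> 1 \<longrightarrow>
     real (card {w \<in> Yset L. q dvd wg v w \<and> \<bar>cfrac w - cfrac v\<bar> \<le> r})
       \<le> C * (L / sqrt X) powr (2 * \<delta>) * r powr \<delta> * (X / q)"
proof -
  obtain C0 where C0: "C0 > 0" "\<And>B c r. 0 < r \<Longrightarrow> r \<le> 1 \<Longrightarrow> 1 \<le> r * B\<^sup>2 \<Longrightarrow> 1 \<le> B \<Longrightarrow>
     real (card {u \<in> stop B. \<bar>cfrac u - c\<bar> \<le> 2 * r}) \<le> C0 * B powr (2 * \<delta>) * r powr \<delta>"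
    using card_stop_near_le by blast
  define b2 where "b2 = 2 * a0 * (2 * a0 + 1)"
  define C where "C = C0 * (4 * b2\<^sup>2 + 4)"
  have main: "real (card {w \<in> Yset L. q dvd wg v w \<and> \<bar>cfrac w - cfrac v\<bar> \<le> r})
       \<le> C * (L / sqrt X) powr (2 * \<delta>) * r powr \<delta> * (X / q)"
    if X: "1 \<le> X" and L: "2 * a0 * X \<le> L" and q: "1 \<le> q" "real_of_int q \<le> 2 * X"
      and r: "1 / X \<le> r" "r \<le> 1" for L X r :: real and q :: int and v
  proof -
    define L1 where "L1 = L / (2 * a0 * sqrt X)"
    have sX: "1 \<le> sqrt X" "sqrt X * sqrt X = X" using X by auto
    have a2: "0 < 2 * a0" "1 \<le> 2 * a0" using a0_ge by auto
    have "0 < 2 * a0 * X" using a2 X by (intro mult_pos_pos) auto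
    then have L0: "0 < L" using L by linarith
    have L1s: "sqrt X \<le> L1"
    proof -
      have "sqrt X * (2 * a0 * sqrt X) = 2 * a0 * X" using sX by (simp add: mult_ac)
      then have "sqrt X * (2 * a0 * sqrt X) \<le> L" using L by linarith
      moreover have "0 < 2 * a0 * sqrt X" using a2 sX by (intro mult_pos_pos) auto
      ultimately show ?thesis unfolding L1_def by (simp only: pos_le_divide_eq)
    qed
    have L1: "1 \<le> L1" using L1s sX by linarith
    have "0 < 1 / X" using X by simp
    then have r0: "0 < r" using r(1) by linarith
    have rL: "1 \<le> r * L1\<^sup>2"
    proof -
      have "X \<le> L1\<^sup>2" using L1s sX power_mono[OF L1s, of 2] by (simp add: power2_eq_square)
      then have "1 / X * X \<le> r * L1\<^sup>2" using r r0 X by (intro mult_mono) auto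
      then show ?thesis using X by simp
    qed
    define T where "T = {u \<in> stop L1. \<bar>cfrac u - cfrac v\<bar> \<le> 2 * r}"
    have finT: "finite T" unfolding T_def using finite_stop[OF L1] by simp
    define B where "B = b2 * sqrt X"
    define G where "G u = {s. set s \<subseteq> A \<and> q dvd wg v (u @ s) \<and> real_of_int (den s) \<le> B}" for u
    have finG: "finite (G u)" for u unfolding G_def by (rule finite_den_range)
    have cardG: "real (card (G u)) \<le> (4 * b2\<^sup>2 + 4) * (X / q)" for u
    proof -
      have "real (card (G u)) \<le> 2 * (2 * B\<^sup>2 / q + 1)"
      proof (rule card_wg_divisible_le)
        show "finite (G u)" by (rule finG)
        show "G u \<subseteq> {w. set w \<subseteq> A}" by (auto simp: G_def)
        show "1 \<le> q" by fact
        show "real_of_int (den s) \<le> B" if "s \<in> G u" for s using that by (simp add: G_def)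
        fix s t assume st: "s \<in> G u" "t \<in> G u"
        have "q dvd wg (u @ s) (u @ t)"
          using dvd_wedge[OF coprime_den_num[of v], of q "num (u @ s)" "den (u @ s)" "num (u @ t)" "den (u @ t)"] st
          by (simp add: G_def wg_def mult.commute)
        then have "q dvd (- 1) ^ length u * wg s t" unfolding wg_append .
        then show "q dvd wg s t" by (cases "even (length u)") auto
      qed
      also have "\<dots> = 4 * b2\<^sup>2 * (X / q) + 2" using X by (simp add: B_def power_mult_distrib sX(2) power2_eq_square[of "sqrt X"])
      also have "\<dots> \<le> 4 * b2\<^sup>2 * (X / q) + 4 * (X / q)"
      proof -
        have "1 / 2 \<le> X / q" using q by (simp add: pos_le_divide_eq)
        then show ?thesis by linarith
      qed
      finally show ?thesis by (simp add: algebra_simps)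
    qed
    have sub: "{w \<in> Yset L. q dvd wg v w \<and> \<bar>cfrac w - cfrac v\<bar> \<le> r} \<subseteq> (\<Union>u\<in>T. (\<lambda>s. u @ s) ` G u)"
    proof
      fix w assume w: "w \<in> {w \<in> Yset L. q dvd wg v w \<and> \<bar>cfrac w - cfrac v\<bar> \<le> r}"
      then have wY: "w \<in> Yset L" and wd: "q dvd wg v w" and wc: "\<bar>cfrac w - cfrac v\<bar> \<le> r" by auto
      note y = YsetD[OF wY]
      have "L1 \<le> L / (2 * a0)"
        unfolding L1_def using L0 a2 sX by (intro divide_left_mono) (auto simp: mult_le_cancel_left1)
      then have "L1 \<le> den w" using y(3) by linarith
      then obtain u s where us: "u \<in> stop L1" "w = u @ s" using stop_prefix[OF y(1)] by blast
      note u = stopD[OF us(1) L1]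
      have sA: "set s \<subseteq> A" using y(1) us by auto
      have s1: "1 \<le> real_of_int (den s)" using den_word_ge1[OF sA] .
      have "\<bar>cfrac w - cfrac u\<bar> \<le> 1 / (den u)\<^sup>2"
        unfolding us(2) using u(1) sA by (intro cfrac_append_dist word_pos)
      also have "\<dots> \<le> 1 / L1\<^sup>2"
      proof -
        have "L1\<^sup>2 \<le> (real_of_int (den u))\<^sup>2" using u L1 by (intro power_mono) auto
        then show ?thesis using L1 by (simp add: frac_le)
      qed
      also have "\<dots> \<le> r" using rL L1 by (simp add: pos_divide_le_eq)
      finally have "u \<in> T" using wc us by (simp add: T_def)
      have d1: "real_of_int (den u) * real_of_int (den s) \<le> real_of_int (den w)"
        using den_append_ge[OF word_pos[OF u(1)] word_pos[OF sA]] us(2) by (simp flip: of_int_mult)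
      have "L1 * real_of_int (den s) \<le> real_of_int (den u) * real_of_int (den s)" using u s1 by (intro mult_right_mono) auto
      then have "L1 * real_of_int (den s) \<le> (2 * a0 + 1) * L" using d1 y(4) by linarith
      also have "\<dots> = L1 * B" unfolding L1_def B_def b2_def using a2 sX by (simp add: field_simps)
      finally have "real_of_int (den s) \<le> B" using L1 by (simp only: mult_le_cancel_left_pos)
      then have "s \<in> G u" using sA wd us by (simp add: G_def)
      then show "w \<in> (\<Union>u\<in>T. (\<lambda>s. u @ s) ` G u)" using \<open>u \<in> T\<close> us by blast
    qed
    have "card {w \<in> Yset L. q dvd wg v w \<and> \<bar>cfrac w - cfrac v\<bar> \<le> r} \<le> card (\<Union>u\<in>T. (\<lambda>s. u @ s) ` G u)"
      using finT finG by (intro card_mono sub) auto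
    also have "\<dots> \<le> (\<Sum>u\<in>T. card ((\<lambda>s. u @ s) ` G u))" by (rule card_UN_le[OF finT])
    also have "\<dots> \<le> (\<Sum>u\<in>T. card (G u))" by (intro sum_mono card_image_le finG)
    finally have "real (card {w \<in> Yset L. q dvd wg v w \<and> \<bar>cfrac w - cfrac v\<bar> \<le> r}) \<le> real (\<Sum>u\<in>T. card (G u))"
      by (simp only: of_nat_le_iff)
    also have "\<dots> = (\<Sum>u\<in>T. real (card (G u)))" by (simp only: of_nat_sum)
    also have "\<dots> \<le> (\<Sum>u\<in>T. (4 * b2\<^sup>2 + 4) * (X / q))" by (intro sum_mono cardG)
    also have "\<dots> = real (card T) * ((4 * b2\<^sup>2 + 4) * (X / q))" by simp
    also have "\<dots> \<le> (C0 * L1 powr (2 * \<delta>) * r powr \<delta>) * ((4 * b2\<^sup>2 + 4) * (X / q))"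
      unfolding T_def using X q by (intro mult_right_mono C0(2) r0 r rL L1) auto
    also have "\<dots> \<le> (C0 * (L / sqrt X) powr (2 * \<delta>) * r powr \<delta>) * ((4 * b2\<^sup>2 + 4) * (X / q))"
    proof (intro mult_right_mono mult_left_mono powr_mono2)
      show "L1 \<le> L / sqrt X" unfolding L1_def using L0 a2 sX
        by (intro divide_left_mono) (auto simp: mult_le_cancel_right1)
    qed (use C0 delta_nonneg L1 X q in auto)
    also have "\<dots> = C * (L / sqrt X) powr (2 * \<delta>) * r powr \<delta> * (X / q)" unfolding C_def by (simp only: mult_ac)
    finally show ?thesis .
  qed
  have "C > 0" unfolding C_def using C0(1) by (intro mult_pos_pos add_nonneg_pos) auto
  then show ?thesis by (intro exI[of _ C] conjI allI impI main)
qed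

definition block :: "nat \<Rightarrow> real \<Rightarrow> (real \<Rightarrow> int) \<Rightarrow> (real \<Rightarrow> int) \<Rightarrow> real set \<Rightarrow> bool" where
  "block N X aa qq Z \<longleftrightarrow> Z \<subseteq> grid (PN N) \<and> (\<forall>\<theta>\<in>Z. 0 < qq \<theta> \<and> coprime (aa \<theta>) (qq \<theta>) \<and>
     X \<le> qq \<theta> * (1 + real N * \<bar>\<theta> - aa \<theta> / qq \<theta>\<bar>) \<and> qq \<theta> * (1 + real N * \<bar>\<theta> - aa \<theta> / qq \<theta>\<bar>) < 2 * X)"

lemma blockD:
  assumes "block N X aa qq Z" "\<theta> \<in> Z" "0 < N"
  shows "0 < qq \<theta>" "coprime (aa \<theta>) (qq \<theta>)" "1 \<le> real_of_int (qq \<theta>)" "real_of_int (qq \<theta>) < 2 * X"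
    "real_of_int (qq \<theta>) * \<bar>\<theta> - aa \<theta> / qq \<theta>\<bar> < 2 * X / real N"
    "X \<le> real_of_int (qq \<theta>) * (1 + real N * \<bar>\<theta> - aa \<theta> / qq \<theta>\<bar>)"
proof -
  let ?b = "\<bar>\<theta> - aa \<theta> / qq \<theta>\<bar>" and ?q = "real_of_int (qq \<theta>)"
  show q: "0 < qq \<theta>" "coprime (aa \<theta>) (qq \<theta>)" "X \<le> ?q * (1 + real N * ?b)"
    using assms unfolding block_def by blast+
  have lt: "?q * (1 + real N * ?b) < 2 * X" using assms unfolding block_def by blast
  show q1: "1 \<le> ?q" using q by simp
  have split: "?q * (1 + real N * ?b) = ?q + real N * (?q * ?b)" by (simp add: algebra_simps)
  have "0 \<le> real N * (?q * ?b)" using q1 by simp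
  then show "?q < 2 * X" using lt split by linarith
  have "real N * (?q * ?b) < 2 * X" using lt split q1 by linarith
  then show "?q * ?b < 2 * X / real N" using assms(3) by (simp add: pos_less_divide_eq mult.commute)
qed

text \<open>There are \<open>O(X)\<close> numerators and \<open>O(X)\<close> denominators, and each
  fraction has \<open>O(X)\<close> grid points within \<open>2 * X / N\<close>.\<close>

lemma card_block_le:
  assumes b: "block N X aa qq Z" and N: "0 < N" and X: "1 \<le> X"
  shows "real (card Z) \<le> 27 * (8 * a0 + 9) * X ^ 3"
proof -
  have Zg: "Z \<subseteq> grid (PN N)" using b by (simp add: block_def)
  have fin: "finite Z" using Zg finite_grid finite_subset by blast
  have PN0: "0 < PN N" using N by (simp add: PN_def)
  let ?A = "{n::int. - (4 * X) \<le> n \<and> n \<le> 4 * X}" and ?Q = "{n::int. 1 \<le> n \<and> n \<le> 2 * X}"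
  have geA: "- (4 * X) \<le> 4 * X + 1" and geQ: "1 \<le> 2 * X + 1" using X by auto
  have finA: "finite ?A" by (rule card_int_between_le(1)[OF geA])
  have finQ: "finite ?Q" using card_int_between_le(1)[OF geQ] by simp
  have cA: "real (card ?A) \<le> 9 * X" using card_int_between_le(2)[OF geA] X by linarith
  have cQ: "real (card ?Q) \<le> 3 * X" using card_int_between_le(2)[OF geQ] X by simp
  have "real (card Z) \<le> ((8 * a0 + 9) * X) * real (card (?A \<times> ?Q))"
  proof (rule card_le_fibres'[where f = "\<lambda>\<theta>. (aa \<theta>, qq \<theta>)"])
    show "(\<lambda>\<theta>. (aa \<theta>, qq \<theta>)) ` Z \<subseteq> ?A \<times> ?Q"
    proof
      fix p assume "p \<in> (\<lambda>\<theta>. (aa \<theta>, qq \<theta>)) ` Z"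
      then obtain \<theta> where t: "\<theta> \<in> Z" "p = (aa \<theta>, qq \<theta>)" by blast
      note d = blockD[OF b t(1) N]
      let ?q = "real_of_int (qq \<theta>)"
      have t01: "0 \<le> \<theta>" "\<theta> < 1" using gridD Zg t by blast+
      have "\<bar>?q * (\<theta> - aa \<theta> / qq \<theta>)\<bar> < 2 * X / real N" using d(3,5) by (simp add: abs_mult)
      also have "\<dots> \<le> 2 * X / 1" using N X by (intro divide_left_mono) auto
      finally have "\<bar>?q * (\<theta> - aa \<theta> / qq \<theta>)\<bar> < 2 * X" by simp
      moreover have "?q * (\<theta> - aa \<theta> / qq \<theta>) = ?q * \<theta> - aa \<theta>" using d(3) by (simp add: right_diff_distrib)
      moreover have "\<bar>?q * \<theta>\<bar> \<le> 2 * X"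
      proof -
        have "?q * \<theta> \<le> ?q * 1" using t01 d(3) by (intro mult_left_mono) auto
        moreover have "0 \<le> ?q * \<theta>" using t01 d(3) by simp
        ultimately show ?thesis using d(4) by linarith
      qed
      ultimately have "\<bar>real_of_int (aa \<theta>)\<bar> \<le> 4 * X" by linarith
      then have "aa \<theta> \<in> ?A" by (simp add: abs_le_iff)
      moreover have "qq \<theta> \<in> ?Q" using d by simp
      ultimately show "p \<in> ?A \<times> ?Q" using t by blast
    qed
    show "0 \<le> (8 * a0 + 9) * X" using a0_ge X by simp
    show "finite (?A \<times> ?Q)" using finA finQ by blast
    fix p :: "int \<times> int" assume p: "p \<in> ?A \<times> ?Q"
    have "real (card {s \<in> Z. (aa s, qq s) = p}) \<le> 2 * (2 * X / real N) * real (PN N) + 1"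
    proof (rule card_grid_interval_le[where c = "fst p / snd p"])
      fix \<theta> assume t: "\<theta> \<in> {s \<in> Z. (aa s, qq s) = p}"
      then have tZ: "\<theta> \<in> Z" and e: "fst p = aa \<theta>" "snd p = qq \<theta>" by auto
      note d = blockD[OF b tZ N]
      have "1 * \<bar>\<theta> - aa \<theta> / qq \<theta>\<bar> \<le> real_of_int (qq \<theta>) * \<bar>\<theta> - aa \<theta> / qq \<theta>\<bar>" using d(3) by (intro mult_right_mono) auto
      moreover have "x \<le> c" if "1 * x \<le> g * x" "g * x < c" for x g c :: real using that by linarith
      ultimately show "\<bar>\<theta> - fst p / snd p\<bar> \<le> 2 * X / real N" using d(5) unfolding e by blast
    qed (use PN0 X Zg in auto)
    also have "\<dots> = 8 * (a0 + 1) * X + 1" unfolding PN_eq using N by (simp add: field_simps)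
    also have "\<dots> \<le> (8 * a0 + 9) * X" using X by (simp add: algebra_simps)
    finally show "real (card {s \<in> Z. (aa s, qq s) = p}) \<le> (8 * a0 + 9) * X" .
  qed (use fin in simp)
  also have "real (card (?A \<times> ?Q)) = real (card ?A) * real (card ?Q)" by (simp only: card_cartesian_product of_nat_mult)
  also have "((8 * a0 + 9) * X) * (real (card ?A) * real (card ?Q)) \<le> ((8 * a0 + 9) * X) * ((9 * X) * (3 * X))"
    using cA cQ X a0_ge by (intro mult_left_mono mult_mono) auto
  also have "\<dots> = 27 * (8 * a0 + 9) * X ^ 3" by (simp add: power3_eq_cube)
  finally show ?thesis .
qed

text \<open>One more than \<open>16 * a0 + 12\<close>, the coefficient to which the error terms in
  \<open>small_close_D\<close> add up; this makes their sum strictly less than 1.\<close>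

definition C1 :: real where "C1 = 16 * a0 + 13"

text \<open>Verifies the smallness condition of \<open>small_pair\<close>. The terms with \<beta>
  and \<beta>' contribute \<open>O(X\<^sup>2 / M)\<close>, the tolerance contributes
  \<open>q * q' * D / M \<le> 4 * X ^ 4 / M\<close>; this is where \<open>D \<le> X\<^sup>2\<close>
  is needed.\<close>

lemma small_close_D:
  fixes \<beta> \<beta>' :: real
  assumes b: "block N X aa qq Z" and N: "0 < N" and X: "1 \<le> X" and M: "M = C1 * X ^ 4"
    and D: "1 \<le> D" "D \<le> X\<^sup>2"
    and p: "\<theta> \<in> Z" "v \<in> Yset (real N / M)" and p': "\<theta>' \<in> Z" "v' \<in> Yset (real N / M)"
    and cl: "close (D / M) (\<theta>, v) (\<theta>', v')"
  defines "\<beta> \<equiv> \<theta> - aa \<theta> / qq \<theta>" and "\<beta>' \<equiv> \<theta>' - aa \<theta>' / qq \<theta>'"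
  shows "qq \<theta>' = qq \<theta>" "qq \<theta> dvd wg v v'" "qq \<theta> dvd aa \<theta>' * den v' - aa \<theta> * den v"
    "qq \<theta> dvd aa \<theta>' * num v' - aa \<theta> * num v"
    "\<bar>\<beta>' * den v' - \<beta> * den v\<bar> \<le> D / M" "\<bar>\<beta>' * num v' - \<beta> * num v\<bar> \<le> D / M"
proof -
  note d = blockD[OF b p(1) N] and d' = blockD[OF b p'(1) N]
  note y = YsetD[OF p(2)] and y' = YsetD[OF p'(2)]
  have C1: "1 \<le> C1" using a0_ge by (simp add: C1_def)
  have M0: "0 < M" unfolding M using C1 X by simp
  have sm: "real_of_int (qq \<theta> * qq \<theta>') * (\<bar>\<beta> * k\<bar> + \<bar>\<beta>' * k'\<bar> + D / M) < 1"
    if k: "0 \<le> k" "k \<le> (2 * a0 + 1) * (real N / M)" "0 \<le> k'" "k' \<le> (2 * a0 + 1) * (real N / M)" for k k'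
  proof -
    let ?q = "real_of_int (qq \<theta>)" and ?q' = "real_of_int (qq \<theta>')" and ?Y = "(2 * a0 + 1) * (real N / M)"
    have Y0: "0 \<le> ?Y" using k by linarith
    have "(?q * \<bar>\<beta>\<bar>) * (?q' * k) \<le> (2 * X / real N) * ((2 * X) * ?Y)"
      using d d' k X unfolding \<beta>_def by (intro mult_mono) auto
    also have "\<dots> = 4 * X\<^sup>2 * (2 * a0 + 1) / M" using N by (simp add: power2_eq_square)
    finally have 1: "(?q * \<bar>\<beta>\<bar>) * (?q' * k) \<le> 4 * X\<^sup>2 * (2 * a0 + 1) / M" .
    have "(?q' * \<bar>\<beta>'\<bar>) * (?q * k') \<le> (2 * X / real N) * ((2 * X) * ?Y)"
      using d d' k X unfolding \<beta>'_def by (intro mult_mono) auto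
    also have "\<dots> = 4 * X\<^sup>2 * (2 * a0 + 1) / M" using N by (simp add: power2_eq_square)
    finally have 2: "(?q' * \<bar>\<beta>'\<bar>) * (?q * k') \<le> 4 * X\<^sup>2 * (2 * a0 + 1) / M" .
    have "?q * ?q' * (D / M) \<le> ((2 * X) * (2 * X)) * (X\<^sup>2 / M)"
      using d d' D M0 X by (intro mult_mono divide_right_mono) auto
    also have "\<dots> = 4 * X ^ 4 / M" by (simp add: power2_eq_square power4_eq_xxxx)
    finally have 3: "?q * ?q' * (D / M) \<le> 4 * X ^ 4 / M" .
    have "real_of_int (qq \<theta> * qq \<theta>') * (\<bar>\<beta> * k\<bar> + \<bar>\<beta>' * k'\<bar> + D / M)
        = (?q * \<bar>\<beta>\<bar>) * (?q' * k) + (?q' * \<bar>\<beta>'\<bar>) * (?q * k') + ?q * ?q' * (D / M)"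
      using k by (simp add: abs_mult algebra_simps)
    also have "\<dots> \<le> 4 * X\<^sup>2 * (2 * a0 + 1) / M + 4 * X\<^sup>2 * (2 * a0 + 1) / M + 4 * X ^ 4 / M"
      by (intro add_mono 1 2 3)
    also have "\<dots> = (X\<^sup>2 * (16 * a0 + 8) + 4 * X ^ 4) / M" by (simp add: add_divide_distrib[symmetric] algebra_simps)
    also have "\<dots> \<le> (X ^ 4 * (16 * a0 + 8) + 4 * X ^ 4) / M"
      using X M0 a0_ge by (intro divide_right_mono add_mono mult_right_mono power_increasing) auto
    also have "\<dots> < 1"
    proof -
      have "X ^ 4 * (16 * a0 + 8) + 4 * X ^ 4 = (16 * a0 + 12) * X ^ 4" by (simp add: algebra_simps)
      also have "\<dots> < C1 * X ^ 4" using X by (intro mult_strict_right_mono) (auto simp: C1_def)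
      finally show ?thesis using M0 M by simp
    qed
    finally show ?thesis .
  qed
  have th: "\<theta> = aa \<theta> / qq \<theta> + \<beta>" "\<theta>' = aa \<theta>' / qq \<theta>' + \<beta>'" by (simp_all add: \<beta>_def \<beta>'_def)
  have ny: "real_of_int (num v) \<le> (2 * a0 + 1) * (real N / M)" "real_of_int (num v') \<le> (2 * a0 + 1) * (real N / M)"
    using y y' by linarith+
  have dy: "0 \<le> real_of_int (den v)" "0 \<le> real_of_int (den v')" using y y' by linarith+
  note sp = small_pair[OF d(2) d'(2) coprime_den_num[of v] coprime_den_num[of v'] d(1) d'(1) th,
      OF _ _ sm[OF dy(1) y(4) dy(2) y'(4)] sm[OF y(5) ny(1) y'(5) ny(2)]]
  have cl': "dnorm (\<theta>' * den v' - \<theta> * den v) \<le> D / M" "dnorm (\<theta>' * num v' - \<theta> * num v) \<le> D / M"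
    using cl by (auto simp: close_def)
  show "qq \<theta>' = qq \<theta>" "qq \<theta> dvd wg v v'" "qq \<theta> dvd aa \<theta>' * den v' - aa \<theta> * den v"
    "qq \<theta> dvd aa \<theta>' * num v' - aa \<theta> * num v"
    "\<bar>\<beta>' * den v' - \<beta> * den v\<bar> \<le> D / M" "\<bar>\<beta>' * num v' - \<beta> * num v\<bar> \<le> D / M"
    unfolding wg_def using sp[OF cl'] by blast+
qed

text \<open>The second components \<open>w\<close> satisfy the congruence from
  \<open>small_close_D\<close> and lie close to \<open>v\<close> in value, at distance
  \<open>O(D * q / X)\<close>, so \<open>card_small_words_le\<close> counts them. For given
  \<open>w\<close> the numerators of the \<theta>' are congruent modulo \<open>q\<close>; only
  \<beta>' varies, within \<open>O(D / N)\<close>, which leaves \<open>O(D)\<close> grid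
  points.\<close>

lemma small_count_main:
  "\<exists>C>0. \<forall>N X aa qq Z D p. block N X aa qq Z \<longrightarrow> 0 < N \<longrightarrow> 1 \<le> X \<longrightarrow>
     2 * a0 * X \<le> real N / (C1 * X ^ 4) \<longrightarrow> 1 \<le> D \<longrightarrow> D \<le> X\<^sup>2 \<longrightarrow> p \<in> Z \<times> Yset (real N / (C1 * X ^ 4)) \<longrightarrow>
     real (card {p' \<in> Z \<times> Yset (real N / (C1 * X ^ 4)). close (D / (C1 * X ^ 4)) p p'})
       \<le> C * (real N / (C1 * X ^ 4)) powr (2 * \<delta>) * X powr (1 - 2 * \<delta>) * D\<^sup>2"
proof -
  obtain Cw where Cw: "Cw > 0" "\<And>L X q v r. 1 \<le> X \<Longrightarrow> 2 * a0 * X \<le> L \<Longrightarrow> 1 \<le> q \<Longrightarrow> real_of_int q \<le> 2 * X \<Longrightarrow>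
     1 / X \<le> r \<Longrightarrow> r \<le> 1 \<Longrightarrow>
     real (card {w \<in> Yset L. q dvd wg v w \<and> \<bar>cfrac w - cfrac v\<bar> \<le> r})
       \<le> Cw * (L / sqrt X) powr (2 * \<delta>) * r powr \<delta> * (X / q)"
    using card_small_words_le by blast
  define Ct where "Ct = 3 * (8 * a0 * (2 * a0 + 2) + 1)"
  define Cr where "Cr = 4 * a0 + 1"
  define C where "C = Ct * Cw * Cr powr \<delta>"
  have Ct: "Ct > 0" using a0_ge by (simp add: Ct_def add_nonneg_pos)
  have Cr: "Cr \<ge> 1" using a0_ge by (simp add: Cr_def)
  have main: "real (card {p' \<in> Z \<times> Yset (real N / (C1 * X ^ 4)). close (D / (C1 * X ^ 4)) p p'})
       \<le> C * (real N / (C1 * X ^ 4)) powr (2 * \<delta>) * X powr (1 - 2 * \<delta>) * D\<^sup>2"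
    if b: "block N X aa qq Z" and N: "0 < N" and X: "1 \<le> X" and LX: "2 * a0 * X \<le> real N / (C1 * X ^ 4)"
      and D: "1 \<le> D" "D \<le> X\<^sup>2" and p: "p \<in> Z \<times> Yset (real N / (C1 * X ^ 4))" for N X aa qq Z D p
  proof -
    define M where "M = C1 * X ^ 4"
    define L where "L = real N / M"
    have M0: "0 < M" unfolding M_def using a0_ge X by (simp add: C1_def)
    have NML: "M * L = real N" using M0 by (simp add: L_def)
    have L0: "0 < L" using M0 N by (simp add: L_def)
    obtain \<theta> v where pv: "p = (\<theta>, v)" "\<theta> \<in> Z" "v \<in> Yset L" using p by (auto simp: L_def M_def)
    note d = blockD[OF b pv(2) N] and y = YsetD[OF pv(3)]
    let ?q = "qq \<theta>" and ?Q = "real_of_int (qq \<theta>)"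
    let ?S = "{p' \<in> Z \<times> Yset L. close (D / M) p p'}"
    note scd = small_close_D[OF b N X M_def D pv(2) pv(3)[unfolded L_def]]
    \<comment> \<open>Values of continued fractions differ by at most 1, so truncating at 1 loses
      nothing and keeps \<open>r\<close> in the range of \<open>card_small_words_le\<close>.\<close>
    define r where "r = min 1 (Cr * D * ?Q / X)"
    have Zg: "Z \<subseteq> grid (PN N)" using b by (simp add: block_def)
    have fin: "finite Z" using Zg finite_grid finite_subset by blast
    have PN0: "0 < PN N" using N by (simp add: PN_def)
    define V where "V = {w \<in> Yset L. ?q dvd wg v w \<and> \<bar>cfrac w - cfrac v\<bar> \<le> r}"
    have finV: "finite V" unfolding V_def using finite_Yset by simp
    have "real (card ?S) \<le> (Ct * D) * real (card V)"
    proof (rule card_le_fibres'[where f = snd])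
      show "snd ` ?S \<subseteq> V"
      proof
        fix w assume "w \<in> snd ` ?S"
        then obtain \<theta>' where s: "\<theta>' \<in> Z" "w \<in> Yset L" "close (D / M) (\<theta>, v) (\<theta>', w)" using pv by auto
        note sc = scd[OF s(1) s(2)[unfolded L_def] s(3)]
        note d' = blockD[OF b s(1) N] and y' = YsetD[OF s(2)]
        define \<beta> where "\<beta> = \<theta> - aa \<theta> / qq \<theta>"
        define \<beta>' where "\<beta>' = \<theta>' - aa \<theta>' / qq \<theta>'"
        define \<kappa> where "\<kappa> = \<bar>cfrac w - cfrac v\<bar>"
        let ?dv = "real_of_int (den v)" and ?dw = "real_of_int (den w)" and ?m = "real_of_int (wg v w)"
        have k: "\<kappa> = \<bar>?m\<bar> / (?dv * ?dw)" unfolding \<kappa>_def by (rule cfrac_diff_eq[OF y(2) y'(2)])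
        have dd: "0 < ?dv * ?dw" using y(7) y'(7) by (intro mult_pos_pos) auto
        have "\<bar>wg v w\<bar> \<le> den v * den w" by (rule abs_wg_le[OF y(2) y'(2)])
        then have "real_of_int \<bar>wg v w\<bar> \<le> real_of_int (den v * den w)" by (simp only: of_int_le_iff)
        then have "\<bar>?m\<bar> \<le> ?dv * ?dw" by simp
        then have k1: "\<kappa> \<le> 1" unfolding k using dd by (simp only: pos_divide_le_eq mult_1)
        have e1: "\<bar>\<beta>' * den w - \<beta> * den v\<bar> \<le> D / M" and e2: "\<bar>\<beta>' * num w - \<beta> * num v\<bar> \<le> D / M"
          using sc(5,6) unfolding \<beta>_def \<beta>'_def by blast+
        \<comment> \<open>This combination of the two coordinates is a determinant with the vector
          of \<open>v\<close>, so \<beta> drops out.\<close>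
        have "\<beta>' * ?m = ?dv * (\<beta>' * num w - \<beta> * num v) - real_of_int (num v) * (\<beta>' * den w - \<beta> * den v)"
          unfolding wg_def by (simp add: algebra_simps)
        then have "\<bar>\<beta>' * ?m\<bar> \<le> \<bar>?dv * (\<beta>' * num w - \<beta> * num v)\<bar> + \<bar>real_of_int (num v) * (\<beta>' * den w - \<beta> * den v)\<bar>"
          by linarith
        also have "\<dots> \<le> ?dv * (D / M) + ?dv * (D / M)"
          unfolding abs_mult using y e1 e2 M0 D by (intro add_mono mult_mono) auto
        also have "?dv * (D / M) + ?dv * (D / M) = 2 * ?dv * (D / M)" by simp
        finally have bm: "\<bar>\<beta>'\<bar> * \<bar>?m\<bar> \<le> 2 * ?dv * (D / M)" by (simp only: abs_mult)
        have "\<bar>\<beta>'\<bar> * \<kappa> = (\<bar>\<beta>'\<bar> * \<bar>?m\<bar>) / (?dv * ?dw)" unfolding k by simp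
        also have "\<dots> \<le> (2 * ?dv * (D / M)) / (?dv * ?dw)" using bm dd by (intro divide_right_mono) auto
        also have "\<dots> = 2 * (D / M) / ?dw" using y(7) by simp
        also have "\<dots> \<le> 2 * (D / M) / (L / (2 * a0))"
          using y'(3) L0 a0_ge D M0 y'(7) by (intro divide_left_mono mult_pos_pos) auto
        also have "\<dots> = 4 * a0 * D / real N" unfolding NML[symmetric] using L0 M0 by (simp add: field_simps)
        finally have "real N * (\<bar>\<beta>'\<bar> * \<kappa>) \<le> real N * (4 * a0 * D / real N)" by (intro mult_left_mono) auto
        then have bk: "real N * (\<bar>\<beta>'\<bar> * \<kappa>) \<le> 4 * a0 * D" using N by simp
        \<comment> \<open>A large \<open>q\<close> is exploited through
          \<open>\<kappa> \<le> 1\<close>, a large \<beta>' through \<open>bk\<close>; estimating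
          the sum covers both without a case distinction.\<close>
        have "X \<le> ?Q * (1 + real N * \<bar>\<beta>'\<bar>)" using d'(6) sc(1) unfolding \<beta>'_def by simp
        then have "X * \<kappa> \<le> ?Q * (1 + real N * \<bar>\<beta>'\<bar>) * \<kappa>" unfolding \<kappa>_def by (intro mult_right_mono) auto
        also have "\<dots> = ?Q * (\<kappa> + real N * (\<bar>\<beta>'\<bar> * \<kappa>))" by (simp add: algebra_simps)
        also have "\<dots> \<le> ?Q * (D + 4 * a0 * D)" using d(3) k1 bk D by (intro mult_left_mono add_mono) auto
        also have "\<dots> = Cr * D * ?Q" by (simp add: Cr_def algebra_simps)
        finally have "\<kappa> \<le> Cr * D * ?Q / X" using X by (simp add: pos_le_divide_eq mult.commute)
        then have "\<kappa> \<le> r" using k1 by (simp add: r_def)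
        then show "w \<in> V" using s(2) sc(2) by (simp add: V_def \<kappa>_def)
      qed
      show "0 \<le> Ct * D" using Ct D by simp
      fix w assume w: "w \<in> V"
      then have wY: "w \<in> Yset L" by (simp add: V_def)
      note y' = YsetD[OF wY]
      define J where "J = {\<theta>' \<in> Z. close (D / M) (\<theta>, v) (\<theta>', w)}"
      have "inj_on fst {s \<in> ?S. snd s = w}" by (auto simp: inj_on_def prod_eq_iff)
      then have "card {s \<in> ?S. snd s = w} = card (fst ` {s \<in> ?S. snd s = w})" by (simp add: card_image)
      also have "\<dots> \<le> card J" using fin pv by (intro card_mono) (auto simp: J_def)
      finally have "real (card {s \<in> ?S. snd s = w}) \<le> real (card J)" by simp
      also have "\<dots> \<le> 3 * (2 * (4 * a0 * D / real N) * real (PN N) + 1)"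
      proof (rule card_grid_close_le[OF PN0])
        show "0 \<le> 4 * a0 * D / real N" using a0_ge D by simp
        show "J \<subseteq> grid (PN N)" using Zg by (auto simp: J_def)
        fix t t' assume t: "t \<in> J" "t' \<in> J"
        have tZ: "t \<in> Z" "t' \<in> Z" and tc: "close (D / M) (\<theta>, v) (t, w)" "close (D / M) (\<theta>, v) (t', w)"
          using t by (auto simp: J_def)
        note s1 = scd[OF tZ(1) wY[unfolded L_def] tc(1)] and s2 = scd[OF tZ(2) wY[unfolded L_def] tc(2)]
        define \<beta> where "\<beta> = t - aa t / qq t"
        define \<beta>' where "\<beta>' = t' - aa t' / qq t'"
        have "?q dvd (aa t * den w - aa \<theta> * den v) - (aa t' * den w - aa \<theta> * den v)" using s1(3) s2(3) by (rule dvd_diff)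
        then have a1: "?q dvd (aa t - aa t') * den w" by (simp add: algebra_simps)
        have "?q dvd (aa t * num w - aa \<theta> * num v) - (aa t' * num w - aa \<theta> * num v)" using s1(4) s2(4) by (rule dvd_diff)
        then have a2: "?q dvd (aa t - aa t') * num w" by (simp add: algebra_simps)
        \<comment> \<open>The vector of \<open>w\<close> is primitive, so \<open>q\<close> divides
          the difference of the numerators and the rational parts of \<open>t\<close> and
          \<open>t'\<close> agree modulo 1.\<close>
        obtain g h where gh: "g * den w + h * num w = 1" using coprime_den_num[of w] bezout_int[of "den w" "num w"] by auto
        have "g * ((aa t - aa t') * den w) + h * ((aa t - aa t') * num w) = (aa t - aa t') * (g * den w + h * num w)"
          by (simp add: algebra_simps)
        then have "g * ((aa t - aa t') * den w) + h * ((aa t - aa t') * num w) = aa t - aa t'" using gh by simp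
        moreover have "?q dvd g * ((aa t - aa t') * den w) + h * ((aa t - aa t') * num w)"
          by (rule dvd_add[OF dvd_mult[OF a1] dvd_mult[OF a2]])
        ultimately obtain n where n: "aa t - aa t' = ?q * n" by (auto elim: dvdE)
        have "real_of_int (aa t - aa t') = real_of_int (?q * n)" using n by (rule arg_cong)
        then have "real_of_int (aa t) / ?Q - real_of_int (aa t') / ?Q = of_int n" using d(3) by (simp add: field_simps)
        moreover have "t = aa t / ?Q + \<beta>" "t' = aa t' / ?Q + \<beta>'" using s1(1) s2(1) by (simp_all add: \<beta>_def \<beta>'_def)
        ultimately have "t - t' - of_int n = \<beta> - \<beta>'" by linarith
        then have "dnorm (t - t') \<le> \<bar>\<beta> - \<beta>'\<bar>" using dnorm_le[of "t - t'" n] by simp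
        also have "\<dots> \<le> 4 * a0 * D / real N"
        proof -
          have e1: "\<bar>\<beta> * den w - (\<theta> - aa \<theta> / qq \<theta>) * den v\<bar> \<le> D / M" using s1(5) unfolding \<beta>_def .
          have e2: "\<bar>\<beta>' * den w - (\<theta> - aa \<theta> / qq \<theta>) * den v\<bar> \<le> D / M" using s2(5) unfolding \<beta>'_def .
          have "\<bar>\<beta> * den w - \<beta>' * den w\<bar> \<le> 2 * (D / M)" using e1 e2 by linarith
          moreover have "\<beta> * den w - \<beta>' * den w = (\<beta> - \<beta>') * den w" by (simp add: algebra_simps)
          ultimately have "\<bar>\<beta> - \<beta>'\<bar> * den w \<le> 2 * (D / M)" using y'(7) by (simp add: abs_mult)
          moreover have "0 < real_of_int (den w)" using y'(7) by linarith
          ultimately have "\<bar>\<beta> - \<beta>'\<bar> \<le> 2 * (D / M) / den w" by (simp only: pos_le_divide_eq)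
          also have "\<dots> \<le> 2 * (D / M) / (L / (2 * a0))"
            using y'(3) L0 a0_ge D M0 y'(7) by (intro divide_left_mono mult_pos_pos) auto
          also have "\<dots> = 4 * a0 * D / real N" unfolding NML[symmetric] using L0 M0 by (simp add: field_simps)
          finally show ?thesis .
        qed
        finally show "dnorm (t - t') \<le> 4 * a0 * D / real N" .
      qed
      also have "\<dots> = 3 * (8 * a0 * (2 * a0 + 2) * D + 1)" unfolding PN_eq using N by (simp add: field_simps)
      also have "\<dots> \<le> Ct * D" using D by (simp add: Ct_def algebra_simps)
      finally show "real (card {s \<in> ?S. snd s = w}) \<le> Ct * D" .
    qed (use fin finV finite_Yset in auto)
    also have "\<dots> \<le> (Ct * D) * (Cw * (L / sqrt X) powr (2 * \<delta>) * r powr \<delta> * (X / ?Q))"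
    proof (intro mult_left_mono)
      have "X * (1 / X) \<le> Cr * D * ?Q"
        using X Cr D(1) d(3) mult_mono[OF Cr D(1)] mult_mono[of 1 "Cr * D" 1 ?Q] by simp
      then have "1 / X \<le> Cr * D * ?Q / X" using X by (simp add: divide_right_mono)
      then have r1: "1 / X \<le> r" using X by (simp add: r_def)
      show "real (card V) \<le> Cw * (L / sqrt X) powr (2 * \<delta>) * r powr \<delta> * (X / ?Q)"
        unfolding V_def using d LX by (intro Cw(2) X r1) (auto simp: r_def L_def M_def)
    qed (use Ct D in auto)
    also have "\<dots> \<le> (Ct * D) * (Cw * (L / sqrt X) powr (2 * \<delta>) * (Cr * D * ?Q / X) powr \<delta> * (X / ?Q))"
    proof -
      have "0 < r" unfolding r_def using Cr D X d(3) by simp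
      then have "r powr \<delta> \<le> (Cr * D * ?Q / X) powr \<delta>" using delta_nonneg by (intro powr_mono2) (auto simp: r_def)
      then show ?thesis using Ct D Cw(1) X d(3) by (intro mult_left_mono mult_right_mono) auto
    qed
    also have "\<dots> \<le> (Ct * D) * (Cw * (L powr (2 * \<delta>) * X powr (- \<delta>)) * (Cr powr \<delta> * D * X powr (1 - \<delta>)))"
    proof -
      have 1: "(L / sqrt X) powr (2 * \<delta>) = L powr (2 * \<delta>) * X powr (- \<delta>)"
      proof -
        have "sqrt X powr (2 * \<delta>) = X powr \<delta>" using X by (simp add: powr_half_sqrt[symmetric] powr_powr)
        then show ?thesis using L0 X by (simp add: powr_divide powr_minus_divide)
      qed
      have "(Cr * D * ?Q / X) powr \<delta> * (X / ?Q) = Cr powr \<delta> * D powr \<delta> * (?Q powr \<delta> / ?Q) * (X / X powr \<delta>)"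
        using Cr D X d(3) by (simp add: powr_mult powr_divide)
      \<comment> \<open>Since \<open>\<delta> \<le> 1\<close>,
        \<open>D powr \<delta> \<le> D\<close> and \<open>q powr (\<delta> - 1) \<le> 1\<close>. One
        factor \<open>D\<close> comes from here, the other from the number of frequencies.\<close>
      also have "\<dots> \<le> Cr powr \<delta> * D * 1 * (X / X powr \<delta>)"
      proof (intro mult_right_mono mult_mono)
        have "D powr \<delta> \<le> D powr 1" using D delta_le_1 by (intro powr_mono) auto
        then show "D powr \<delta> \<le> D" using D by simp
        have "?Q powr \<delta> \<le> ?Q powr 1" using d(3) delta_le_1 by (intro powr_mono) auto
        then show "?Q powr \<delta> / ?Q \<le> 1" using d(3) by simp
      qed (use Cr D X d(3) in auto)
      also have "\<dots> = Cr powr \<delta> * D * X powr (1 - \<delta>)" using X by (simp add: powr_diff)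
      finally have 2: "(Cr * D * ?Q / X) powr \<delta> * (X / ?Q) \<le> Cr powr \<delta> * D * X powr (1 - \<delta>)" .
      have "Cw * (L / sqrt X) powr (2 * \<delta>) * (Cr * D * ?Q / X) powr \<delta> * (X / ?Q)
          = Cw * (L / sqrt X) powr (2 * \<delta>) * ((Cr * D * ?Q / X) powr \<delta> * (X / ?Q))" by (simp only: mult.assoc)
      also have "\<dots> \<le> Cw * (L / sqrt X) powr (2 * \<delta>) * (Cr powr \<delta> * D * X powr (1 - \<delta>))"
        using Cw(1) by (intro mult_left_mono 2) auto
      finally have "Cw * (L / sqrt X) powr (2 * \<delta>) * (Cr * D * ?Q / X) powr \<delta> * (X / ?Q)
          \<le> Cw * (L / sqrt X) powr (2 * \<delta>) * (Cr powr \<delta> * D * X powr (1 - \<delta>))" .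
      then show ?thesis unfolding 1[symmetric] using Ct D by (intro mult_left_mono) auto
    qed
    also have "\<dots> = C * L powr (2 * \<delta>) * (X powr (- \<delta>) * X powr (1 - \<delta>)) * D\<^sup>2"
      unfolding C_def power2_eq_square by (simp only: mult_ac)
    also have "X powr (- \<delta>) * X powr (1 - \<delta>) = X powr (1 - 2 * \<delta>)" by (simp add: powr_add[symmetric])
    finally show ?thesis unfolding L_def M_def .
  qed
  have "C > 0" unfolding C_def using Ct Cw Cr by simp
  then show ?thesis by (intro exI[of _ C] conjI allI impI main)
qed

text \<open>The powers of \<open>X\<close> are \<open>8 - 8 * \<delta>\<close> from
  \<open>M powr (2 - 2 * \<delta>)\<close> and \<open>1 - 2 * \<delta>\<close> from the count, in
  total \<open>9 - 10 * \<delta> \<le> - 1 / 4\<close>. Half of this absorbs \<open>ln M\<close>;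
  the other half makes the sum over dyadic \<open>X\<close> converge.\<close>

lemma small_block_sum:
  assumes delta: "37 / 40 \<le> \<delta>"
  shows "\<exists>C>0. \<forall>N X aa qq Z. block N X aa qq Z \<longrightarrow> 0 < N \<longrightarrow> 1 \<le> X \<longrightarrow>
     2 * a0 * X \<le> real N / (C1 * X ^ 4) \<longrightarrow>
     (\<Sum>\<theta>\<in>Z. (norm (S N \<theta>))\<^sup>2) \<le> C * real N powr (4 * \<delta>) * X powr (- (1 / 8))"
proof -
  obtain Cs where Cs': "Cs > 0 \<and> (\<forall>N M Z A0. 0 < N \<longrightarrow> 1 \<le> M \<longrightarrow> M \<le> real N \<longrightarrow> finite Z \<longrightarrow> 0 \<le> A0 \<longrightarrow>
     (\<forall>p\<in>Z \<times> Yset (real N / M). \<forall>D. 1 \<le> D \<longrightarrow> D \<le> 2 * M \<longrightarrow>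
        real (card {q \<in> Z \<times> Yset (real N / M). close (D / M) p q}) \<le> A0 * D\<^sup>2) \<longrightarrow>
     (\<Sum>\<theta>\<in>Z. (norm (S N \<theta>))\<^sup>2) \<le> Cs * real N powr (2 * \<delta>) * M\<^sup>2 * (1 + ln M) * A0)"
    using large_sieve_S by (rule exE)
  note Cs = conjunct1[OF Cs'] conjunct2[OF Cs', rule_format]
  obtain Cm where Cm': "Cm > 0 \<and> (\<forall>N X aa qq Z D p. block N X aa qq Z \<longrightarrow> 0 < N \<longrightarrow> 1 \<le> X \<longrightarrow>
     2 * a0 * X \<le> real N / (C1 * X ^ 4) \<longrightarrow> 1 \<le> D \<longrightarrow> D \<le> X\<^sup>2 \<longrightarrow> p \<in> Z \<times> Yset (real N / (C1 * X ^ 4)) \<longrightarrow>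
     real (card {p' \<in> Z \<times> Yset (real N / (C1 * X ^ 4)). close (D / (C1 * X ^ 4)) p p'})
       \<le> Cm * (real N / (C1 * X ^ 4)) powr (2 * \<delta>) * X powr (1 - 2 * \<delta>) * D\<^sup>2)"
    using small_count_main by (rule exE)
  note Cm = conjunct1[OF Cm'] conjunct2[OF Cm', rule_format]
  obtain CY where CY: "CY > 0" "\<And>L. 1 \<le> L \<Longrightarrow> real (card (Yset L)) \<le> CY * L powr (2 * \<delta>)"
    using card_Yset_le by blast
  have C1ge: "1 \<le> C1" using a0_ge by (simp add: C1_def)
  define Ca where "Ca = Cm + 27 * (8 * a0 + 9) * CY"
  have Ca: "Ca > 0" unfolding Ca_def using Cm CY a0_ge by (intro add_pos_nonneg) auto
  define C where "C = Cs * Ca * C1 powr (2 - 2 * \<delta>) * (33 + ln C1)"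
  have main: "(\<Sum>\<theta>\<in>Z. (norm (S N \<theta>))\<^sup>2) \<le> C * real N powr (4 * \<delta>) * X powr (- (1 / 8))"
    if b: "block N X aa qq Z" and N: "0 < N" and X: "1 \<le> X" and LX: "2 * a0 * X \<le> real N / (C1 * X ^ 4)"
    for N X aa qq Z
  proof -
    define M where "M = C1 * X ^ 4"
    define L where "L = real N / M"
    have X4: "1 \<le> X ^ 4" using X by simp
    have M1: "1 \<le> M" unfolding M_def using mult_mono[OF C1ge X4] C1ge by simp
    have "1 * 1 \<le> 2 * a0 * X" using a0_ge X by (intro mult_mono) auto
    then have L1: "1 \<le> L" using LX by (simp add: L_def M_def)
    then have MN: "M \<le> real N" using M1 by (simp add: L_def pos_le_divide_eq)
    have fin: "finite Z" using b finite_grid finite_subset unfolding block_def by blast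
    define A0 where "A0 = Ca * L powr (2 * \<delta>) * X powr (1 - 2 * \<delta>)"
    have A0: "0 \<le> A0" unfolding A0_def using Ca by simp
    have cnt: "real (card {q \<in> Z \<times> Yset L. close (D / M) p q}) \<le> A0 * D\<^sup>2"
      if p: "p \<in> Z \<times> Yset L" and D: "1 \<le> D" for p D
    proof (cases "D \<le> X\<^sup>2")
      case True
      have "real (card {q \<in> Z \<times> Yset L. close (D / M) p q}) \<le> Cm * L powr (2 * \<delta>) * X powr (1 - 2 * \<delta>) * D\<^sup>2"
        using Cm(2)[OF b N X LX D True] p unfolding L_def M_def by blast
      also have "\<dots> \<le> A0 * D\<^sup>2"
        unfolding A0_def Ca_def using CY a0_ge by (intro mult_right_mono) auto
      finally show ?thesis .
    next
      \<comment> \<open>Here the trivial count \<open>O(X ^ 3 * L powr (2 * \<delta>))\<close>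
        suffices, because \<open>X ^ 4 \<le> D\<^sup>2\<close> and
        \<open>3 \<le> 1 - 2 * \<delta> + 4\<close>.\<close>
      case False
      have "card {q \<in> Z \<times> Yset L. close (D / M) p q} \<le> card (Z \<times> Yset L)"
        using fin finite_Yset by (intro card_mono) auto
      then have "real (card {q \<in> Z \<times> Yset L. close (D / M) p q}) \<le> real (card (Z \<times> Yset L))" by simp
      also have "\<dots> = real (card Z) * real (card (Yset L))" by (simp only: card_cartesian_product of_nat_mult)
      also have "\<dots> \<le> (27 * (8 * a0 + 9) * X ^ 3) * (CY * L powr (2 * \<delta>))"
        using card_block_le[OF b N X] CY(2)[OF L1] a0_ge X by (intro mult_mono) auto
      also have "\<dots> = 27 * (8 * a0 + 9) * CY * L powr (2 * \<delta>) * X ^ 3" by (simp only: mult_ac)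
      also have "\<dots> \<le> 27 * (8 * a0 + 9) * CY * L powr (2 * \<delta>) * (X powr (1 - 2 * \<delta>) * D\<^sup>2)"
      proof (intro mult_left_mono)
        have "X ^ 3 = X powr 3" using X by (simp add: powr_numeral)
        also have "\<dots> \<le> X powr (1 - 2 * \<delta> + 4)" using X delta_le_1 by (intro powr_mono) auto
        also have "\<dots> = X powr (1 - 2 * \<delta>) * X ^ 4" unfolding powr_add using X by (simp add: powr_numeral)
        also have "X ^ 4 = (X\<^sup>2)\<^sup>2" by (simp add: power_mult[symmetric])
        also have "X powr (1 - 2 * \<delta>) * (X\<^sup>2)\<^sup>2 \<le> X powr (1 - 2 * \<delta>) * D\<^sup>2"
          using False by (intro mult_left_mono power_mono) auto
        finally show "X ^ 3 \<le> X powr (1 - 2 * \<delta>) * D\<^sup>2" .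
      qed (use CY a0_ge in auto)
      also have "\<dots> = (27 * (8 * a0 + 9) * CY) * L powr (2 * \<delta>) * X powr (1 - 2 * \<delta>) * D\<^sup>2" by (simp only: mult_ac)
      also have "\<dots> \<le> A0 * D\<^sup>2"
        unfolding A0_def Ca_def using Cm by (intro mult_right_mono) auto
      finally show ?thesis .
    qed
    have "(\<Sum>\<theta>\<in>Z. (norm (S N \<theta>))\<^sup>2) \<le> Cs * real N powr (2 * \<delta>) * M\<^sup>2 * (1 + ln M) * A0"
      using cnt by (intro Cs(2)[OF N M1 MN fin A0]) (auto simp: L_def)
    also have "\<dots> = Cs * Ca * real N powr (2 * \<delta>) * (M\<^sup>2 * L powr (2 * \<delta>)) * X powr (1 - 2 * \<delta>) * (1 + ln M)"
      unfolding A0_def by (simp only: mult_ac)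
    also have "M\<^sup>2 * L powr (2 * \<delta>) = real N powr (2 * \<delta>) * M powr (2 - 2 * \<delta>)"
      unfolding L_def using M1 N by (simp add: powr_divide powr_diff powr_numeral)
    also have "M powr (2 - 2 * \<delta>) = C1 powr (2 - 2 * \<delta>) * X powr (8 - 8 * \<delta>)"
    proof -
      have "X ^ 4 = X powr 4" using X by (simp add: powr_numeral)
      then have "(X ^ 4) powr (2 - 2 * \<delta>) = X powr (8 - 8 * \<delta>)" by (simp add: powr_powr)
      then show ?thesis unfolding M_def using C1ge X by (simp add: powr_mult)
    qed
    also have "Cs * Ca * real N powr (2 * \<delta>) * (real N powr (2 * \<delta>) * (C1 powr (2 - 2 * \<delta>) * X powr (8 - 8 * \<delta>)))
          * X powr (1 - 2 * \<delta>) * (1 + ln M)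
        = (Cs * Ca * C1 powr (2 - 2 * \<delta>)) * (real N powr (2 * \<delta>) * real N powr (2 * \<delta>)) *
          ((X powr (8 - 8 * \<delta>) * X powr (1 - 2 * \<delta>)) * (1 + ln M))" by (simp only: mult_ac)
    also have "real N powr (2 * \<delta>) * real N powr (2 * \<delta>) = real N powr (4 * \<delta>)" by (simp add: powr_add[symmetric])
    also have "X powr (8 - 8 * \<delta>) * X powr (1 - 2 * \<delta>) = X powr (9 - 10 * \<delta>)" by (simp add: powr_add[symmetric])
    also have "(Cs * Ca * C1 powr (2 - 2 * \<delta>)) * real N powr (4 * \<delta>) * (X powr (9 - 10 * \<delta>) * (1 + ln M))
        \<le> (Cs * Ca * C1 powr (2 - 2 * \<delta>)) * real N powr (4 * \<delta>) * (X powr (- (1 / 4)) * ((33 + ln C1) * X powr (1 / 8)))"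
    proof (intro mult_left_mono mult_mono)
      show "X powr (9 - 10 * \<delta>) \<le> X powr (- (1 / 4))" using X delta by (intro powr_mono) auto
      have lnX: "ln X \<le> X powr (1 / 8) / (1 / 8)" using X by (intro ln_powr_bound) auto
      have lC: "0 \<le> ln C1" using C1ge by simp
      have X8: "1 \<le> X powr (1 / 8)" using X by (intro ge_one_powr_ge_zero) auto
      have "ln M = ln C1 + 4 * ln X" unfolding M_def using C1ge X by (simp add: ln_mult ln_realpow)
      then have "1 + ln M \<le> (1 + ln C1) * 1 + 32 * X powr (1 / 8)" using lnX by simp
      also have "\<dots> \<le> (1 + ln C1) * X powr (1 / 8) + 32 * X powr (1 / 8)"
        using lC X8 by (intro add_right_mono mult_left_mono) auto
      also have "\<dots> = (33 + ln C1) * X powr (1 / 8)" by (simp add: algebra_simps)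
      finally show "1 + ln M \<le> (33 + ln C1) * X powr (1 / 8)" .
      show "0 \<le> 1 + ln M" using M1 by (simp add: add_nonneg_nonneg)
    qed (use Cs Ca in auto)
    also have "\<dots> = C * real N powr (4 * \<delta>) * (X powr (- (1 / 4)) * X powr (1 / 8))" unfolding C_def by (simp only: mult_ac)
    also have "X powr (- (1 / 4)) * X powr (1 / 8) = X powr (- (1 / 8))" by (simp add: powr_add[symmetric])
    finally show ?thesis .
  qed
  have "C > 0" unfolding C_def using Cs Ca C1ge by (intro mult_pos_pos add_pos_nonneg) auto
  then show ?thesis by (intro exI[of _ C] conjI allI impI main)
qed

end

section \<open>Generic frequencies\<close>

lemma nump_le_den: "0 \<notin> set w \<Longrightarrow> nump w \<le> den w"
proof (cases w)
  case (Cons a v)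
  assume w: "0 \<notin> set w"
  then have "denp v \<le> den v" using Cons by (intro denp_le_den) auto
  moreover have "den v \<le> den w" using num_le_den[OF w] Cons by simp
  ultimately show ?thesis using Cons by simp
qed simp

text \<open>The bounds on \<eta> and \<open>\<bar>\<beta>\<bar> * B\<close> put
  \<open>a * m / q\<close> within less than \<open>1 / q\<close> of an integer, so
  \<open>q dvd m\<close>. The rational part of \<theta>m is then an integer, and
  \<open>dnorm (\<theta> * m) = \<bar>\<beta> * m\<bar>\<close>. The assumption on \<open>K\<close>
  bounds the quotient of \<open>m\<close> by \<open>q\<close>.\<close>

lemma card_multiples_near_le:
  fixes \<theta> \<beta> B \<eta> K :: real and a q :: int
  assumes cop: "coprime a q" and q: "0 < q" and \<theta>: "\<theta> = a / q + \<beta>"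
    and eta: "\<eta> \<le> 1 / (8 * real_of_int q)" and bB: "\<bar>\<beta>\<bar> * B \<le> 1 / (8 * real_of_int q)"
    and K: "\<And>m::int. \<bar>real_of_int m\<bar> \<le> B \<Longrightarrow> \<bar>\<beta> * m\<bar> \<le> \<eta> \<Longrightarrow> \<bar>real_of_int m\<bar> \<le> q * K" and K0: "0 \<le> K"
  shows "finite {m::int. \<bar>real_of_int m\<bar> \<le> B \<and> dnorm (\<theta> * m) \<le> \<eta>}"
    "real (card {m::int. \<bar>real_of_int m\<bar> \<le> B \<and> dnorm (\<theta> * m) \<le> \<eta>}) \<le> 2 * K + 1"
proof -
  let ?S = "{m::int. \<bar>real_of_int m\<bar> \<le> B \<and> dnorm (\<theta> * m) \<le> \<eta>}" and ?q = "real_of_int q"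
  have q1: "1 \<le> ?q" using q by simp
  let ?I = "{n::int. - K \<le> n \<and> n \<le> K}"
  have ge: "- K \<le> K + 1" using K0 by simp
  have sub: "?S \<subseteq> (\<lambda>k. q * k) ` ?I"
  proof
    fix m assume "m \<in> ?S"
    then have mB: "\<bar>real_of_int m\<bar> \<le> B" and dm: "dnorm (\<theta> * m) \<le> \<eta>" by auto
    have "\<bar>\<beta> * m\<bar> \<le> \<bar>\<beta>\<bar> * B" unfolding abs_mult using mB by (intro mult_left_mono) auto
    then have bm: "\<bar>\<beta> * m\<bar> \<le> 1 / (8 * ?q)" using bB by linarith
    have "dnorm (a / q * m) = dnorm (\<theta> * m - \<beta> * m)" unfolding \<theta> by (simp add: algebra_simps)
    also have "\<dots> \<le> dnorm (\<theta> * m) + dnorm (\<beta> * m)" by (rule dnorm_diff_le)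
    also have "\<dots> \<le> 1 / (8 * ?q) + 1 / (8 * ?q)" using dm eta bm dnorm_le[of "\<beta> * m" 0] by (intro add_mono) auto
    also have "\<dots> < 1 / ?q" using q1 by (simp add: field_simps)
    finally have lt: "dnorm (a / q * m) < 1 / ?q" .
    obtain n where n: "dnorm (a / q * m) = \<bar>a / q * m - of_int n\<bar>" by (rule dnormE)
    have e: "a / q * m - of_int n = real_of_int (a * m - q * n) / ?q" using q1 by (simp add: field_simps)
    have "\<bar>a / q * m - of_int n\<bar> = \<bar>real_of_int (a * m - q * n)\<bar> / ?q" unfolding e using q1 by simp
    then have "\<bar>real_of_int (a * m - q * n)\<bar> / ?q < 1 / ?q" using lt n by simp
    then have "\<bar>real_of_int (a * m - q * n)\<bar> < 1" using q1 by (simp add: divide_less_cancel)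
    then have "a * m = q * n" by linarith
    then have "q dvd a * m" by simp
    then have "q dvd m" using cop by (simp add: coprime_commute coprime_dvd_mult_right_iff)
    then obtain k where k: "m = q * k" by blast
    have "\<theta> * m = \<beta> * m + of_int (a * k)" unfolding \<theta> k using q1 by (simp add: field_simps)
    then have "dnorm (\<beta> * m) \<le> dnorm (\<theta> * m)" using dnorm_add_int[of "\<theta> * m" "- (a * k)"] by simp
    moreover have "dnorm (\<beta> * m) = \<bar>\<beta> * m\<bar>"
    proof (rule dnorm_small)
      have "1 / (8 * ?q) \<le> 1 / 8" using q1 by (simp add: field_simps)
      then show "\<bar>\<beta> * m\<bar> \<le> 1 / 2" using bm by linarith
    qed
    ultimately have "\<bar>\<beta> * m\<bar> \<le> \<eta>" using dm by linarith
    then have "\<bar>real_of_int m\<bar> \<le> ?q * K" by (rule K[OF mB])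
    then have "?q * \<bar>real_of_int k\<bar> \<le> ?q * K" unfolding k using q1 by (simp add: abs_mult)
    then have "\<bar>real_of_int k\<bar> \<le> K" using q1 by simp
    then have "k \<in> ?I" by (simp add: abs_le_iff)
    then show "m \<in> (\<lambda>k. q * k) ` ?I" using k by blast
  qed
  have finI: "finite ?I" by (rule card_int_between_le(1)[OF ge])
  show "finite ?S" using sub finI by (meson finite_imageI finite_subset)
  have "card ?S \<le> card ((\<lambda>k. q * k) ` ?I)" using finI by (intro card_mono sub) auto
  also have "\<dots> \<le> card ?I" by (rule card_image_le[OF finI])
  finally have "real (card ?S) \<le> real (card ?I)" by simp
  also have "\<dots> \<le> K - - K + 1" by (rule card_int_between_le(2)[OF ge])
  finally show "real (card ?S) \<le> 2 * K + 1" by simp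
qed

context critical_alphabet
begin

text \<open>The parameter \<open>n\<close> stands for \<open>N\<^bsup>1/100\<^esup>\<close>, which makes all exponents natural numbers.\<close>

definition generic :: "nat \<Rightarrow> real \<Rightarrow> real \<Rightarrow> (real \<Rightarrow> int) \<Rightarrow> (real \<Rightarrow> int) \<Rightarrow> real set \<Rightarrow> bool" where
  "generic N n T aa qq Z \<longleftrightarrow> Z \<subseteq> grid (PN N) \<and> (\<forall>\<theta>\<in>Z. 0 < qq \<theta> \<and> coprime (aa \<theta>) (qq \<theta>) \<and>
     real_of_int (qq \<theta>) \<le> T \<and> \<bar>\<theta> - aa \<theta> / qq \<theta>\<bar> \<le> 1 / (qq \<theta> * T) \<and>
     n ^ 16 \<le> qq \<theta> * (1 + real N * \<bar>\<theta> - aa \<theta> / qq \<theta>\<bar>))"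

text \<open>\<theta>' cancels when the two coordinates are combined with coefficients
  \<open>den w\<close> and \<open>- num w\<close>; what remains is \<theta> times the
  determinant.\<close>

lemma dnorm_wg_le:
  fixes \<theta> \<theta>' \<epsilon> :: real
  assumes "close \<epsilon> (\<theta>, v) (\<theta>', w)" "0 \<notin> set w"
  shows "dnorm (\<theta> * wg v w) \<le> 2 * den w * \<epsilon>"
proof -
  let ?x = "\<theta>' * den w - \<theta> * den v" and ?y = "\<theta>' * num w - \<theta> * num v"
  have e: "dnorm ?x \<le> \<epsilon>" "dnorm ?y \<le> \<epsilon>" using assms(1) by (auto simp: close_def)
  have nn: "0 \<le> real_of_int (num w)" "real_of_int (num w) \<le> real_of_int (den w)"
    using num_nonneg[of w] num_le_den[OF assms(2)] by auto
  have "\<theta> * wg v w = of_int (den w) * ?y - of_int (num w) * ?x" by (simp add: wg_def algebra_simps)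
  then have "dnorm (\<theta> * wg v w) \<le> dnorm (of_int (den w) * ?y) + dnorm (of_int (num w) * ?x)"
    using dnorm_diff_le[of "of_int (den w) * ?y" "of_int (num w) * ?x"] by simp
  also have "\<dots> \<le> \<bar>of_int (den w)\<bar> * dnorm ?y + \<bar>of_int (num w)\<bar> * dnorm ?x"
    by (intro add_mono dnorm_mult_le)
  also have "\<dots> \<le> real_of_int (den w) * \<epsilon> + real_of_int (den w) * \<epsilon>"
    using e nn dnorm_nonneg by (intro add_mono mult_mono) auto
  also have "\<dots> = 2 * den w * \<epsilon>" by simp
  finally show ?thesis .
qed

text \<open>Inverting the unimodular matrix of \<open>w\<close> gives the crude bound
  \<open>dnorm t \<le> 2 * Y * \<epsilon>\<close>. Consequently the residue of \<open>t\<close>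
  times \<open>den w\<close> is at most 1/2 in modulus, no wrap-around occurs, and the first
  coordinate alone yields the sharper bound.\<close>

lemma dnorm_diff_small:
  fixes t \<epsilon> Y :: real
  assumes w: "0 \<notin> set w" and e: "dnorm (t * den w) \<le> \<epsilon>" "dnorm (t * num w) \<le> \<epsilon>"
    and Y: "real_of_int (den w) \<le> Y" "2 * Y\<^sup>2 * \<epsilon> \<le> 1 / 2"
  shows "dnorm t * den w \<le> \<epsilon>"
proof -
  have d1: "1 \<le> real_of_int (den w)" using den_pos[OF w] by simp
  have e0: "0 \<le> \<epsilon>" using e(1) dnorm_nonneg[of "t * den w"] by linarith
  have nn: "0 \<le> real_of_int (nump w)" "real_of_int (nump w) \<le> Y" "0 \<le> real_of_int (denp w)" "real_of_int (denp w) \<le> Y"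
    using nump_nonneg[of w] denp_nonneg[of w] nump_le_den[OF w] denp_le_den[OF w] Y(1) by auto
  have "of_int (nump w) * (t * den w) - of_int (denp w) * (t * num w) = t * real_of_int (den w * nump w - denp w * num w)"
    by (simp add: algebra_simps)
  also have "\<dots> = t * (- 1) ^ length w" unfolding continuant_det by simp
  finally have "dnorm (of_int (nump w) * (t * den w) - of_int (denp w) * (t * num w)) = dnorm t"
    using dnorm_minus[of t] by (cases "even (length w)") auto
  then have "dnorm t \<le> dnorm (of_int (nump w) * (t * den w)) + dnorm (of_int (denp w) * (t * num w))"
    using dnorm_diff_le[of "of_int (nump w) * (t * den w)" "of_int (denp w) * (t * num w)"] by simp
  also have "\<dots> \<le> \<bar>of_int (nump w)\<bar> * dnorm (t * den w) + \<bar>of_int (denp w)\<bar> * dnorm (t * num w)"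
    by (intro add_mono dnorm_mult_le)
  also have "\<dots> \<le> Y * \<epsilon> + Y * \<epsilon>" using e nn dnorm_nonneg by (intro add_mono mult_mono) auto
  finally have dt: "dnorm t \<le> 2 * Y * \<epsilon>" by simp
  obtain k where k: "dnorm t = \<bar>t - of_int k\<bar>" by (rule dnormE)
  have "\<bar>(t - of_int k) * den w\<bar> = dnorm t * den w" using k d1 by (simp add: abs_mult)
  also have "\<dots> \<le> (2 * Y * \<epsilon>) * Y" using dt Y(1) d1 dnorm_nonneg[of t] e0 by (intro mult_mono) auto
  also have "\<dots> \<le> 1 / 2" using Y(2) by (simp add: power2_eq_square mult_ac)
  finally have "dnorm ((t - of_int k) * den w) = \<bar>(t - of_int k) * den w\<bar>" by (rule dnorm_small)
  moreover have "dnorm ((t - of_int k) * den w) \<le> dnorm (t * den w)"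
    using dnorm_add_int[of "t * den w" "- (k * den w)"] by (simp add: algebra_simps)
  ultimately show ?thesis using e(1) k d1 by (simp add: abs_mult)
qed

text \<open>A close pair yields a determinant \<open>m\<close> of size \<open>O(n ^ 40)\<close> with
  \<theta>m near an integer. There are \<open>O(n ^ 24 * D)\<close> such \<open>m\<close>, the
  saving \<open>n ^ 16\<close> being the lower bound for \<open>X\<close>; each \<open>m\<close>
  belongs to boundedly many \<open>w\<close>, and each \<open>w\<close> to \<open>O(D)\<close>
  frequencies.\<close>

lemma generic_count:
  "\<exists>C n0. C > 0 \<and> (\<forall>N n T aa qq Z D p. generic N n T aa qq Z \<longrightarrow> 1 \<le> n \<longrightarrow> n0 \<le> n \<longrightarrow> real N = n ^ 100 \<longrightarrow>
     n ^ 41 \<le> T \<longrightarrow> T \<le> n ^ 43 \<longrightarrow> 1 \<le> D \<longrightarrow> p \<in> Z \<times> Yset (n ^ 20) \<longrightarrow>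
     real (card {p' \<in> Z \<times> Yset (n ^ 20). close (D / n ^ 80) p p'}) \<le> C * n ^ 24 * D\<^sup>2)"
proof -
  obtain CY where CY: "CY > 0" "\<And>L. 1 \<le> L \<Longrightarrow> real (card (Yset L)) \<le> CY * L powr (2 * \<delta>)"
    using card_Yset_le by blast
  define Y0 where "Y0 = 2 * a0 + 1"
  have Y0: "1 \<le> Y0" using a0_ge by (simp add: Y0_def)
  have Y02: "1 \<le> Y0\<^sup>2" "Y0 \<le> Y0\<^sup>2" using Y0 by (auto intro: one_le_power self_le_power)
  define n0 where "n0 = 16 * Y0\<^sup>2"
  define Ct where "Ct = 3 * (8 * a0 * (2 * a0 + 2) + 1)"
  define C5 where "C5 = 2 * (4 * a0 * (2 * a0 + 1) + 1)"
  have Ct: "Ct > 0" using a0_ge by (simp add: Ct_def add_nonneg_pos)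
  have C5: "C5 > 0" using a0_ge by (simp add: C5_def add_nonneg_pos)
  define Ca where "Ca = Ct * (C5 * (9 * Y0\<^sup>2))"
  define Cb where "Cb = CY * (6 * (2 * a0 + 2) + 3 * Y0) * (8 * Y0\<^sup>2)"
  have Ca: "Ca > 0" unfolding Ca_def using Ct C5 Y0 by simp
  have Cb: "Cb > 0" unfolding Cb_def using CY Y0 a0_ge by (intro mult_pos_pos add_pos_pos) auto
  have main: "real (card {p' \<in> Z \<times> Yset (n ^ 20). close (D / n ^ 80) p p'}) \<le> (Ca + Cb) * n ^ 24 * D\<^sup>2"
    if g: "generic N n T aa qq Z" and n1: "1 \<le> n" and nn0: "n0 \<le> n" and N: "real N = n ^ 100"
      and T: "n ^ 41 \<le> T" "T \<le> n ^ 43" and D: "1 \<le> D" and p: "p \<in> Z \<times> Yset (n ^ 20)"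
    for N n T aa qq Z D p
  proof -
    define L where "L = n ^ 20"
    define M where "M = n ^ 80"
    have LM: "L \<ge> 1" "M \<ge> 1" using n1 by (auto simp: L_def M_def)
    have NLM: "real N = M * L" using N by (simp add: L_def M_def power_add[symmetric])
    have "0 < real N" unfolding N using n1 by simp
    then have N0: "0 < N" by simp
    have PN0: "0 < PN N" using N0 by (simp add: PN_def)
    have Zg: "Z \<subseteq> grid (PN N)" using g by (simp add: generic_def)
    have fin: "finite Z" using Zg finite_grid finite_subset by blast
    obtain \<theta> v where pv: "p = (\<theta>, v)" "\<theta> \<in> Z" "v \<in> Yset L" using p by (auto simp: L_def)
    note y = YsetD[OF pv(3)]
    let ?S = "{p' \<in> Z \<times> Yset L. close (D / M) p p'}"
    have finS: "finite ?S" using fin finite_Yset by auto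
    have injf: "real (card {s \<in> ?S. snd s = w}) \<le> real (card {\<theta>' \<in> Z. close (D / M) (\<theta>, v) (\<theta>', w)})" for w
    proof -
      have "inj_on fst {s \<in> ?S. snd s = w}" by (auto simp: inj_on_def prod_eq_iff)
      then have "card {s \<in> ?S. snd s = w} = card (fst ` {s \<in> ?S. snd s = w})" by (simp add: card_image)
      also have "\<dots> \<le> card {\<theta>' \<in> Z. close (D / M) (\<theta>, v) (\<theta>', w)}" using fin pv by (intro card_mono) auto
      finally show ?thesis by simp
    qed
    show ?thesis
    \<comment> \<open>This threshold is the condition under which \<open>dnorm_diff_small\<close>
      applies with tolerance \<open>2 * (D / M)\<close> and \<open>Y = Y0 * L\<close>. Above it a
      single coordinate is enough: \<open>O(L * D)\<close> frequencies for each of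
      \<open>O(L\<^sup>2)\<close> tails, and \<open>L ^ 3 = n ^ 60\<close> is below
      \<open>n ^ 24 * n ^ 40\<close>.\<close>
    proof (cases "8 * Y0\<^sup>2 * D \<le> n ^ 40")
      case False
      have "real (card ?S) \<le> (6 * (D / M) * real (PN N) + 3 * (Y0 * L)) * real (card (Yset L))"
      proof (rule card_le_fibres'[where f = snd])
        show "snd ` ?S \<subseteq> Yset L" by auto
        show "0 \<le> 6 * (D / M) * real (PN N) + 3 * (Y0 * L)" using D LM Y0 by simp
        fix w assume w: "w \<in> Yset L"
        note y' = YsetD[OF w]
        have d1: "1 \<le> den w" using y'(7) by simp
        have "card {\<theta>' \<in> Z. close (D / M) (\<theta>, v) (\<theta>', w)} \<le> card {\<theta>' \<in> grid (PN N). dnorm (\<theta>' * of_int (den w) - \<theta> * den v) \<le> D / M}"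
          using Zg finite_grid by (intro card_mono) (auto simp: close_def)
        then have "real (card {\<theta>' \<in> Z. close (D / M) (\<theta>, v) (\<theta>', w)}) \<le> real (card {\<theta>' \<in> grid (PN N). dnorm (\<theta>' * of_int (den w) - \<theta> * den v) \<le> D / M})"
          by simp
        also have "\<dots> \<le> 6 * (D / M) * real (PN N) + 3 * of_int (den w)"
          using D LM by (intro card_grid_linear_le PN0 d1) auto
        also have "\<dots> \<le> 6 * (D / M) * real (PN N) + 3 * (Y0 * L)" using y'(4) by (simp add: Y0_def)
        finally show "real (card {s \<in> ?S. snd s = w}) \<le> 6 * (D / M) * real (PN N) + 3 * (Y0 * L)" using injf[of w] by linarith
      qed (use finS finite_Yset in auto)
      also have "(D / M) * real (PN N) = (2 * a0 + 2) * L * D" unfolding PN_eq NLM using LM by simp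
      then have "6 * (D / M) * real (PN N) + 3 * (Y0 * L) = 6 * ((2 * a0 + 2) * L * D) + 3 * (Y0 * L)" by simp
      also have "\<dots> * real (card (Yset L)) \<le> ((6 * (2 * a0 + 2) + 3 * Y0) * (L * D)) * (CY * L\<^sup>2)"
      proof (intro mult_mono)
        have "Y0 * L * 1 \<le> Y0 * L * D" using Y0 LM D by (intro mult_left_mono) auto
        then show "6 * ((2 * a0 + 2) * L * D) + 3 * (Y0 * L) \<le> (6 * (2 * a0 + 2) + 3 * Y0) * (L * D)"
          by (simp add: algebra_simps)
        have "real (card (Yset L)) \<le> CY * L powr (2 * \<delta>)" by (rule CY(2)[OF LM(1)])
        also have "\<dots> \<le> CY * L powr 2" using CY LM delta_le_1 by (intro mult_left_mono powr_mono) auto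
        also have "\<dots> = CY * L\<^sup>2" using LM by (simp add: powr_numeral)
        finally show "real (card (Yset L)) \<le> CY * L\<^sup>2" .
      qed (use a0_ge LM D Y0 CY in auto)
      also have "\<dots> = (CY * (6 * (2 * a0 + 2) + 3 * Y0)) * (L ^ 3 * D)" by (simp add: power2_eq_square power3_eq_cube mult_ac)
      also have "\<dots> \<le> (CY * (6 * (2 * a0 + 2) + 3 * Y0)) * ((8 * Y0\<^sup>2) * n ^ 24 * D\<^sup>2)"
      proof (intro mult_left_mono)
        have "L ^ 3 = n ^ 60" by (simp add: L_def power_mult[symmetric])
        also have "\<dots> \<le> n ^ 64" using n1 by (intro power_increasing) auto
        also have "\<dots> = n ^ 24 * n ^ 40" by (simp add: power_add[symmetric])
        also have "\<dots> \<le> n ^ 24 * (8 * Y0\<^sup>2 * D)" using False n1 by (intro mult_left_mono) auto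
        finally have "L ^ 3 * D \<le> n ^ 24 * (8 * Y0\<^sup>2 * D) * D" using D by (intro mult_right_mono) auto
        then show "L ^ 3 * D \<le> (8 * Y0\<^sup>2) * n ^ 24 * D\<^sup>2" by (simp add: power2_eq_square mult_ac)
      qed (use CY a0_ge Y0 in auto)
      also have "\<dots> = Cb * n ^ 24 * D\<^sup>2" unfolding Cb_def by (simp only: mult_ac)
      also have "\<dots> \<le> (Ca + Cb) * n ^ 24 * D\<^sup>2" using Ca n1 by (intro mult_right_mono) auto
      finally show ?thesis unfolding L_def M_def .
    next
      case True
      define V where "V = {w \<in> Yset L. \<exists>\<theta>'\<in>Z. close (D / M) (\<theta>, v) (\<theta>', w)}"
      have finV: "finite V" unfolding V_def using finite_Yset by simp
      define B where "B = Y0\<^sup>2 * L\<^sup>2"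
      define \<eta> where "\<eta> = 2 * (Y0 * L) * (D / M)"
      define Ms where "Ms = {m::int. \<bar>real_of_int m\<bar> \<le> B \<and> dnorm (\<theta> * m) \<le> \<eta>}"
      have L2: "L\<^sup>2 = n ^ 40" by (simp add: L_def power_mult[symmetric])
      have B1: "1 \<le> B" unfolding B_def using mult_mono[of 1 "Y0\<^sup>2" 1 "L\<^sup>2"] Y02 LM by simp
      have VB: "\<bar>real_of_int (wg v w)\<bar> \<le> B \<and> dnorm (\<theta> * wg v w) \<le> \<eta>" if w: "w \<in> V" for w
      proof
        obtain \<theta>' where t: "w \<in> Yset L" "close (D / M) (\<theta>, v) (\<theta>', w)" using w by (auto simp: V_def)
        note y' = YsetD[OF t(1)]
        have "\<bar>wg v w\<bar> \<le> den v * den w" by (rule abs_wg_le[OF y(2) y'(2)])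
        then have "real_of_int \<bar>wg v w\<bar> \<le> real_of_int (den v * den w)" by (simp only: of_int_le_iff)
        then have "\<bar>real_of_int (wg v w)\<bar> \<le> real_of_int (den v) * real_of_int (den w)" by simp
        also have "\<dots> \<le> (Y0 * L) * (Y0 * L)" using y y' Y0 LM unfolding Y0_def by (intro mult_mono) auto
        finally show "\<bar>real_of_int (wg v w)\<bar> \<le> B" by (simp add: B_def power2_eq_square mult_ac)
        have "dnorm (\<theta> * wg v w) \<le> 2 * den w * (D / M)" by (rule dnorm_wg_le[OF t(2) y'(2)])
        also have "\<dots> \<le> \<eta>" unfolding \<eta>_def using y'(4) D LM by (intro mult_right_mono) (auto simp: Y0_def)
        finally show "dnorm (\<theta> * wg v w) \<le> \<eta>" .
      qed
      have q: "0 < qq \<theta>" "coprime (aa \<theta>) (qq \<theta>)" "real_of_int (qq \<theta>) \<le> T"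
        "\<bar>\<theta> - aa \<theta> / qq \<theta>\<bar> \<le> 1 / (qq \<theta> * T)" "n ^ 16 \<le> qq \<theta> * (1 + real N * \<bar>\<theta> - aa \<theta> / qq \<theta>\<bar>)"
        using g pv(2) unfolding generic_def by blast+
      let ?q = "real_of_int (qq \<theta>)"
      define \<beta> where "\<beta> = \<theta> - aa \<theta> / qq \<theta>"
      have q1: "1 \<le> ?q" using q(1) by simp
      have Ms: "finite Ms \<and> real (card Ms) \<le> 9 * Y0\<^sup>2 * n ^ 24 * D"
      proof (cases "D \<le> n ^ 16")
        case False
        let ?I = "{m::int. - B \<le> m \<and> m \<le> B}"
        have ge: "- B \<le> B + 1" using B1 by simp
        have sub: "Ms \<subseteq> ?I" unfolding Ms_def by (auto simp: abs_le_iff)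
        have finI: "finite ?I" by (rule card_int_between_le(1)[OF ge])
        have "real (card Ms) \<le> real (card ?I)" using card_mono[OF finI sub] by simp
        also have "\<dots> \<le> B - - B + 1" by (rule card_int_between_le(2)[OF ge])
        also have "\<dots> \<le> 9 * B" using B1 by linarith
        also have "\<dots> = 9 * Y0\<^sup>2 * (n ^ 24 * n ^ 16)" unfolding B_def L2 by (simp add: power_add[symmetric])
        also have "\<dots> \<le> 9 * Y0\<^sup>2 * (n ^ 24 * D)" using False n1 by (intro mult_left_mono) auto
        finally show ?thesis using finite_subset[OF sub finI] by (simp add: mult.assoc)
      next
        case True
        define K where "K = 3 * Y0\<^sup>2 * n ^ 24 * D"
        have K0: "1 \<le> K"
        proof -
          have "1 * 1 \<le> 3 * Y0\<^sup>2" using Y02 by simp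
          then have "1 * 1 \<le> 3 * Y0\<^sup>2 * n ^ 24" using n1 by (intro mult_mono) auto
          then have "1 * 1 \<le> 3 * Y0\<^sup>2 * n ^ 24 * D" using D by (intro mult_mono) auto
          then show ?thesis by (simp add: K_def)
        qed
        have "0 < n ^ 41" using n1 by simp
        then have T0: "0 < T" using T(1) by linarith
        have th: "\<theta> = aa \<theta> / qq \<theta> + \<beta>" by (simp add: \<beta>_def)
        \<comment> \<open>Uses \<open>q \<le> T \<le> n ^ 43\<close>: the exponents 43 + 20 + 16 =
          79 leave one factor \<open>n \<ge> n0\<close> below \<open>M = n ^ 80\<close> for the
          constants.\<close>
        have eta: "\<eta> \<le> 1 / (8 * ?q)"
          proof -
            have "8 * ?q * (2 * (Y0 * L) * D) \<le> 8 * n ^ 43 * (2 * (Y0 * n ^ 20) * n ^ 16)"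
              using q(3) T(2) True D Y0 n1 q1 unfolding L_def by (intro mult_mono) auto
            also have "\<dots> = (16 * Y0) * n ^ 79" by (simp add: power_add[symmetric])
            also have "\<dots> \<le> n * n ^ 79"
              using nn0 Y02 n1 unfolding n0_def by (intro mult_right_mono) auto
            also have "\<dots> = M" by (simp add: M_def power_Suc[symmetric] del: power_Suc)
            finally have "8 * ?q * (2 * (Y0 * L) * D) \<le> M" .
            then have "2 * (Y0 * L) * D \<le> M / (8 * ?q)" using q1 by (subst pos_le_divide_eq) (auto simp: mult_ac)
            then have "2 * (Y0 * L) * D / M \<le> (M / (8 * ?q)) / M" using LM by (intro divide_right_mono) auto
            then show ?thesis unfolding \<eta>_def using LM by simp
          qed
        \<comment> \<open>Uses \<open>T \<ge> n ^ 41\<close>, one power above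
          \<open>L\<^sup>2 = n ^ 40\<close>; again \<open>n \<ge> n0\<close> pays for the
          constants.\<close>
        have bB: "\<bar>\<beta>\<bar> * B \<le> 1 / (8 * ?q)"
          proof -
            have "\<bar>\<beta>\<bar> * B \<le> (1 / (?q * T)) * B" using q(4) B1 unfolding \<beta>_def by (intro mult_right_mono) auto
            also have "\<dots> = (B / T) / ?q" by simp
            also have "\<dots> \<le> (1 / 8) / ?q"
            proof (intro divide_right_mono)
              have "B * 8 = (8 * Y0\<^sup>2) * n ^ 40" by (simp add: B_def L2)
              also have "\<dots> \<le> n * n ^ 40" using nn0 Y02 n1 unfolding n0_def by (intro mult_right_mono) auto
              also have "\<dots> = n ^ 41" by (simp add: power_Suc[symmetric] del: power_Suc)
              also have "\<dots> \<le> T" by fact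
              finally show "B / T \<le> 1 / 8" using T0 by (simp add: pos_divide_le_eq)
            qed (use q1 in auto)
            finally show ?thesis by simp
          qed
        \<comment> \<open>Both \<bar>m\<bar> and \<open>N * \<bar>\<beta> * m\<bar>\<close> are
          \<open>O(n ^ 40 * D)\<close>. Multiplying the lower bound
          \<open>n ^ 16 \<le> q * (1 + N * \<bar>\<beta>\<bar>)\<close> by \<bar>m\<bar> therefore
          gains \<open>n ^ 16\<close>.\<close>
        have KK: "\<bar>real_of_int m\<bar> \<le> ?q * K" if m: "\<bar>real_of_int m\<bar> \<le> B" "\<bar>\<beta> * m\<bar> \<le> \<eta>" for m :: int
          proof -
            have "real N * \<bar>\<beta> * m\<bar> \<le> real N * \<eta>" using m(2) by (intro mult_left_mono) auto
            also have "\<dots> = 2 * Y0 * L\<^sup>2 * D" unfolding \<eta>_def NLM using LM by (simp add: power2_eq_square)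
            also have "\<dots> \<le> 2 * Y0\<^sup>2 * L\<^sup>2 * D" using Y02 D by (intro mult_right_mono mult_left_mono) auto
            finally have 1: "real N * \<bar>\<beta>\<bar> * \<bar>real_of_int m\<bar> \<le> 2 * Y0\<^sup>2 * L\<^sup>2 * D" by (simp add: abs_mult mult_ac)
            have "B * 1 \<le> B * D" using D B1 by (intro mult_left_mono) auto
            then have "\<bar>real_of_int m\<bar> \<le> B * D" using m(1) by linarith
            then have 2: "\<bar>real_of_int m\<bar> \<le> Y0\<^sup>2 * L\<^sup>2 * D" by (simp add: B_def)
            have "n ^ 16 * \<bar>real_of_int m\<bar> \<le> (?q * (1 + real N * \<bar>\<beta>\<bar>)) * \<bar>real_of_int m\<bar>"
              using q(5) unfolding \<beta>_def by (intro mult_right_mono) auto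
            also have "\<dots> = ?q * (\<bar>real_of_int m\<bar> + real N * \<bar>\<beta>\<bar> * \<bar>real_of_int m\<bar>)" by (simp add: algebra_simps)
            also have "\<dots> \<le> ?q * (Y0\<^sup>2 * L\<^sup>2 * D + 2 * Y0\<^sup>2 * L\<^sup>2 * D)" using 1 2 q1 by (intro mult_left_mono add_mono) auto
            also have "\<dots> = n ^ 16 * (?q * K)"
            proof -
              have "n ^ 40 = n ^ 16 * n ^ 24" by (simp add: power_add[symmetric])
              then show ?thesis unfolding K_def L2 by (simp add: algebra_simps)
            qed
            finally show ?thesis using n1 by simp
          qed
        have K0': "0 \<le> K" using K0 by simp
        have cm: "finite Ms" "real (card Ms) \<le> 2 * K + 1"
          unfolding Ms_def by (rule card_multiples_near_le[OF q(2,1) th eta bB KK K0'], assumption+)+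
        have "real (card Ms) \<le> 9 * Y0\<^sup>2 * n ^ 24 * D" using cm(2) K0 unfolding K_def by linarith
        then show ?thesis using cm by blast
      qed
      have "real (card V) \<le> C5 * real (card Ms)"
      proof (rule card_le_fibres'[where f = "wg v"])
        show "wg v ` V \<subseteq> Ms" using VB unfolding Ms_def by blast
        fix m assume "m \<in> Ms"
        show "real (card {s \<in> V. wg v s = m}) \<le> C5"
          unfolding C5_def using LM by (intro card_Yset_same_wg_le[OF pv(3)]) (auto simp: V_def)
      qed (use finV Ms C5 in auto)
      also have "\<dots> \<le> C5 * (9 * Y0\<^sup>2 * n ^ 24 * D)" using Ms C5 by (intro mult_left_mono) auto
      finally have cV: "real (card V) \<le> C5 * (9 * Y0\<^sup>2 * n ^ 24 * D)" .
      have "real (card ?S) \<le> (Ct * D) * real (card V)"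
      proof (rule card_le_fibres'[where f = snd])
        show "snd ` ?S \<subseteq> V" unfolding V_def pv(1) by auto
        show "0 \<le> Ct * D" using Ct D by simp
        fix w assume w: "w \<in> V"
        then have wY: "w \<in> Yset L" by (simp add: V_def)
        note y' = YsetD[OF wY]
        have "real (card {\<theta>' \<in> Z. close (D / M) (\<theta>, v) (\<theta>', w)}) \<le> 3 * (2 * (4 * a0 * D / real N) * real (PN N) + 1)"
        proof (rule card_grid_close_le[OF PN0])
          show "0 \<le> 4 * a0 * D / real N" using a0_ge D by simp
          show "{\<theta>' \<in> Z. close (D / M) (\<theta>, v) (\<theta>', w)} \<subseteq> grid (PN N)" using Zg by auto
          fix t t' assume t: "t \<in> {\<theta>' \<in> Z. close (D / M) (\<theta>, v) (\<theta>', w)}" "t' \<in> {\<theta>' \<in> Z. close (D / M) (\<theta>, v) (\<theta>', w)}"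
          have tc: "dnorm (t * den w - \<theta> * den v) \<le> D / M" "dnorm (t * num w - \<theta> * num v) \<le> D / M"
            "dnorm (t' * den w - \<theta> * den v) \<le> D / M" "dnorm (t' * num w - \<theta> * num v) \<le> D / M"
            using t by (auto simp: close_def)
          have "dnorm ((t - t') * den w) \<le> 2 * (D / M)"
          proof -
            have e: "(t - t') * den w = (t * den w - \<theta> * den v) - (t' * den w - \<theta> * den v)" by (simp add: algebra_simps)
            show ?thesis unfolding e
              using dnorm_diff_le[of "t * den w - \<theta> * den v" "t' * den w - \<theta> * den v"] tc by linarith
          qed
          moreover have "dnorm ((t - t') * num w) \<le> 2 * (D / M)"
          proof -
            have e: "(t - t') * num w = (t * num w - \<theta> * num v) - (t' * num w - \<theta> * num v)" by (simp add: algebra_simps)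
            show ?thesis unfolding e
              using dnorm_diff_le[of "t * num w - \<theta> * num v" "t' * num w - \<theta> * num v"] tc by linarith
          qed
          moreover have "real_of_int (den w) \<le> Y0 * L" using y'(4) by (simp add: Y0_def)
          moreover have "2 * (Y0 * L)\<^sup>2 * (2 * (D / M)) \<le> 1 / 2"
          proof -
            have "M = n ^ 40 * L\<^sup>2" unfolding L2 M_def by (simp add: power_add[symmetric])
            then have "2 * (Y0 * L)\<^sup>2 * (2 * (D / M)) = (4 * Y0\<^sup>2 * D) / n ^ 40"
              using LM by (simp add: power_mult_distrib)
            also have "\<dots> \<le> 1 / 2" using True n1 by (simp add: pos_divide_le_eq)
            finally show ?thesis .
          qed
          ultimately have dd: "dnorm (t - t') * den w \<le> 2 * (D / M)" by (rule dnorm_diff_small[OF y'(2)])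
          have "0 < real_of_int (den w)" using y'(7) by linarith
          then have "dnorm (t - t') \<le> 2 * (D / M) / den w" using dd by (simp only: pos_le_divide_eq)
          also have "\<dots> \<le> 2 * (D / M) / (L / (2 * a0))"
            using y'(3) LM a0_ge D y'(7) by (intro divide_left_mono mult_pos_pos) auto
          also have "\<dots> = 4 * a0 * D / real N" unfolding NLM using LM by (simp add: field_simps)
          finally show "dnorm (t - t') \<le> 4 * a0 * D / real N" .
        qed
        also have "\<dots> = 3 * (8 * a0 * (2 * a0 + 2) * D + 1)" unfolding PN_eq using N0 by (simp add: field_simps)
        also have "\<dots> \<le> Ct * D" using D by (simp add: Ct_def algebra_simps)
        finally show "real (card {s \<in> ?S. snd s = w}) \<le> Ct * D" using injf[of w] by linarith
      qed (use finS finV in auto)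
      also have "\<dots> \<le> (Ct * D) * (C5 * (9 * Y0\<^sup>2 * n ^ 24 * D))" using cV Ct D by (intro mult_left_mono) auto
      also have "\<dots> = Ca * n ^ 24 * D\<^sup>2" unfolding Ca_def power2_eq_square[of D] by (simp only: mult_ac)
      also have "\<dots> \<le> (Ca + Cb) * n ^ 24 * D\<^sup>2" using Cb n1 by (intro mult_right_mono) auto
      finally show ?thesis unfolding L_def M_def .
    qed
  qed
  have "Ca + Cb > 0" using Ca Cb by simp
  then show ?thesis by (intro exI[of _ "Ca + Cb"] exI[of _ n0] conjI allI impI main)
qed

text \<open>\<open>M\<^sup>2 = n ^ 160\<close> and the count \<open>n ^ 24\<close> give
  \<open>n ^ 184\<close>. The logarithm costs at most a further \<open>n\<close>, and
  \<open>n ^ 185 \<le> N powr (2 * \<delta>)\<close> amounts to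
  \<open>185 \<le> 200 * \<delta>\<close>.\<close>

lemma generic_sum:
  assumes delta: "37 / 40 \<le> \<delta>"
  shows "\<exists>C n0. C > 0 \<and> (\<forall>N n T aa qq Z. generic N n T aa qq Z \<longrightarrow> 1 \<le> n \<longrightarrow> n0 \<le> n \<longrightarrow> real N = n ^ 100 \<longrightarrow>
     n ^ 41 \<le> T \<longrightarrow> T \<le> n ^ 43 \<longrightarrow> (\<Sum>\<theta>\<in>Z. (norm (S N \<theta>))\<^sup>2) \<le> C * real N powr (4 * \<delta>))"
proof -
  obtain Cs where Cs': "Cs > 0 \<and> (\<forall>N M Z A0. 0 < N \<longrightarrow> 1 \<le> M \<longrightarrow> M \<le> real N \<longrightarrow> finite Z \<longrightarrow> 0 \<le> A0 \<longrightarrow>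
     (\<forall>p\<in>Z \<times> Yset (real N / M). \<forall>D. 1 \<le> D \<longrightarrow> D \<le> 2 * M \<longrightarrow>
        real (card {q \<in> Z \<times> Yset (real N / M). close (D / M) p q}) \<le> A0 * D\<^sup>2) \<longrightarrow>
     (\<Sum>\<theta>\<in>Z. (norm (S N \<theta>))\<^sup>2) \<le> Cs * real N powr (2 * \<delta>) * M\<^sup>2 * (1 + ln M) * A0)"
    using large_sieve_S by (rule exE)
  note Cs = conjunct1[OF Cs'] conjunct2[OF Cs', rule_format]
  obtain Cg where "\<exists>n0. Cg > 0 \<and> (\<forall>N n T aa qq Z D p. generic N n T aa qq Z \<longrightarrow> 1 \<le> n \<longrightarrow> n0 \<le> n \<longrightarrow> real N = n ^ 100 \<longrightarrow>
     n ^ 41 \<le> T \<longrightarrow> T \<le> n ^ 43 \<longrightarrow> 1 \<le> D \<longrightarrow> p \<in> Z \<times> Yset (n ^ 20) \<longrightarrow>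
     real (card {p' \<in> Z \<times> Yset (n ^ 20). close (D / n ^ 80) p p'}) \<le> Cg * n ^ 24 * D\<^sup>2)"
    using generic_count by (rule exE)
  then obtain n0 where Cg': "Cg > 0 \<and> (\<forall>N n T aa qq Z D p. generic N n T aa qq Z \<longrightarrow> 1 \<le> n \<longrightarrow> n0 \<le> n \<longrightarrow> real N = n ^ 100 \<longrightarrow>
     n ^ 41 \<le> T \<longrightarrow> T \<le> n ^ 43 \<longrightarrow> 1 \<le> D \<longrightarrow> p \<in> Z \<times> Yset (n ^ 20) \<longrightarrow>
     real (card {p' \<in> Z \<times> Yset (n ^ 20). close (D / n ^ 80) p p'}) \<le> Cg * n ^ 24 * D\<^sup>2)"
    by (rule exE)
  note Cg = conjunct1[OF Cg'] conjunct2[OF Cg', rule_format]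
  have main: "(\<Sum>\<theta>\<in>Z. (norm (S N \<theta>))\<^sup>2) \<le> (80 * Cs * Cg) * real N powr (4 * \<delta>)"
    if g: "generic N n T aa qq Z" and n1: "1 \<le> n" and nn0: "n0 \<le> n" and N: "real N = n ^ 100"
      and T: "n ^ 41 \<le> T" "T \<le> n ^ 43" for N n T aa qq Z
  proof -
    have "0 < real N" unfolding N using n1 by simp
    then have N0: "0 < N" by simp
    have e: "n ^ 100 = n ^ 20 * n ^ 80" by (simp add: power_add[symmetric])
    have NM: "real N / n ^ 80 = n ^ 20" unfolding N e using n1 by (intro nonzero_mult_div_cancel_right) auto
    have M1: "1 \<le> n ^ 80" using n1 by simp
    have MN: "n ^ 80 \<le> real N" unfolding N using n1 by (intro power_increasing) auto
    have fin: "finite Z" using g finite_grid finite_subset unfolding generic_def by blast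
    have A0: "0 \<le> Cg * n ^ 24" using Cg(1) n1 by simp
    have "(\<Sum>\<theta>\<in>Z. (norm (S N \<theta>))\<^sup>2) \<le> Cs * real N powr (2 * \<delta>) * (n ^ 80)\<^sup>2 * (1 + ln (n ^ 80)) * (Cg * n ^ 24)"
      by (rule Cs(2)[OF N0 M1 MN fin A0]) (simp only: NM, rule Cg(2)[OF g n1 nn0 N T])
    also have "\<dots> = (Cs * Cg) * real N powr (2 * \<delta>) * (n ^ 184 * (1 + 80 * ln n))"
    proof -
      have "(n ^ 80)\<^sup>2 * n ^ 24 = n ^ 184" by (simp add: power_mult[symmetric] power_add[symmetric])
      moreover have "ln (n ^ 80) = 80 * ln n" using n1 by (simp add: ln_realpow)
      moreover have "Cs * R * k * l * (Cg * m) = (Cs * Cg) * R * ((k * m) * l)" for R k l m by (simp only: mult_ac)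
      ultimately show ?thesis by (simp only:)
    qed
    also have "\<dots> \<le> (Cs * Cg) * real N powr (2 * \<delta>) * (80 * real N powr (2 * \<delta>))"
    proof (intro mult_left_mono)
      have "ln n \<le> n - 1" using n1 by (intro ln_le_minus_one) auto
      then have "n ^ 184 * (1 + 80 * ln n) \<le> n ^ 184 * (80 * n)" using n1 by (intro mult_left_mono) auto
      also have "\<dots> = 80 * n ^ 185" by (simp add: power_Suc[symmetric] mult_ac del: power_Suc)
      also have "n ^ 185 = n powr 185" using n1 by (simp add: powr_numeral)
      also have "n powr 185 \<le> n powr (100 * (2 * \<delta>))" using n1 delta by (intro powr_mono) auto
      also have "n powr (100 * (2 * \<delta>)) = real N powr (2 * \<delta>)"
      proof -
        have "n ^ 100 = n powr 100" using n1 by (simp add: powr_numeral)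
        then show ?thesis unfolding N by (simp add: powr_powr)
      qed
      finally show "n ^ 184 * (1 + 80 * ln n) \<le> 80 * real N powr (2 * \<delta>)" by simp
    qed (use Cs(1) Cg(1) in auto)
    also have "\<dots> = (80 * Cs * Cg) * (real N powr (2 * \<delta>) * real N powr (2 * \<delta>))" by (simp only: mult_ac)
    also have "real N powr (2 * \<delta>) * real N powr (2 * \<delta>) = real N powr (4 * \<delta>)" by (simp add: powr_add[symmetric])
    finally show ?thesis .
  qed
  have "80 * Cs * Cg > 0" using Cs(1) Cg(1) by simp
  then show ?thesis by (intro exI[of _ "80 * Cs * Cg"] exI[of _ n0] conjI allI impI main)
qed

end

section \<open>The mean square bound and its consequence\<close>

context critical_alphabet
begin

lemma sum_grid: "0 < P \<Longrightarrow> (\<Sum>\<theta>\<in>grid P. g \<theta>) = (\<Sum>j<P. g (real j / real P))"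
  unfolding grid_def by (subst sum.reindex) (auto simp: inj_on_def)

text \<open>Dirichlet's theorem with \<open>T\<close> near \<open>n ^ 42\<close> attaches a fraction
  to every grid point. The points with \<open>X \<ge> n ^ 16\<close> form one generic set; the
  others fall into dyadic blocks whose bounds decrease geometrically with ratio
  \<open>2 powr (- (1 / 8))\<close>.\<close>

lemma mean_square_le:
  assumes delta: "37 / 40 \<le> \<delta>"
  shows "\<exists>C>0. \<forall>\<^sub>F N in sequentially. (\<Sum>\<theta>\<in>grid (PN N). (norm (S N \<theta>))\<^sup>2) \<le> C * real N powr (4 * \<delta>)"
proof -
  obtain Cs where Cs': "Cs > 0 \<and> (\<forall>N X aa qq Z. block N X aa qq Z \<longrightarrow> 0 < N \<longrightarrow> 1 \<le> X \<longrightarrow>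
     2 * a0 * X \<le> real N / (C1 * X ^ 4) \<longrightarrow>
     (\<Sum>\<theta>\<in>Z. (norm (S N \<theta>))\<^sup>2) \<le> Cs * real N powr (4 * \<delta>) * X powr (- (1 / 8)))"
    using small_block_sum[OF delta] by (rule exE)
  note Cs = conjunct1[OF Cs'] conjunct2[OF Cs', rule_format]
  obtain Cg where "\<exists>n0. Cg > 0 \<and> (\<forall>N n T aa qq Z. generic N n T aa qq Z \<longrightarrow> 1 \<le> n \<longrightarrow> n0 \<le> n \<longrightarrow> real N = n ^ 100 \<longrightarrow>
     n ^ 41 \<le> T \<longrightarrow> T \<le> n ^ 43 \<longrightarrow> (\<Sum>\<theta>\<in>Z. (norm (S N \<theta>))\<^sup>2) \<le> Cg * real N powr (4 * \<delta>))"
    using generic_sum[OF delta] by (rule exE)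
  then obtain n0 where Cg': "Cg > 0 \<and> (\<forall>N n T aa qq Z. generic N n T aa qq Z \<longrightarrow> 1 \<le> n \<longrightarrow> n0 \<le> n \<longrightarrow> real N = n ^ 100 \<longrightarrow>
     n ^ 41 \<le> T \<longrightarrow> T \<le> n ^ 43 \<longrightarrow> (\<Sum>\<theta>\<in>Z. (norm (S N \<theta>))\<^sup>2) \<le> Cg * real N powr (4 * \<delta>))"
    by (rule exE)
  note Cg = conjunct1[OF Cg'] conjunct2[OF Cg', rule_format]
  define \<rho> where "\<rho> = (2::real) powr (- (1 / 8))"
  have rho: "0 < \<rho>" "\<rho> < 1" unfolding \<rho>_def using powr_less_mono[of "- (1 / 8)" 0 "2::real"] by auto
  have C1ge: "1 \<le> C1" using a0_ge by (simp add: C1_def)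
  define C where "C = Cg + Cs / (1 - \<rho>)"
  \<comment> \<open>The bound \<open>2 * a0 * C1 \<le> n\<close> lets \<open>X \<le> n ^ 16\<close>
    meet the size condition of \<open>small_block_sum\<close>, as 1 + 5 * 16 = 81 is below 100. The
    2 leaves room for rounding \<open>n ^ 42\<close> up to an integer below
    \<open>n ^ 43\<close>.\<close>
  define n1 where "n1 = max (max 2 n0) (2 * a0 * C1)"
  have main: "(\<Sum>\<theta>\<in>grid (PN N). (norm (S N \<theta>))\<^sup>2) \<le> C * real N powr (4 * \<delta>)" if Nn1: "n1 ^ 100 \<le> real N" for N
  proof -
    have n12: "2 \<le> n1" by (simp add: n1_def)
    have "1 \<le> n1 ^ 100" using n12 by simp
    then have N0: "0 < N" using Nn1 by (cases N) auto
    define n where "n = root 100 (real N)"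
    have nN: "real N = n ^ 100" unfolding n_def by simp
    have nn1: "n1 \<le> n"
    proof -
      have "n1 = root 100 (n1 ^ 100)" using n12 by (simp add: real_root_power_cancel)
      also have "\<dots> \<le> n" unfolding n_def using Nn1 by simp
      finally show ?thesis .
    qed
    have n2: "2 \<le> n" "n0 \<le> n" "2 * a0 * C1 \<le> n" "1 \<le> n" using nn1 unfolding n1_def by auto
    define T where "T = nat \<lceil>n ^ 42\<rceil>"
    have n42: "1 \<le> n ^ 42" using n2 by simp
    have T: "n ^ 42 \<le> real T" "real T \<le> n ^ 42 + 1" unfolding T_def using n42 by linarith+
    have T0: "0 < T" using T n42 by (cases T) auto
    have "n ^ 41 \<le> n ^ 42" using n2 by (intro power_increasing) auto
    then have T41: "n ^ 41 \<le> real T" using T(1) by linarith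
    have T43: "real T \<le> n ^ 43"
    proof -
      have "n ^ 42 + 1 \<le> 2 * n ^ 42" using n42 by simp
      also have "\<dots> \<le> n * n ^ 42" using n2 n42 by (intro mult_right_mono) auto
      finally show ?thesis using T(2) by (simp add: power_Suc[symmetric] del: power_Suc)
    qed
    have ex: "\<exists>p. coprime (fst p) (snd p) \<and> 0 < snd p \<and> snd p \<le> int T \<and> \<bar>of_int (snd p) * \<theta> - of_int (fst p)\<bar> < 1 / T"
      for \<theta> :: real
    proof -
      obtain h k where "coprime h k" "0 < k" "k \<le> int T" "\<bar>of_int k * \<theta> - of_int h\<bar> < 1 / T"
        using Dirichlet_approx_coprime[OF T0] by blast
      then show ?thesis by (intro exI[of _ "(h, k)"]) auto
    qed
    define f where "f \<theta> = (SOME p. coprime (fst p) (snd p) \<and> 0 < snd p \<and> snd p \<le> int T \<and> \<bar>of_int (snd p) * \<theta> - of_int (fst p)\<bar> < 1 / T)"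
      for \<theta> :: real
    have f: "coprime (fst (f \<theta>)) (snd (f \<theta>)) \<and> 0 < snd (f \<theta>) \<and> snd (f \<theta>) \<le> int T \<and>
        \<bar>of_int (snd (f \<theta>)) * \<theta> - of_int (fst (f \<theta>))\<bar> < 1 / T" for \<theta>
      unfolding f_def by (rule someI_ex[OF ex])
    define aa where "aa \<theta> = fst (f \<theta>)" for \<theta>
    define qq where "qq \<theta> = snd (f \<theta>)" for \<theta>
    have q: "coprime (aa \<theta>) (qq \<theta>)" "0 < qq \<theta>" "real_of_int (qq \<theta>) \<le> real T" "\<bar>\<theta> - aa \<theta> / qq \<theta>\<bar> \<le> 1 / (qq \<theta> * real T)" for \<theta>
    proof -
      show "coprime (aa \<theta>) (qq \<theta>)" and q0: "0 < qq \<theta>" using f[of \<theta>] by (auto simp: aa_def qq_def)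
      have "qq \<theta> \<le> int T" using f[of \<theta>] by (auto simp: qq_def)
      then show "real_of_int (qq \<theta>) \<le> real T" by linarith
      have qr: "0 < real_of_int (qq \<theta>)" using q0 by simp
      have "\<bar>of_int (qq \<theta>) * \<theta> - of_int (aa \<theta>)\<bar> \<le> 1 / T" using f[of \<theta>] by (auto simp: aa_def qq_def)
      then have "\<bar>of_int (qq \<theta>) * \<theta> - of_int (aa \<theta>)\<bar> / qq \<theta> \<le> (1 / T) / qq \<theta>" using qr by (intro divide_right_mono) auto
      moreover have "\<theta> - aa \<theta> / qq \<theta> = (of_int (qq \<theta>) * \<theta> - of_int (aa \<theta>)) / qq \<theta>" using qr by (simp add: field_simps)
      ultimately show "\<bar>\<theta> - aa \<theta> / qq \<theta>\<bar> \<le> 1 / (qq \<theta> * real T)" using qr by (simp add: mult.commute)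
    qed
    define X where "X \<theta> = real_of_int (qq \<theta>) * (1 + real N * \<bar>\<theta> - aa \<theta> / qq \<theta>\<bar>)" for \<theta>
    have X1: "1 \<le> X \<theta>" for \<theta>
    proof -
      have "1 * 1 \<le> X \<theta>" unfolding X_def using q(2)[of \<theta>] by (intro mult_mono) auto
      then show ?thesis by simp
    qed
    define G where "G = grid (PN N)"
    define ZL where "ZL = {\<theta> \<in> G. n ^ 16 \<le> X \<theta>}"
    define Z where "Z i = {\<theta> \<in> G. 2 ^ i \<le> X \<theta> \<and> X \<theta> < 2 * 2 ^ i \<and> X \<theta> < n ^ 16}" for i :: nat
    have finG: "finite G" by (simp add: G_def finite_grid)
    obtain K :: nat where K: "n ^ 16 < 2 ^ K" using real_arch_pow[of 2 "n ^ 16"] by auto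
    have cover: "G \<subseteq> ZL \<union> (\<Union>i<K. Z i)"
    proof
      fix \<theta> assume t: "\<theta> \<in> G"
      show "\<theta> \<in> ZL \<union> (\<Union>i<K. Z i)"
      proof (cases "n ^ 16 \<le> X \<theta>")
        case True
        then show ?thesis using t by (simp add: ZL_def)
      next
        case False
        define j where "j = (LEAST j. X \<theta> < 2 ^ j)"
        have lt: "X \<theta> < 2 ^ K" using False K by linarith
        have j: "X \<theta> < 2 ^ j" unfolding j_def using lt by (rule LeastI)
        have jK: "j \<le> K" unfolding j_def using lt by (rule Least_le)
        have "j \<noteq> 0" using j X1[of \<theta>] by (cases j) auto
        then obtain i where i: "j = Suc i" using not0_implies_Suc by blast
        have "\<not> X \<theta> < 2 ^ i" using not_less_Least[of i "\<lambda>j. X \<theta> < 2 ^ j"] i by (simp add: j_def)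
        then have "\<theta> \<in> Z i" using j i False t by (simp add: Z_def)
        moreover have "i < K" using i jK by simp
        ultimately show ?thesis by blast
      qed
    qed
    let ?g = "\<lambda>\<theta>. (norm (S N \<theta>))\<^sup>2"
    have large: "(\<Sum>\<theta>\<in>ZL. ?g \<theta>) \<le> Cg * real N powr (4 * \<delta>)"
    proof (rule Cg(2)[OF _ n2(4) n2(2) nN T41 T43])
      show "generic N n (real T) aa qq ZL"
        unfolding generic_def ZL_def G_def X_def using q by auto
    qed
    have small: "(\<Sum>\<theta>\<in>Z i. ?g \<theta>) \<le> (Cs * real N powr (4 * \<delta>)) * \<rho> ^ i" for i
    proof (cases "Z i = {}")
      case True
      then show ?thesis using Cs(1) rho by simp
    next
      case False
      then obtain \<theta>0 where "\<theta>0 \<in> Z i" by blast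
      then have i16: "2 ^ i \<le> n ^ 16" by (auto simp: Z_def)
      have "block N (2 ^ i) aa qq (Z i)"
        unfolding block_def Z_def G_def X_def using q by auto
      moreover have "1 \<le> (2::real) ^ i" by simp
      moreover have "2 * a0 * 2 ^ i \<le> real N / (C1 * (2 ^ i) ^ 4)"
      proof -
        have "2 * a0 * 2 ^ i * (C1 * (2 ^ i) ^ 4) = (2 * a0 * C1) * (2 ^ i) ^ 5" by (simp add: power_eq_if)
        also have "\<dots> \<le> n * (n ^ 16) ^ 5"
          using i16 n2 a0_ge C1ge by (intro mult_mono power_mono) auto
        also have "\<dots> = n ^ 81" by (simp add: power_mult[symmetric] power_Suc[symmetric] del: power_Suc)
        also have "\<dots> \<le> n ^ 100" using n2 by (intro power_increasing) auto
        finally have "2 * a0 * 2 ^ i * (C1 * (2 ^ i) ^ 4) \<le> real N" using nN by simp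
        moreover have "0 < C1 * (2 ^ i) ^ 4" using C1ge by simp
        ultimately show ?thesis by (simp only: pos_le_divide_eq)
      qed
      ultimately have "(\<Sum>\<theta>\<in>Z i. ?g \<theta>) \<le> Cs * real N powr (4 * \<delta>) * (2 ^ i) powr (- (1 / 8))"
        using Cs(2) N0 by blast
      also have "(2 ^ i) powr (- (1 / 8)) = \<rho> ^ i"
      proof -
        have "(2 ^ i) powr (- (1 / 8)) = (2 powr real i) powr (- (1 / 8))" by (simp add: powr_realpow)
        also have "\<dots> = (2 powr (- (1 / 8))) powr (real i)" by (simp only: powr_powr mult.commute)
        also have "\<dots> = \<rho> ^ i" unfolding \<rho>_def by (simp add: powr_realpow)
        finally show ?thesis .
      qed
      finally show ?thesis .
    qed
    have geo: "(\<Sum>i<K. \<rho> ^ i) \<le> 1 / (1 - \<rho>)"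
    proof -
      have "(\<Sum>i<K. \<rho> ^ i) = (1 - \<rho> ^ K) / (1 - \<rho>)" using rho by (simp add: sum_gp_strict)
      also have "\<dots> \<le> 1 / (1 - \<rho>)" using rho by (intro divide_right_mono) auto
      finally show ?thesis .
    qed
    have fins: "finite ZL" "finite (\<Union>i<K. Z i)" "\<And>i. finite (Z i)" using finG by (auto simp: ZL_def Z_def)
    have "(\<Sum>\<theta>\<in>G. ?g \<theta>) \<le> (\<Sum>\<theta>\<in>ZL \<union> (\<Union>i<K. Z i). ?g \<theta>)" using cover fins by (intro sum_mono2) auto
    also have "\<dots> \<le> (\<Sum>\<theta>\<in>ZL. ?g \<theta>) + (\<Sum>\<theta>\<in>(\<Union>i<K. Z i). ?g \<theta>)"
      using sum.union_inter[OF fins(1,2), of ?g] sum_nonneg[of "ZL \<inter> (\<Union>i<K. Z i)" ?g] by simp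
    also have "(\<Sum>\<theta>\<in>(\<Union>i<K. Z i). ?g \<theta>) = (\<Sum>i<K. \<Sum>\<theta>\<in>Z i. ?g \<theta>)"
    proof (rule sum.UNION_disjoint)
      show "\<forall>i\<in>{..<K}. \<forall>j\<in>{..<K}. i \<noteq> j \<longrightarrow> Z i \<inter> Z j = {}"
      proof (intro ballI impI)
        fix i j :: nat assume "i \<noteq> j"
        have "False" if "\<theta> \<in> Z i" "\<theta> \<in> Z j" "i < j" for \<theta> i j
        proof -
          have "(2::real) * 2 ^ i \<le> 2 ^ j" using that(3) power_increasing[of "Suc i" j "2::real"] by simp
          then show False using that by (auto simp: Z_def)
        qed
        then show "Z i \<inter> Z j = {}" using \<open>i \<noteq> j\<close> by (metis disjoint_iff linorder_neqE_nat)
      qed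
    qed (use fins in auto)
    also have "(\<Sum>i<K. \<Sum>\<theta>\<in>Z i. ?g \<theta>) \<le> (\<Sum>i<K. (Cs * real N powr (4 * \<delta>)) * \<rho> ^ i)" by (intro sum_mono small)
    also have "\<dots> = (Cs * real N powr (4 * \<delta>)) * (\<Sum>i<K. \<rho> ^ i)" by (simp only: sum_distrib_left)
    also have "\<dots> \<le> (Cs * real N powr (4 * \<delta>)) * (1 / (1 - \<rho>))" using Cs(1) by (intro mult_left_mono geo) auto
    also have "(\<Sum>\<theta>\<in>ZL. ?g \<theta>) \<le> Cg * real N powr (4 * \<delta>)" by (rule large)
    also have "Cg * real N powr (4 * \<delta>) + (Cs * real N powr (4 * \<delta>)) * (1 / (1 - \<rho>)) = C * real N powr (4 * \<delta>)"
      by (simp add: C_def algebra_simps)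
    finally show ?thesis unfolding G_def by simp
  qed
  have "C > 0" unfolding C_def using Cg(1) Cs(1) rho by (intro add_pos_pos) auto
  moreover have "\<forall>\<^sub>F N in sequentially. n1 ^ 100 \<le> real N"
    using filterlim_real_sequentially unfolding filterlim_at_top by blast
  ultimately show ?thesis using main by (intro exI[of _ C] conjI) (auto elim: eventually_mono)
qed

text \<open>Cauchy-Schwarz for \<open>r d\<close>, the weighted number of words with denominator
  \<open>d\<close>. The \<open>r d\<close> add up to at least the number of words in
  \<open>stop (2 * N)\<close>, while their squares are controlled by \<open>parseval\<close> and the
  mean square. The argument \<open>(2 * Max A + 3) * N\<close> equals
  \<open>(2 * a0 + 1) * N\<close>, the end of the support of the weight.\<close>

lemma cfrac_denoms_ge:
  assumes N: "0 < N" and ms: "(\<Sum>\<theta>\<in>grid (PN N). (norm (S N \<theta>))\<^sup>2) \<le> C * real N powr (4 * \<delta>)"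
  shows "(4 powr (- \<delta>))\<^sup>2 * real N \<le> C * real (card (cfrac_denoms A ((2 * Max A + 3) * N)))"
proof -
  define P where "P = PN N"
  have P: "0 < P" "real P = (2 * a0 + 2) * real N" using N PN_eq by (auto simp: P_def PN_def)
  define W where "W = {w \<in> Wset N. wt N (den w) \<noteq> 0}"
  have finW: "finite W" unfolding W_def using finite_Wset by simp
  define Dd where "Dd = den ` W"
  have finD: "finite Dd" using finW by (simp add: Dd_def)
  define r where "r d = (\<Sum>w\<in>{w \<in> W. den w = d}. wt N (den w))" for d
  have WD: "set w \<subseteq> A" "real N < den w" "real_of_int (den w) \<le> (2 * a0 + 1) * real N" if "w \<in> W" for w
  proof -
    show "set w \<subseteq> A" "real_of_int (den w) \<le> (2 * a0 + 1) * real N" using that by (auto simp: W_def Wset_def)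
    show "real N < den w" using that wt_eq_0[OF N, of "real_of_int (den w)"] by (force simp: W_def)
  qed
  have DP: "Dd \<subseteq> {0..<int P}"
  proof
    fix d assume "d \<in> Dd"
    then obtain w where w: "w \<in> W" "d = den w" by (auto simp: Dd_def)
    have "(2 * a0 + 1) * real N < real P" using P N by (simp add: algebra_simps)
    then have "real_of_int d < real P" using WD(3)[OF w(1)] w(2) by linarith
    then show "d \<in> {0..<int P}" using den_nonneg[of w] w by simp
  qed
  have Seq: "S N \<theta> = (\<Sum>d\<in>Dd. of_real (r d) * ee (\<theta> * of_int d))" for \<theta>
  proof -
    have "S N \<theta> = (\<Sum>w\<in>W. of_real (wt N (den w)) * ee (\<theta> * of_int (den w)))"
      unfolding S_def W_def by (rule sum.mono_neutral_right) (auto simp: finite_Wset)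
    also have "\<dots> = (\<Sum>d\<in>Dd. \<Sum>w\<in>{w \<in> W. den w = d}. of_real (wt N (den w)) * ee (\<theta> * of_int (den w)))"
      unfolding Dd_def by (rule sum.image_gen[OF finW])
    also have "\<dots> = (\<Sum>d\<in>Dd. of_real (r d) * ee (\<theta> * of_int d))"
      unfolding r_def of_real_sum sum_distrib_right by (intro sum.cong refl) auto
    finally show ?thesis .
  qed
  have par: "real P * (\<Sum>d\<in>Dd. (r d)\<^sup>2) \<le> C * real N powr (4 * \<delta>)"
  proof -
    have "real P * (\<Sum>d\<in>Dd. (r d)\<^sup>2) = (\<Sum>j<P. (norm (S N (real j / real P)))\<^sup>2)"
      unfolding Seq by (rule parseval[OF P(1) finD DP, symmetric])
    also have "\<dots> = (\<Sum>\<theta>\<in>grid P. (norm (S N \<theta>))\<^sup>2)" by (rule sum_grid[OF P(1), symmetric])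
    finally show ?thesis using ms by (simp add: P_def)
  qed
  have low: "4 powr (- \<delta>) * real N powr (2 * \<delta>) \<le> (\<Sum>d\<in>Dd. r d)"
  proof -
    have N2: "1 \<le> 2 * real N" using N by simp
    have sub: "stop (2 * real N) \<subseteq> W" and one: "\<And>w. w \<in> stop (2 * real N) \<Longrightarrow> wt N (den w) = 1"
    proof -
      show one: "wt N (den w) = 1" if "w \<in> stop (2 * real N)" for w
        using stopD[OF that N2] by (intro wt_eq_1[OF N]) auto
      show "stop (2 * real N) \<subseteq> W"
      proof
        fix w assume w: "w \<in> stop (2 * real N)"
        have "a0 * (2 * real N) \<le> (2 * a0 + 1) * real N" by (simp add: algebra_simps)
        then have "w \<in> Wset N" using stopD[OF w N2] by (simp add: Wset_def)
        then show "w \<in> W" using one[OF w] by (simp add: W_def)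
      qed
    qed
    have "4 powr (- \<delta>) * real N powr (2 * \<delta>) \<le> 4 powr (- \<delta>) * (2 * real N) powr (2 * \<delta>)"
      using delta_nonneg by (intro mult_left_mono powr_mono2) auto
    also have "\<dots> \<le> real (card (stop (2 * real N)))" by (rule card_stop_ge[OF N2])
    also have "\<dots> = (\<Sum>w\<in>stop (2 * real N). wt N (den w))" using one by simp
    also have "\<dots> \<le> (\<Sum>w\<in>W. wt N (den w))" using sub finW wt_nonneg by (intro sum_mono2) auto
    also have "\<dots> = (\<Sum>d\<in>Dd. r d)" unfolding r_def Dd_def by (rule sum.image_gen[OF finW])
    finally show ?thesis .
  qed
  have "(4 powr (- \<delta>) * real N powr (2 * \<delta>))\<^sup>2 \<le> (\<Sum>d\<in>Dd. r d)\<^sup>2" using low by (intro power_mono) auto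
  also have "\<dots> \<le> (\<Sum>d\<in>Dd. (r d)\<^sup>2) * real (card Dd)" by (rule sum_squared_le_sum_of_squares)
  finally have "real P * (4 powr (- \<delta>) * real N powr (2 * \<delta>))\<^sup>2 \<le> real P * ((\<Sum>d\<in>Dd. (r d)\<^sup>2) * real (card Dd))"
    by (intro mult_left_mono) auto
  also have "\<dots> \<le> (C * real N powr (4 * \<delta>)) * real (card Dd)"
    unfolding mult.assoc[symmetric] by (intro mult_right_mono par) auto
  also have "(4 powr (- \<delta>) * real N powr (2 * \<delta>))\<^sup>2 = (4 powr (- \<delta>))\<^sup>2 * real N powr (4 * \<delta>)"
    by (simp add: power_mult_distrib power2_eq_square[of "real N powr (2 * \<delta>)"] powr_add[symmetric])
  finally have "(real P * (4 powr (- \<delta>))\<^sup>2) * real N powr (4 * \<delta>) \<le> (C * real (card Dd)) * real N powr (4 * \<delta>)"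
    by (simp only: mult_ac)
  moreover have "0 < real N powr (4 * \<delta>)" using N by simp
  ultimately have PC: "real P * (4 powr (- \<delta>))\<^sup>2 \<le> C * real (card Dd)" by (simp only: mult_le_cancel_right_pos)
  have C0: "0 \<le> C"
  proof -
    have "0 < real N powr (4 * \<delta>)" using N by simp
    moreover have "0 \<le> C * real N powr (4 * \<delta>)" using ms by (intro order_trans[OF sum_nonneg ms]) auto
    ultimately show ?thesis by (simp add: zero_le_mult_iff)
  qed
  have sub: "Dd \<subseteq> int ` cfrac_denoms A ((2 * Max A + 3) * N)"
  proof
    fix d assume "d \<in> Dd"
    then obtain w where w: "w \<in> W" "d = den w" by (auto simp: Dd_def)
    note wd = WD[OF w(1)]
    have pos: "0 \<notin> set w" using word_pos[OF wd(1)] .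
    have "w \<noteq> []" using wd(2) N by auto
    have n1: "1 \<le> num w" using den_eq_one_num_zero[OF pos] \<open>w \<noteq> []\<close> num_nonneg[of w] by linarith
    have d1: "1 \<le> den w" using den_pos[OF pos] .
    have "real_of_int (den w) \<le> real ((2 * Max A + 3) * N)" using wd(3) by (simp add: a0_def algebra_simps)
    then have le: "nat (den w) \<le> (2 * Max A + 3) * N" using d1 by linarith
    have "nat (den w) \<in> cfrac_denoms A ((2 * Max A + 3) * N)"
      unfolding cfrac_denoms_def
    proof (intro CollectI conjI exI[of _ "nat (num w)"] exI[of _ w])
      show "1 \<le> nat (den w)" "nat (den w) \<le> (2 * Max A + 3) * N" "1 \<le> nat (num w)" using d1 n1 le by auto
      show "coprime (nat (num w)) (nat (den w))"
      proof -
        have "coprime (int (nat (num w))) (int (nat (den w)))"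
          using coprime_den_num[of w] d1 n1 by (simp add: coprime_commute)
        then show ?thesis by (simp only: coprime_int_iff)
      qed
      show "w \<noteq> []" "set w \<subseteq> A" by fact+
      show "real (nat (num w)) / real (nat (den w)) = cfrac w" using cfrac_eq[OF pos] d1 n1 by simp
    qed
    then show "d \<in> int ` cfrac_denoms A ((2 * Max A + 3) * N)"
      using w d1 by (intro image_eqI[of _ _ "nat (den w)"]) auto
  qed
  have finC: "finite (cfrac_denoms A k)" for k
    by (rule finite_subset[of _ "{..k}"]) (auto simp: cfrac_denoms_def)
  have "card Dd \<le> card (int ` cfrac_denoms A ((2 * Max A + 3) * N))" using finC by (intro card_mono sub) auto
  also have "\<dots> \<le> card (cfrac_denoms A ((2 * Max A + 3) * N))" by (rule card_image_le[OF finC])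
  finally have "C * real (card Dd) \<le> C * real (card (cfrac_denoms A ((2 * Max A + 3) * N)))"
    using C0 by (intro mult_left_mono) auto
  moreover have "(4 powr (- \<delta>))\<^sup>2 * real N \<le> real P * (4 powr (- \<delta>))\<^sup>2"
  proof -
    have "1 * real N \<le> real P" unfolding P(2) using a0_ge by (intro mult_right_mono) auto
    then have "real N * (4 powr (- \<delta>))\<^sup>2 \<le> real P * (4 powr (- \<delta>))\<^sup>2" by (intro mult_right_mono) auto
    then show ?thesis by (simp only: mult.commute)
  qed
  ultimately show ?thesis using PC by linarith
qed

text \<open>Arbitrary \<open>N\<close> is reached through \<open>m = N div k\<close> and
  monotonicity in the bound on the denominators; the rounding costs a factor 2.\<close>

lemma positive_proportion:
  assumes delta: "37 / 40 \<le> \<delta>"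
  shows "\<exists>c>0. \<forall>\<^sub>F N in sequentially. c * real N \<le> real (card (cfrac_denoms A N))"
proof -
  obtain C where C: "C > 0" and ev: "\<forall>\<^sub>F N in sequentially. (\<Sum>\<theta>\<in>grid (PN N). (norm (S N \<theta>))\<^sup>2) \<le> C * real N powr (4 * \<delta>)"
    using mean_square_le[OF delta] by blast
  obtain N0 where N0: "\<And>N. N0 \<le> N \<Longrightarrow> (\<Sum>\<theta>\<in>grid (PN N). (norm (S N \<theta>))\<^sup>2) \<le> C * real N powr (4 * \<delta>)"
    using ev unfolding eventually_sequentially by blast
  define k where "k = 2 * Max A + 3"
  define c where "c = (4 powr (- \<delta>))\<^sup>2 / C"
  have c0: "c > 0" using C by (simp add: c_def)
  have k0: "0 < k" by (simp add: k_def)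
  have finC: "finite (cfrac_denoms A k)" for k
    by (rule finite_subset[of _ "{..k}"]) (auto simp: cfrac_denoms_def)
  have "c / (2 * real k) * real N \<le> real (card (cfrac_denoms A N))" if N: "k * (N0 + 2) \<le> N" for N
  proof -
    define m where "m = N div k"
    have "N0 + 2 \<le> m" unfolding m_def using N k0 by (simp add: less_eq_div_iff_mult_less_eq mult.commute)
    then have m: "N0 \<le> m" "0 < m" "2 \<le> m" by auto
    have kN: "k * m \<le> N" unfolding m_def by simp
    have "N < k * (m + 1)" unfolding m_def using k0 by (simp add: dividend_less_times_div)
    then have "real N \<le> real (k * (m + 1))" by (simp only: of_nat_le_iff less_imp_le)
    also have "\<dots> = real k * (real m + 1)" by (simp add: distrib_left)
    also have "\<dots> \<le> real k * (2 * real m)" using m by (intro mult_left_mono) auto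
    also have "\<dots> = 2 * real k * real m" by simp
    finally have "real N / (2 * real k) \<le> real m" using k0 by (simp add: pos_divide_le_eq mult_ac)
    then have "c * (real N / (2 * real k)) \<le> c * real m" using c0 by (intro mult_left_mono) auto
    also have "\<dots> \<le> real (card (cfrac_denoms A (k * m)))"
      using cfrac_denoms_ge[OF m(2) N0[OF m(1)]] C unfolding c_def k_def by (simp add: field_simps)
    also have "\<dots> \<le> real (card (cfrac_denoms A N))"
      using kN finC by (intro of_nat_mono card_mono) (auto simp: cfrac_denoms_def)
    finally show ?thesis by simp
  qed
  then have "\<forall>\<^sub>F N in sequentially. c / (2 * real k) * real N \<le> real (card (cfrac_denoms A N))"
    using eventually_sequentially by blast
  moreover have "c / (2 * real k) > 0" using c0 k0 by simp
  ultimately show ?thesis by blast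
qed

end

theorem theorem4:
  fixes A :: "nat set"
  assumes "finite A" and "card A \<ge> 2" and "0 \<notin> A"
    and "hausdorff_dim (cfrac_limit_set A) > ennreal (1 - 1 / (8 + sqrt 34))"
  shows "\<exists>c::real. c > 0 \<and>
           (\<forall>\<^sub>F N in sequentially. real (card (cfrac_denoms A N)) \<ge> c * real N)"
proof -
  interpret alphabet A using assms by unfold_locales auto
  obtain \<delta> where \<delta>: "0 \<le> \<delta>" "\<forall>n. 1 \<le> psum \<delta> n \<and> psum \<delta> n \<le> 4 powr \<delta>" "\<forall>s>\<delta>. \<exists>n. psum s n < 1"
    using ex_critical_exponent by blast
  interpret critical_alphabet A \<delta> using \<delta> by unfold_locales auto
  have "ennreal (1 - 1 / (8 + sqrt 34)) < ennreal \<delta>"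
    using assms(4) hausdorff_dim_le_exponent[OF \<delta>(1,3)] by (rule less_le_trans)
  then have "1 - 1 / (8 + sqrt 34) < \<delta>" using ennreal_leI[of \<delta> "1 - 1 / (8 + sqrt 34)"] by (meson not_less)
  \<comment> \<open>As \<open>sqrt 34 \<ge> 16 / 3\<close>, the denominator is at least
    \<open>40 / 3\<close>.\<close>
  moreover have "1 / (8 + sqrt 34) \<le> 3 / 40"
  proof -
    have "(16 / 3)\<^sup>2 \<le> (34::real)" by (simp add: power2_eq_square)
    then have "16 / 3 \<le> sqrt 34" by (rule real_le_rsqrt)
    then show ?thesis by (simp add: field_simps)
  qed
  ultimately have "37 / 40 \<le> \<delta>" by simp
  then show ?thesis using positive_proportion by blast
qed

end
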